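(* Let $\mathbf{x}_1,\mathbf{x}_2,\ldots$ be i.i.d. from the normal mixture $\alpha_1\mathcal{N}_p(\boldsymbol{\mu}_1,\boldsymbol{\Sigma})+\alpha_2\mathcal{N}_p(\boldsymbol{\mu}_2,\boldsymbol{\Sigma})$, where $0<\alpha_1<1$, $\alpha_2=1-\alpha_1$, $\boldsymbol{\mu}_1\neq\boldsymbol{\mu}_2\in\mathbb{R}^p$ and $\boldsymbol{\Sigma}\in\mathbb{R}^{p\times p}$ is a full-rank covariance matrix. Let $w_1,w_2>0$ with $w_1+w_2=1$, and let $\mathbf{u}_n$ be any sequence of maximizers over $\mathbb{S}^{p-1}$ of $$\eta_n(\mathbf{u}):=w_1\gamma_n(\mathbf{u})^2+w_2\{\kappa_n(\mathbf{u})-3\}^2,$$ where $\gamma_n$ and $\kappa_n$ are the sample skewness and sample kurtosis of the projection of $\mathbf{x}_1,\ldots,\mathbf{x}_n$ onto $\mathbf{u}$. Let $\boldsymbol{\theta}=\boldsymbol{\Sigma}^{-1}(\boldsymbol{\mu}_2-\boldsymbol{\mu}_1)$, $\beta=\alpha_1\alpha_2$ and $\tau=(\boldsymbol{\mu}_2-\boldsymbol{\mu}_1)'\boldsymbol{\Sigma}^{-1}(\boldsymbol{\mu}_2-\boldsymbol{\mu}_1)$. Then there exists a sequence of (random) signs $s_n\in\{-1,1\}$ such that, as $n\to\infty$, 1) $s_n\mathbf{u}_n\to\boldsymbol{\theta}/\|\boldsymbol{\theta}\|$ almost surely; 2) $\sqrt{n}(s_n\mathbf{u}_n-\boldsymbol{\theta}/\|\boldsymbol{\theta}\|)\xrightarrow{d}\mathcal{N}_p(\mathbf{0},\boldsymbol{\Psi}_\eta)$,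 where $$\boldsymbol{\Psi}_\eta:=C_\eta\left(\frac{1+\beta\tau}{\|\boldsymbol{\theta}\|^2\beta}\right)\left(\mathbf{I}_p-\frac{\boldsymbol{\theta}\boldsymbol{\theta}'}{\|\boldsymbol{\theta}\|^2}\right)\boldsymbol{\Sigma}^{-1}\left(\mathbf{I}_p-\frac{\boldsymbol{\theta}\boldsymbol{\theta}'}{\|\boldsymbol{\theta}\|^2}\right)$$ and $$\begin{aligned}C_\eta=\;&\frac{(1+\beta\tau)(1-4\beta)\left(9w_1^2(1+\beta\tau)(2+6\beta\tau+\beta\tau^2)+24w_1w_2\tau^2\beta(1-6\beta)(6+\tau)\right)}{\beta\tau^2\{3w_1(1+\beta\tau)(1-4\beta)+4w_2\tau(1-6\beta)^2\}^2}\\&+\frac{16w_2^2\tau(1-6\beta)^2\Delta}{\beta\tau^2\{3w_1(1+\beta\tau)(1-4\beta)+4w_2\tau(1-6\beta)^2\}^2},\end{aligned}$$ with $\Delta:=6+24\beta\tau+9\beta(1-2\beta)\tau^2+\beta(1-3\beta)\tau^3$.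
   Context: A prime denotes transpose, $\|\cdot\|$ is the Euclidean norm, $\mathbb{S}^{p-1}$ is the unit sphere of $\mathbb{R}^p$, and $\xrightarrow{d}$ is convergence in distribution. With $\bar{\mathbf{x}}=(1/n)\sum_{i=1}^n\mathbf{x}_i$ and $\tilde{\mathbf{x}}_i:=\mathbf{x}_i-\bar{\mathbf{x}}$, define for $\mathbf{u}\in\mathbb{S}^{p-1}$ $$\gamma_n(\mathbf{u})=\frac{(1/n)\sum_{i=1}^n(\mathbf{u}'\tilde{\mathbf{x}}_i)^3}{\{(1/n)\sum_{i=1}^n(\mathbf{u}'\tilde{\mathbf{x}}_i)^2\}^{3/2}},\qquad \kappa_n(\mathbf{u})=\frac{(1/n)\sum_{i=1}^n(\mathbf{u}'\tilde{\mathbf{x}}_i)^4}{\{(1/n)\sum_{i=1}^n(\mathbf{u}'\tilde{\mathbf{x}}_i)^2\}^2}.$$ For $n$ large enough the denominators are almost surely positive for all $\mathbf{u}\in\mathbb{S}^{p-1}$, so that these functions are well-defined and continuous and maximizers exist. Each $\mathbf{u}_n$ is a random unit vector and the signs $s_n$ may depend on the sample. *)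

theory Defs
  imports "HOL-Probability.Probability"
begin

definition covariance_matrix :: "real^'n^'n \<Rightarrow> bool" where
  "covariance_matrix S \<longleftrightarrow> transpose S = S \<and> (\<forall>v. 0 \<le> v \<bullet> (S *v v))"

definition std_mvn :: "(real^'n) measure" where
  "std_mvn = distr (Pi\<^sub>M UNIV (\<lambda>_. std_normal_distribution)) borel (\<lambda>z. \<chi> i. z i)"

text \<open>
  The law of \<open>m + A Z\<close> with \<open>Z\<close> standard normal and \<open>A\<close> any square root of \<open>S\<close> in the sense
  \<open>A A' = S\<close>. Singular \<open>S\<close> are allowed (the law is then concentrated on an affine subspace).
  The lemma \<open>mvn_characteristic_function\<close> below shows that the law does not depend on the choice
  of \<open>A\<close>.
\<close>
definition mvn :: "real^'n \<Rightarrow> real^'n^'n \<Rightarrow> (real^'n) measure" where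
  "mvn m S = distr std_mvn borel (\<lambda>z. m + (SOME A :: real^'n^'n. A ** transpose A = S) *v z)"

definition mixture2 :: "real \<Rightarrow> 'a measure \<Rightarrow> real \<Rightarrow> 'a measure \<Rightarrow> 'a measure" where
  "mixture2 a P b Q = measure_of (space P) (sets P)
     (\<lambda>E. ennreal a * emeasure P E + ennreal b * emeasure Q E)"

text \<open>
  Convergence in distribution of random vectors to a law; the library only has the version
  for laws on the real line via distribution functions.
\<close>
definition converges_in_distribution ::
    "'a measure \<Rightarrow> (nat \<Rightarrow> 'a \<Rightarrow> 'b::euclidean_space) \<Rightarrow> 'b measure \<Rightarrow> bool" where
  "converges_in_distribution M Y P \<longleftrightarrow>
     (\<forall>f::'b \<Rightarrow> real. continuous_on UNIV f \<longrightarrow> bounded (range f) \<longrightarrow>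
        (\<lambda>n. \<integral>x. f x \<partial>distr M borel (Y n)) \<longlonglongrightarrow> (\<integral>x. f x \<partial>P))"

text \<open>The sample of size \<open>n\<close> consists of \<open>x 0, \<dots>, x (n - 1)\<close>.\<close>

definition sample_mean :: "(nat \<Rightarrow> real^'n) \<Rightarrow> nat \<Rightarrow> real^'n" where
  "sample_mean x n = (1 / real n) *\<^sub>R (\<Sum>i<n. x i)"

definition proj_moment :: "nat \<Rightarrow> (nat \<Rightarrow> real^'n) \<Rightarrow> nat \<Rightarrow> real^'n \<Rightarrow> real" where
  "proj_moment k x n u = (1 / real n) * (\<Sum>i<n. (u \<bullet> (x i - sample_mean x n)) ^ k)"

definition sample_skewness :: "(nat \<Rightarrow> real^'n) \<Rightarrow> nat \<Rightarrow> real^'n \<Rightarrow> real" where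
  "sample_skewness x n u = proj_moment 3 x n u / (proj_moment 2 x n u) powr (3 / 2)"

definition sample_kurtosis :: "(nat \<Rightarrow> real^'n) \<Rightarrow> nat \<Rightarrow> real^'n \<Rightarrow> real" where
  "sample_kurtosis x n u = proj_moment 4 x n u / (proj_moment 2 x n u)\<^sup>2"

definition eta_index :: "real \<Rightarrow> real \<Rightarrow> (nat \<Rightarrow> real^'n) \<Rightarrow> nat \<Rightarrow> real^'n \<Rightarrow> real" where
  "eta_index w1 w2 x n u =
     w1 * (sample_skewness x n u)\<^sup>2 + w2 * (sample_kurtosis x n u - 3)\<^sup>2"

definition Delta :: "real \<Rightarrow> real \<Rightarrow> real" where
  "Delta \<beta> \<tau> = 6 + 24 * \<beta> * \<tau> + 9 * \<beta> * (1 - 2 * \<beta>) * \<tau>\<^sup>2 + \<beta> * (1 - 3 * \<beta>) * \<tau> ^ 3"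

definition C_eta :: "real \<Rightarrow> real \<Rightarrow> real \<Rightarrow> real \<Rightarrow> real" where
  "C_eta w1 w2 \<beta> \<tau> =
     ((1 + \<beta> * \<tau>) * (1 - 4 * \<beta>) *
       (9 * w1\<^sup>2 * (1 + \<beta> * \<tau>) * (2 + 6 * \<beta> * \<tau> + \<beta> * \<tau>\<^sup>2)
        + 24 * w1 * w2 * \<tau>\<^sup>2 * \<beta> * (1 - 6 * \<beta>) * (6 + \<tau>)))
     / (\<beta> * \<tau>\<^sup>2 *
         (3 * w1 * (1 + \<beta> * \<tau>) * (1 - 4 * \<beta>) + 4 * w2 * \<tau> * (1 - 6 * \<beta>)\<^sup>2)\<^sup>2)
   + (16 * w2\<^sup>2 * \<tau> * (1 - 6 * \<beta>)\<^sup>2 * Delta \<beta> \<tau>)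
     / (\<beta> * \<tau>\<^sup>2 *
         (3 * w1 * (1 + \<beta> * \<tau>) * (1 - 4 * \<beta>) + 4 * w2 * \<tau> * (1 - 6 * \<beta>)\<^sup>2)\<^sup>2)"

text \<open>\<open>I - \<theta> \<theta>' / \<parallel>\<theta>\<parallel>\<^sup>2\<close>\<close>
definition proj_orth :: "real^'n \<Rightarrow> real^'n^'n" where
  "proj_orth \<theta> = mat 1 - (1 / (norm \<theta>)\<^sup>2) *\<^sub>R ((columnvector \<theta> :: real^1^'n) ** rowvector \<theta>)"

definition Psi_eta ::
    "real \<Rightarrow> real \<Rightarrow> real \<Rightarrow> real \<Rightarrow> real^'n \<Rightarrow> real^'n^'n \<Rightarrow> real^'n^'n" where
  "Psi_eta w1 w2 \<beta> \<tau> \<theta> \<Sigma> =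
     (C_eta w1 w2 \<beta> \<tau> * ((1 + \<beta> * \<tau>) / ((norm \<theta>)\<^sup>2 * \<beta>))) *\<^sub>R
       (proj_orth \<theta> ** matrix_inv \<Sigma> ** proj_orth \<theta>)"


lemma measurable_vec_PiM [measurable]:
  "(\<lambda>z. \<chi> i. z i) \<in> borel_measurable (Pi\<^sub>M UNIV (\<lambda>_::'n::finite. std_normal_distribution))"
proof -
  have "(\<lambda>z. (\<chi> i. z i) \<bullet> b) \<in> borel_measurable (Pi\<^sub>M UNIV (\<lambda>_::'n. std_normal_distribution))"
    if "b \<in> Basis" for b :: "real^'n"
  proof -
    have "(\<lambda>z. z i) \<in> borel_measurable (Pi\<^sub>M UNIV (\<lambda>_::'n. std_normal_distribution))" for i
      using measurable_component_singleton[of i UNIV "\<lambda>_::'n. std_normal_distribution"]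
      by (simp add: measurable_def)
    then show ?thesis
      by (auto simp: inner_vec_def intro!: borel_measurable_sum borel_measurable_times)
  qed
  then show ?thesis
    by (subst borel_measurable_euclidean_space) auto
qed

lemma prob_space_std_mvn: "prob_space (std_mvn :: (real^'n) measure)"
proof -
  interpret N: prob_space std_normal_distribution
    by (rule prob_space_normal_density) simp
  interpret product_prob_space "\<lambda>_::'n. std_normal_distribution" UNIV
    by unfold_locales
  show ?thesis
    unfolding std_mvn_def by (rule prob_space_distr) (rule measurable_vec_PiM)
qed

lemma sets_std_mvn [measurable_cong]: "sets std_mvn = sets borel"
  by (simp add: std_mvn_def)

lemma measurable_affine [measurable]:
  "(\<lambda>z. m + A *v z) \<in> borel_measurable (borel :: (real^'n) measure)" for A :: "real^'n^'m"
  by (intro borel_measurable_continuous_onI continuous_intros)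

lemma prob_space_mvn: "prob_space (mvn m S)"
proof -
  interpret prob_space "std_mvn :: (real^'n) measure"
    by (rule prob_space_std_mvn)
  show ?thesis
    unfolding mvn_def by (rule prob_space_distr) measurable
qed

lemma sets_mvn [measurable_cong]: "sets (mvn m S) = sets borel"
  by (simp add: mvn_def)

lemma space_mvn: "space (mvn m S) = UNIV"
  by (simp add: mvn_def)

lemma std_mvn_characteristic_function:
  "(\<integral>z. iexp (v \<bullet> z) \<partial>std_mvn) = of_real (exp (- (v \<bullet> v) / 2))" for v :: "real^'n"
proof -
  interpret N: prob_space std_normal_distribution
    by (rule prob_space_normal_density) simp
  interpret P: product_prob_space "\<lambda>_::'n. std_normal_distribution" UNIV
    by unfold_locales
  have int: "integrable std_normal_distribution (\<lambda>x. iexp (t * x))" for t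
    by (rule N.integrable_const_bound[where B=1]) auto
  have "(\<integral>z. iexp (v \<bullet> z) \<partial>std_mvn) =
      (\<integral>z. iexp (v \<bullet> (\<chi> i. z i)) \<partial>Pi\<^sub>M UNIV (\<lambda>_::'n. std_normal_distribution))"
    unfolding std_mvn_def
    by (rule integral_distr) (auto intro!: measurable_vec_PiM)
  also have "\<dots> = (\<integral>z. (\<Prod>i\<in>UNIV. iexp (v $ i * z i))
      \<partial>Pi\<^sub>M UNIV (\<lambda>_::'n. std_normal_distribution))"
    by (simp add: inner_vec_def sum_distrib_left exp_sum)
  also have "\<dots> = (\<Prod>i\<in>UNIV. \<integral>x. iexp (v $ i * x) \<partial>std_normal_distribution)"
    using int by (intro P.product_integral_prod) auto
  also have "\<dots> = (\<Prod>i\<in>UNIV. char std_normal_distribution (v $ i))"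
    by (simp add: char_def)
  also have "\<dots> = (\<Prod>i\<in>UNIV. of_real (exp (- ((v $ i)\<^sup>2) / 2)))"
    by (simp only: char_std_normal_distribution)
  also have "\<dots> = of_real (exp (\<Sum>i\<in>UNIV. - ((v $ i)\<^sup>2) / 2))"
    by (simp only: exp_sum[OF finite] of_real_prod)
  also have "(\<Sum>i\<in>UNIV. - ((v $ i)\<^sup>2) / 2) = - (v \<bullet> v) / 2"
    by (simp add: inner_vec_def sum_negf sum_divide_distrib power2_eq_square)
  finally show ?thesis .
qed

lemma mvn_characteristic_function:
  fixes A S :: "real^'n^'n"
  assumes "A ** transpose A = S"
  shows "(\<integral>x. iexp (v \<bullet> x) \<partial>mvn m S) =
    iexp (v \<bullet> m) * of_real (exp (- (v \<bullet> (S *v v)) / 2))"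
proof -
  define B where "B = (SOME A :: real^'n^'n. A ** transpose A = S)"
  have B: "B ** transpose B = S"
    unfolding B_def using assms by (rule someI)
  have "(\<integral>x. iexp (v \<bullet> x) \<partial>mvn m S) = (\<integral>z. iexp (v \<bullet> (m + B *v z)) \<partial>std_mvn)"
    unfolding mvn_def B_def[symmetric] by (rule integral_distr) measurable
  also have "\<dots> = (\<integral>z. iexp (v \<bullet> m) * iexp ((transpose B *v v) \<bullet> z) \<partial>std_mvn)"
    by (simp add: inner_add_right distrib_left exp_add dot_lmul_matrix)
  also have "\<dots> = iexp (v \<bullet> m) * of_real (exp (- ((transpose B *v v) \<bullet> (transpose B *v v)) / 2))"
    by (simp only: integral_mult_right_zero std_mvn_characteristic_function)
  also have "(transpose B *v v) \<bullet> (transpose B *v v) = v \<bullet> (S *v v)"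
    by (simp add: B[symmetric] dot_lmul_matrix matrix_vector_mul_assoc[symmetric])
  finally show ?thesis .
qed

lemma emeasure_mixture2:
  assumes sets: "sets Q = sets P" and E: "E \<in> sets P"
  shows "emeasure (mixture2 a P b Q) E = ennreal a * emeasure P E + ennreal b * emeasure Q E"
proof (rule emeasure_measure_of[OF mixture2_def])
  show "sets P \<subseteq> Pow (space P)"
    by (rule sets.space_closed)
  show "E \<in> sets (mixture2 a P b Q)"
    using E by (simp add: mixture2_def)
  show "positive (sets (mixture2 a P b Q))
      (\<lambda>E. ennreal a * emeasure P E + ennreal b * emeasure Q E)"
    by (simp add: positive_def)
  show "countably_additive (sets (mixture2 a P b Q))
      (\<lambda>E. ennreal a * emeasure P E + ennreal b * emeasure Q E)"
  proof (rule countably_additiveI)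
    fix F :: "nat \<Rightarrow> 'a set"
    assume "range F \<subseteq> sets (mixture2 a P b Q)" and F: "disjoint_family F"
    then have "range F \<subseteq> sets P" "range F \<subseteq> sets Q"
      using sets by (simp_all add: mixture2_def)
    then show "(\<Sum>i. ennreal a * emeasure P (F i) + ennreal b * emeasure Q (F i)) =
        ennreal a * emeasure P (\<Union>i. F i) + ennreal b * emeasure Q (\<Union>i. F i)"
      using F by (simp add: suminf_add[symmetric] suminf_emeasure)
  qed
qed

end

theory Submission
  imports Defs "HOL-Real_Asymp.Real_Asymp" "HOL-Computational_Algebra.Polynomial"
begin

text \<open>
  Projections along directions \<open>e\<close> orthogonal to \<open>\<delta> = \<mu>2 - \<mu>1\<close> do not see the mixture: \<open>W = e \<bullet> (x - mean)\<close> is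
  centred normal and independent of the discriminating projection \<open>Z = \<theta> \<bullet> (x - mean)\<close>. In the population the
  index is an increasing function of \<open>(u \<bullet> \<delta>)\<^sup>2 / u \<bullet> \<Sigma> u\<close>, which by the Cauchy-Schwarz inequality is maximal exactly
  in the direction of \<open>\<theta>\<close>; compactness of the sphere and the strong law for polynomials give consistency.

  The index is invariant under rescaling, so the maximizer may be normalized to \<open>\<theta> + h\<close> with \<open>h \<bullet> \<delta> = 0\<close>. All
  sample moments are polynomials in the direction, hence the first-order condition in a direction \<open>e \<bottom> \<delta>\<close> is
  exactly \<open>0 = S e + B e h\<close> without a Taylor remainder. Here \<open>B\<close> converges to \<open>curv\<close> times the form \<open>\<Sigma>\<close> on
  the orthogonal complement of \<open>\<delta>\<close>, with \<open>curv < 0\<close>, and \<open>S e\<close> is up to smaller terms the average of \<open>g(Z) W\<close> for a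
  cubic \<open>g\<close>. Testing with the element \<open>dual b\<close> representing \<open>b\<close> with respect to \<open>\<Sigma>\<close> shows that \<open>b \<bullet> h\<close> is
  asymptotically an average of independent centred variables. The one-dimensional central limit theorem
  and the continuity theorem for characteristic functions in several dimensions yield the limit law, whose
  covariance is computed from the first six moments of \<open>Z\<close>.
\<close>

section \<open>Square roots of covariance matrices\<close>

text \<open>A Taylor remainder could only be neglected with a rate for the maximizer in hand. In the
  exact condition the form \<open>B\<close> still depends on \<open>h\<close>, and its convergence
  is available for fixed arguments only. Hence \<open>h\<close> is expanded in finitely many fixed
  vectors orthogonal to \<delta>; the errors of \<open>B\<close> then multiply coordinates of
  \<open>h\<close> and are absorbed because \<open>curv\<close> is nonzero. The rate of
  \<open>h\<close> thus comes out of the condition itself. All of this happens along one sample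
  path: remainders are o(1) multiples of a sum \<open>T n\<close> of absolute averages, and
  probability returns only through the bounded expectation of sqrt n times \<open>T n\<close>. Both
  parts of the index are needed for strict monotonicity and for \<open>curv < 0\<close>: the
  skewness part degenerates at \<beta> = 1/4 and the kurtosis part at \<beta> = 1/6, never both
  together. Weighting them by \<open>3 * w1 * \<epsilon> * D\<close> and \<open>4 * w2 * k\<close>,
  with \<epsilon> = \<alpha>1 - \<alpha>2, D = 1 + \<beta> \<tau> and k = 1 - 6 \<beta>, splits the
  cubic \<open>g\<close> into two cubics, whose second moments and mixed moment are the three
  numerator terms of \<open>C_eta\<close>.\<close>

lemma inner_symmetric_matrix:
  fixes S :: "real^'n^'n"
  assumes "transpose S = S"
  shows "v \<bullet> (S *v w) = w \<bullet> (S *v v)"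
  by (metis assms dot_lmul_matrix inner_commute transpose_matrix_vector)

text \<open>Symmetric elimination: the induction runs over an index set outside which
  \<open>S\<close> vanishes, and each step splits off one column and passes to the Schur complement.
  The support clause for \<open>A\<close> keeps column \<open>i\<close> free for the column split
  off. Zero pivots must be handled because the limit covariance annihilates \<theta>.\<close>

lemma covariance_matrix_sqrt_on:
  fixes S :: "real^'n^'n"
  assumes "finite I" "covariance_matrix S" "\<And>j k. S $ j $ k \<noteq> 0 \<Longrightarrow> j \<in> I \<and> k \<in> I"
  shows "\<exists>A. A ** transpose A = S \<and> (\<forall>j k. A $ j $ k \<noteq> 0 \<longrightarrow> k \<in> I)"
  using assms
proof (induction I arbitrary: S rule: finite_induct)
  case empty
  then have "S = 0" by (auto simp: vec_eq_iff)
  then show ?case by (intro exI[of _ 0]) (auto simp: vec_eq_iff matrix_matrix_mult_def)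
next
  case (insert i I)
  have sym: "transpose S = S" and psd: "\<And>v. 0 \<le> v \<bullet> (S *v v)"
    using insert.prems(1) by (auto simp: covariance_matrix_def)
  have symc: "S $ j $ k = S $ k $ j" for j k
    using sym by (metis (no_types, lifting) transpose_def vec_lambda_beta)
  define c where "c v = v \<bullet> (S *v axis i 1)" for v
  \<comment> \<open>A nonnegative quadratic polynomial in \<open>r\<close>: for a zero pivot it is
    affine, which forces \<open>c\<close> to vanish on the axes; for a positive pivot its minimum is
    the form of the Schur complement.\<close>
  have expand: "(v + r *\<^sub>R axis i 1) \<bullet> (S *v (v + r *\<^sub>R axis i 1)) = v \<bullet> (S *v v) + 2 * r * c v + r\<^sup>2 * S $ i $ i" for v r
  proof -
    have "axis i 1 \<bullet> (S *v axis i 1) = S $ i $ i"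
      by (simp add: inner_axis' matrix_vector_mult_basis column_def)
    moreover have "axis i 1 \<bullet> (S *v v) = c v"
      unfolding c_def by (rule inner_symmetric_matrix[OF sym])
    moreover have "v \<bullet> (S *v axis i 1) = c v" by (simp add: c_def)
    ultimately show ?thesis
      by (simp add:           power2_eq_square algebra_simps)
  qed
  have c_axis: "c (axis j 1) = S $ j $ i" for j
    by (simp add: c_def inner_axis' matrix_vector_mult_basis column_def)
  show ?case
  proof (cases "S $ i $ i = 0")
    case True
    have "S $ j $ i = 0" for j
    proof (rule ccontr)
      assume ne: "S $ j $ i \<noteq> 0"
      let ?v = "axis j 1 :: real^'n"
      \<comment> \<open>Chosen so that the affine function of \<open>r\<close> takes the value
        -1.\<close>
      let ?r = "- (?v \<bullet> (S *v ?v) + 1) / (2 * S $ j $ i)"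
      have "0 \<le> (?v + ?r *\<^sub>R axis i 1) \<bullet> (S *v (?v + ?r *\<^sub>R axis i 1))" by (rule psd)
      also have "\<dots> = -1" unfolding expand using ne True by (simp add: c_axis field_simps)
      finally show False by simp
    qed
    then have "j \<in> I \<and> k \<in> I" if "S $ j $ k \<noteq> 0" for j k
      using insert.prems(2)[OF that] that symc by (metis insertE)
    from insert.IH[OF insert.prems(1) this] show ?thesis by auto
  next
    case False
    have pos: "S $ i $ i > 0"
    proof -
      have "0 \<le> axis i 1 \<bullet> (S *v axis i 1)" by (rule psd)
      then show ?thesis using False by (simp add: inner_axis' matrix_vector_mult_basis column_def)
    qed
    define S' :: "real^'n^'n" where "S' = (\<chi> j k. S $ j $ k - S $ j $ i * S $ k $ i / S $ i $ i)"
    have S'v: "v \<bullet> (S' *v v) = v \<bullet> (S *v v) - (c v)\<^sup>2 / S $ i $ i" for v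
    proof -
      have cv: "c v = (\<Sum>j\<in>UNIV. v $ j * S $ j $ i)"
        by (simp add: c_def inner_vec_def matrix_vector_mult_basis column_def)
      show ?thesis
        unfolding cv by (simp add: inner_vec_def matrix_vector_mult_def S'_def power2_eq_square
            sum_product sum_distrib_left sum_divide_distrib left_diff_distrib right_diff_distrib
            sum_subtractf algebra_simps)
    qed
    have "covariance_matrix S'"
      unfolding covariance_matrix_def
    proof
      show "transpose S' = S'" using symc by (simp add: S'_def transpose_def vec_eq_iff algebra_simps)
      show "\<forall>v. 0 \<le> v \<bullet> (S' *v v)"
      proof
        fix v
        \<comment> \<open>Evaluation at the minimizing \<open>r = - c v / S $ i $ i\<close>.\<close>
        have "0 \<le> v \<bullet> (S *v v) + 2 * (- c v / S $ i $ i) * c v + (- c v / S $ i $ i)\<^sup>2 * S $ i $ i"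
          using psd[of "v + (- c v / S $ i $ i) *\<^sub>R axis i 1"] unfolding expand .
        also have "\<dots> = v \<bullet> (S' *v v)" unfolding S'v using pos by (simp add: field_simps power2_eq_square)
        finally show "0 \<le> v \<bullet> (S' *v v)" .
      qed
    qed
    moreover have "j \<in> I \<and> k \<in> I" if nz: "S' $ j $ k \<noteq> 0" for j k
    proof -
      have "j \<in> insert i I" "k \<in> insert i I"
        using nz insert.prems(2)[of j k] insert.prems(2)[of j i] insert.prems(2)[of k i]
        by (cases "S $ j $ k = 0"; cases "S $ j $ i = 0"; cases "S $ k $ i = 0"; auto simp: S'_def)+
      moreover have "j \<noteq> i" "k \<noteq> i" using nz pos symc[of j i] symc[of k i] by (auto simp: S'_def)
      ultimately show ?thesis by auto
    qed
    ultimately obtain A' where A': "A' ** transpose A' = S'" "\<And>j k. A' $ j $ k \<noteq> 0 \<Longrightarrow> k \<in> I"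
      using insert.IH by metis
    have A'i: "A' $ j $ i = 0" for j using A'(2) insert.hyps by blast
    \<comment> \<open>Column \<open>i\<close> of \<open>A'\<close> is zero by its support, so it can
      carry the rank-one part removed from \<open>S\<close>.\<close>
    define A :: "real^'n^'n" where "A = (\<chi> j k. if k = i then S $ j $ i / sqrt (S $ i $ i) else A' $ j $ k)"
    have "(A ** transpose A) $ j $ l = S $ j $ l" for j l
    proof -
      have "(A ** transpose A) $ j $ l = (\<Sum>k\<in>UNIV. A $ j $ k * A $ l $ k)"
        by (simp add: matrix_matrix_mult_def transpose_def)
      also have "\<dots> = (\<Sum>k\<in>UNIV. A' $ j $ k * A' $ l $ k + (if k = i then S $ j $ i * S $ l $ i / S $ i $ i else 0))"
        using pos by (intro sum.cong) (auto simp: A_def A'i)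
      also have "\<dots> = (A' ** transpose A') $ j $ l + S $ j $ i * S $ l $ i / S $ i $ i"
        by (simp add: sum.distrib matrix_matrix_mult_def transpose_def)
      also have "\<dots> = S $ j $ l" unfolding A'(1) by (simp add: S'_def)
      finally show ?thesis .
    qed
    then have "A ** transpose A = S" by (simp add: vec_eq_iff)
    moreover have "A $ j $ k \<noteq> 0 \<Longrightarrow> k \<in> insert i I" for j k using A'(2) by (auto simp: A_def split: if_splits)
    ultimately show ?thesis by blast
  qed
qed

lemma covariance_matrix_sqrt:
  assumes "covariance_matrix S"
  obtains A :: "real^'n^'n" where "A ** transpose A = S"
  using covariance_matrix_sqrt_on[of UNIV S] assms by auto

section \<open>Convergence of characteristic functions\<close>

text \<open>The Gaussian kernel is itself the characteristic function of \<open>std_mvn\<close>,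
  evaluated at \<open>c *\<^sub>R (y - x)\<close>. After Fubini the Gaussian-smoothed
  \<open>Q\<close> depends on \<open>Q\<close> only through its characteristic function.\<close>

lemma gaussian_average_eq_char_average:
  fixes Q :: "(real^'n) measure"
  assumes "prob_space Q" and [measurable_cong]: "sets Q = sets borel"
  shows "complex_of_real (\<integral>x. exp (- (norm (c *\<^sub>R (y - x)))\<^sup>2 / 2) \<partial>Q) =
    (\<integral>z. iexp (c * (y \<bullet> z)) * (\<integral>x. iexp ((- c *\<^sub>R z) \<bullet> x) \<partial>Q) \<partial>(std_mvn :: (real^'n) measure))"
proof -
  interpret Q: prob_space Q by fact
  interpret N: prob_space "std_mvn :: (real^'n) measure" by (rule prob_space_std_mvn)
  interpret pair_prob_space Q "std_mvn :: (real^'n) measure" ..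
  have "complex_of_real (\<integral>x. exp (- (norm (c *\<^sub>R (y - x)))\<^sup>2 / 2) \<partial>Q) =
      (\<integral>x. complex_of_real (exp (- ((c *\<^sub>R (y - x)) \<bullet> (c *\<^sub>R (y - x))) / 2)) \<partial>Q)"
    unfolding power2_norm_eq_inner by (rule integral_complex_of_real[symmetric])
  also have "\<dots> = (\<integral>x. (\<integral>z. iexp ((c *\<^sub>R (y - x)) \<bullet> z) \<partial>(std_mvn :: (real^'n) measure)) \<partial>Q)"
    by (subst std_mvn_characteristic_function) simp
  also have "\<dots> = (\<integral>z. (\<integral>x. iexp ((c *\<^sub>R (y - x)) \<bullet> z) \<partial>Q) \<partial>(std_mvn :: (real^'n) measure))"
  proof (rule Fubini_integral[symmetric])
    show "integrable (Q \<Otimes>\<^sub>M (std_mvn :: (real^'n) measure)) (\<lambda>(x, z). iexp ((c *\<^sub>R (y - x)) \<bullet> z))"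
      by (rule P.integrable_const_bound[where B=1]) (auto simp: case_prod_beta)
  qed
  also have "\<dots> = (\<integral>z. (\<integral>x. iexp (c * (y \<bullet> z)) * iexp ((- c *\<^sub>R z) \<bullet> x) \<partial>Q) \<partial>(std_mvn :: (real^'n) measure))"
    by (simp add: exp_add[symmetric] inner_diff_left algebra_simps inner_commute)
  also have "\<dots> = (\<integral>z. iexp (c * (y \<bullet> z)) * (\<integral>x. iexp ((- c *\<^sub>R z) \<bullet> x) \<partial>Q) \<partial>(std_mvn :: (real^'n) measure))"
    by simp
  finally show ?thesis .
qed

text \<open>Dominated convergence under \<open>std_mvn\<close>: characteristic functions are bounded
  by 1.\<close>

lemma gaussian_average_tendsto:
  fixes \<nu> :: "nat \<Rightarrow> (real^'n) measure" and P :: "(real^'n) measure"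
  assumes \<nu>: "\<And>n. prob_space (\<nu> n)" "\<And>n. sets (\<nu> n) = sets borel"
    and P: "prob_space P" "sets P = sets borel"
    and conv: "\<And>v. (\<lambda>n. \<integral>x. iexp (v \<bullet> x) \<partial>\<nu> n) \<longlonglongrightarrow> (\<integral>x. iexp (v \<bullet> x) \<partial>P)"
  shows "(\<lambda>n. \<integral>x. exp (- (norm (c *\<^sub>R (y - x)))\<^sup>2 / 2) \<partial>\<nu> n) \<longlonglongrightarrow>
    (\<integral>x. exp (- (norm (c *\<^sub>R (y - x)))\<^sup>2 / 2) \<partial>P)"
proof -
  interpret N: prob_space "std_mvn :: (real^'n) measure" by (rule prob_space_std_mvn)
  have meas: "(\<lambda>z. \<integral>x. iexp ((- c *\<^sub>R z) \<bullet> x) \<partial>Q) \<in> borel_measurable (std_mvn :: (real^'n) measure)"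
    if "prob_space Q" and [measurable_cong]: "sets Q = sets borel" for Q :: "(real^'n) measure"
  proof -
    interpret Q: prob_space Q by fact
    show ?thesis
      by (rule Q.borel_measurable_lebesgue_integral) measurable
  qed
  have bd: "cmod (\<integral>x. iexp ((- c *\<^sub>R z) \<bullet> x) \<partial>Q) \<le> 1"
    if "prob_space Q" and [measurable_cong]: "sets Q = sets borel" for Q :: "(real^'n) measure" and z
  proof -
    interpret Q: prob_space Q by fact
    have "cmod (\<integral>x. iexp ((- c *\<^sub>R z) \<bullet> x) \<partial>Q) \<le> (\<integral>x. norm (iexp ((- c *\<^sub>R z) \<bullet> x)) \<partial>Q)"
      by (rule integral_norm_bound)
    also have "\<dots> = 1" by (simp add: Q.prob_space)
    finally show ?thesis .
  qed
  have "(\<lambda>n. complex_of_real (\<integral>x. exp (- (norm (c *\<^sub>R (y - x)))\<^sup>2 / 2) \<partial>\<nu> n)) \<longlonglongrightarrow>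
    complex_of_real (\<integral>x. exp (- (norm (c *\<^sub>R (y - x)))\<^sup>2 / 2) \<partial>P)"
    unfolding gaussian_average_eq_char_average[OF \<nu>] gaussian_average_eq_char_average[OF P]
  proof (rule integral_dominated_convergence[where w="\<lambda>_. 1"])
    show "(\<lambda>z. iexp (c * (y \<bullet> z)) * (\<integral>x. iexp ((- c *\<^sub>R z) \<bullet> x) \<partial>P)) \<in> borel_measurable std_mvn"
      using meas[OF P] by measurable
    show "(\<lambda>z. iexp (c * (y \<bullet> z)) * (\<integral>x. iexp ((- c *\<^sub>R z) \<bullet> x) \<partial>\<nu> n)) \<in> borel_measurable std_mvn" for n
      using meas[OF \<nu>] by measurable
    show "AE z in std_mvn. (\<lambda>n. iexp (c * (y \<bullet> z)) * (\<integral>x. iexp ((- c *\<^sub>R z) \<bullet> x) \<partial>\<nu> n)) \<longlonglongrightarrow>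
        iexp (c * (y \<bullet> z)) * (\<integral>x. iexp ((- c *\<^sub>R z) \<bullet> x) \<partial>P)"
      by (intro AE_I2 tendsto_mult tendsto_const conv)
    show "AE z in std_mvn. cmod (iexp (c * (y \<bullet> z)) * (\<integral>x. iexp ((- c *\<^sub>R z) \<bullet> x) \<partial>\<nu> n)) \<le> 1" for n
      unfolding norm_mult norm_exp_i_times using bd[OF \<nu>] by (intro AE_I2) simp
  qed simp
  then show ?thesis by (simp only: tendsto_of_real_iff)
qed

section \<open>Smoothing with the Gaussian kernel\<close>

lemma integrable_gaussian_kernel:
  "integrable lborel (\<lambda>z :: 'a::euclidean_space. exp (- (norm z)\<^sup>2 / 2))"
proof (rule integrableI_bounded)
  have "integrable lborel (\<lambda>x::real. exp (- x\<^sup>2 / 2))"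
    using integrable_mult_right[OF integrable_std_normal_moment[of 0], of "sqrt (2 * pi)"]
    by (simp add: std_normal_density_def)
  then have int: "(\<integral>\<^sup>+x. ennreal (exp (- x\<^sup>2 / 2)) \<partial>lborel) < \<infinity>"
    by (simp add: integrable_iff_bounded)
  have "(\<integral>\<^sup>+(z::'a). ennreal (norm (exp (- (norm z)\<^sup>2 / 2))) \<partial>lborel) =
      (\<integral>\<^sup>+(z::'a). (\<Prod>b\<in>Basis. ennreal (exp (- (z \<bullet> b)\<^sup>2 / 2))) \<partial>lborel)"
  proof (intro nn_integral_cong)
    fix z :: 'a
    have "exp (- (norm z)\<^sup>2 / 2) = (\<Prod>b\<in>Basis. exp (- (z \<bullet> b)\<^sup>2 / 2))"
      unfolding power2_norm_eq_inner
      by (subst euclidean_inner)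
         (simp add: exp_sum[symmetric] sum_negf sum_divide_distrib power2_eq_square)
    then show "ennreal (norm (exp (- (norm z)\<^sup>2 / 2))) = (\<Prod>b\<in>Basis. ennreal (exp (- (z \<bullet> b)\<^sup>2 / 2)))"
      by (simp add: prod_ennreal prod_nonneg abs_of_nonneg)
  qed
  also have "\<dots> = (\<Prod>b\<in>(Basis :: 'a set). (\<integral>\<^sup>+x. ennreal (exp (- x\<^sup>2 / 2)) \<partial>lborel))"
    by (rule nn_integral_lborel_prod) auto
  also have "\<dots> < \<infinity>" using int by (simp add: ennreal_prod_eq_top less_top power_less_top_ennreal)
  finally show "(\<integral>\<^sup>+(z::'a). ennreal (norm (exp (- (norm z)\<^sup>2 / 2))) \<partial>lborel) < \<infinity>" .
qed simp

text \<open>The kernel is nowhere zero, so a vanishing integral would make the whole space a null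
  set.\<close>

lemma integral_gaussian_kernel_pos:
  "0 < (\<integral>(z::'a::euclidean_space). exp (- (norm z)\<^sup>2 / 2) \<partial>lborel)"
proof -
  have "(\<integral>(z::'a). exp (- (norm z)\<^sup>2 / 2) \<partial>lborel) \<noteq> 0"
    using integral_nonneg_eq_0_iff_AE[OF integrable_gaussian_kernel[where 'a='a]]
    by (simp add: ae_filter_eq_bot_iff emeasure_lborel_UNIV)
  moreover have "0 \<le> (\<integral>(z::'a). exp (- (norm z)\<^sup>2 / 2) \<partial>lborel)"
    by simp
  ultimately show ?thesis by linarith
qed

lemma uniformly_continuous_bounded_support:
  fixes f :: "'a::euclidean_space \<Rightarrow> real"
  assumes "continuous_on UNIV f" "\<And>x. norm x > R \<Longrightarrow> f x = 0"
  shows "uniformly_continuous_on UNIV f"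
  unfolding uniformly_continuous_on_def
proof (intro allI impI)
  fix e :: real assume e: "0 < e"
  have "uniformly_continuous_on (cball 0 (R + 1)) f"
    by (intro compact_uniformly_continuous continuous_on_subset[OF assms(1)]) auto
  then obtain d where d: "d > 0" "\<And>x y. x \<in> cball 0 (R+1) \<Longrightarrow> y \<in> cball 0 (R+1) \<Longrightarrow> dist x y < d \<Longrightarrow> dist (f x) (f y) < e"
    unfolding uniformly_continuous_on_def using e by metis
  \<comment> \<open>The cap 1 matters when one point leaves the ball of radius \<open>R + 1\<close>:
    then both points lie beyond \<open>R\<close>, where \<open>f\<close> vanishes.\<close>
  have "dist (f y) (f x) < e" if "dist y x < min d 1" for x y
  proof (cases "norm x \<le> R + 1 \<and> norm y \<le> R + 1")
    case True then show ?thesis using d that by auto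
  next
    case False
    have "norm x > R \<and> norm y > R"
      using False that norm_triangle_sub[of x y] norm_triangle_sub[of y x]
      by (auto simp: dist_norm norm_minus_commute)
    then show ?thesis using assms(2) e by auto
  qed
  then show "\<exists>d>0. \<forall>x\<in>UNIV. \<forall>x'\<in>UNIV. dist x' x < d \<longrightarrow> dist (f x') (f x) < e"
    using d(1) by (intro exI[of _ "min d 1"]) auto
qed

lemma integral_gaussian_kernel_affine:
  fixes f :: "'a::euclidean_space \<Rightarrow> real"
  assumes c: "0 < c" and [measurable]: "f \<in> borel_measurable borel"
  shows "(\<integral>y. f y * exp (- (norm (c *\<^sub>R (y - x)))\<^sup>2 / 2) \<partial>lborel) =
    (1 / c) ^ DIM('a) * (\<integral>z. f (x + (1/c) *\<^sub>R z) * exp (- (norm z)\<^sup>2 / 2) \<partial>lborel)"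
proof -
  have "(\<integral>y. f y * exp (- (norm (c *\<^sub>R (y - x)))\<^sup>2 / 2) \<partial>lborel) =
    (\<integral>y. f y * exp (- (norm (c *\<^sub>R (y - x)))\<^sup>2 / 2) \<partial>density (distr lborel borel (\<lambda>z. x + (1/c) *\<^sub>R z)) (\<lambda>_. ennreal (\<bar>1/c\<bar>^DIM('a))))"
    using lborel_affine[of "1/c" x] c by (simp add: ennreal_power)
  also have "\<dots> = (\<integral>z. \<bar>1/c\<bar>^DIM('a) * (f (x + (1/c) *\<^sub>R z) * exp (- (norm (c *\<^sub>R ((x + (1/c) *\<^sub>R z) - x)))\<^sup>2 / 2)) \<partial>lborel)"
    by (subst integral_density, (simp; fail)+, subst integral_distr) simp_all
  also have "\<dots> = (1 / c) ^ DIM('a) * (\<integral>z. f (x + (1/c) *\<^sub>R z) * exp (- (norm z)\<^sup>2 / 2) \<partial>lborel)"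
    using c by simp
  finally show ?thesis .
qed

text \<open>The kernel mass is split at \<open>norm z = d * c\<close>. Inside, uniform continuity
  gives \<open>\<eta> / 2\<close>; outside, \<open>f\<close> changes by at most \<open>2 * B\<close>
  while the tail mass of the kernel tends to zero.\<close>

lemma gaussian_smoothing_uniform:
  fixes f :: "'a::euclidean_space \<Rightarrow> real"
  assumes cont: "continuous_on UNIV f" and supp: "\<And>x. norm x > R \<Longrightarrow> f x = 0"
    and bd: "\<And>x. \<bar>f x\<bar> \<le> B" and \<eta>: "\<eta> > 0"
  obtains c where "c > 0"
    "\<And>x. \<bar>(\<integral>z. f (x + (1/c) *\<^sub>R z) * exp (- (norm z)\<^sup>2 / 2) \<partial>lborel) /
        (\<integral>(z::'a). exp (- (norm z)\<^sup>2 / 2) \<partial>lborel) - f x\<bar> \<le> \<eta>"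
proof -
  let ?k = "\<lambda>z :: 'a. exp (- (norm z)\<^sup>2 / 2)"
  let ?C = "\<integral>z. ?k z \<partial>lborel"
  have C: "?C > 0" by (rule integral_gaussian_kernel_pos)
  note [simp] = integrable_gaussian_kernel integrable_gaussian_kernel[simplified]
  have [measurable]: "f \<in> borel_measurable borel" using cont by (rule borel_measurable_continuous_onI)
  have B: "B \<ge> 0" using bd[of 0] by linarith
  obtain d where d: "d > 0" "\<And>x y. dist y x < d \<Longrightarrow> dist (f y) (f x) < \<eta> / 2"
    using uniformly_continuous_bounded_support[OF cont supp] \<eta>
    unfolding uniformly_continuous_on_def by (metis UNIV_I half_gt_zero)
  have "(\<lambda>m. \<integral>z. indicator {z. norm z \<ge> d * real m} z * ?k z \<partial>lborel) \<longlonglongrightarrow> (\<integral>(z::'a). 0 \<partial>lborel)"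
  proof (rule integral_dominated_convergence[where w="?k"])
    show "AE x :: 'a in lborel. (\<lambda>m. indicator {z. norm z \<ge> d * real m} x * ?k x) \<longlonglongrightarrow> 0"
    proof (rule AE_I2)
      fix x :: 'a
      have "\<forall>\<^sub>F m in sequentially. norm x < d * real m"
        using d(1) by real_asymp
      then have "\<forall>\<^sub>F m in sequentially. indicator {z. norm z \<ge> d * real m} x * ?k x = 0"
        by eventually_elim auto
      then show "(\<lambda>m. indicator {z. norm z \<ge> d * real m} x * ?k x) \<longlonglongrightarrow> 0"
        by (rule tendsto_eventually)
    qed
  qed (auto simp: indicator_def)
  then have "(\<lambda>m. \<integral>z. indicator {z. norm z \<ge> d * real m} z * ?k z \<partial>lborel) \<longlonglongrightarrow> 0" by simp
  \<comment> \<open>Multiplied by \<open>2 * B\<close> this bound stays below half of \<eta> times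
    the total mass; \<open>B + 1\<close> keeps the divisor positive when
    \<open>B = 0\<close>.\<close>
  then have "\<forall>\<^sub>F m in sequentially. (\<integral>z. indicator {z. norm z \<ge> d * real m} z * ?k z \<partial>lborel) < \<eta> * ?C / (4 * (B + 1))"
    using \<eta> C B by (intro order_tendstoD) auto
  moreover have "\<forall>\<^sub>F m in sequentially. m > (0::nat)" by (rule eventually_gt_at_top)
  ultimately have "\<forall>\<^sub>F m in sequentially. m > 0 \<and> (\<integral>z. indicator {z. norm z \<ge> d * real m} z * ?k z \<partial>lborel) < \<eta> * ?C / (4 * (B + 1))"
    by eventually_elim auto
  then obtain m :: nat where m: "m > 0" "(\<integral>z. indicator {z. norm z \<ge> d * real m} z * ?k z \<partial>lborel) < \<eta> * ?C / (4 * (B + 1))"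
    using eventually_happens[of _ sequentially] by auto
  let ?c = "real m"
  have int_ind: "integrable lborel (\<lambda>z :: 'a. indicator {z. norm z \<ge> d * ?c} z * ?k z)"
    by (rule Bochner_Integration.integrable_bound[OF integrable_gaussian_kernel]) (auto simp: indicator_def)
  have int_f: "integrable lborel (\<lambda>z. f (x + (1/?c) *\<^sub>R z) * ?k z)" for x
    by (rule Bochner_Integration.integrable_bound[OF integrable_mult_right[OF integrable_gaussian_kernel, of B]])
       (use bd B in \<open>auto simp: abs_mult\<close>)
  have "\<bar>(\<integral>z. f (x + (1/?c) *\<^sub>R z) * ?k z \<partial>lborel) / ?C - f x\<bar> \<le> \<eta>" for x
  proof -
    have "\<bar>(\<integral>z. f (x + (1/?c) *\<^sub>R z) * ?k z \<partial>lborel) - f x * ?C\<bar> =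
        \<bar>\<integral>z. f (x + (1/?c) *\<^sub>R z) * ?k z - f x * ?k z \<partial>lborel\<bar>"
      using int_f by simp
    also have "\<dots> \<le> (\<integral>z. \<bar>f (x + (1/?c) *\<^sub>R z) * ?k z - f x * ?k z\<bar> \<partial>lborel)"
      by (rule integral_abs_bound)
    also have "\<dots> \<le> (\<integral>z. \<eta>/2 * ?k z + 2 * B * (indicator {z. norm z \<ge> d * ?c} z * ?k z) \<partial>lborel)"
    proof (rule integral_mono)
      fix z :: 'a
      have "\<bar>f (x + (1/?c) *\<^sub>R z) - f x\<bar> \<le> \<eta>/2 + 2 * B * indicator {z. norm z \<ge> d * ?c} z"
      proof (cases "norm z \<ge> d * ?c")
        case True
        then show ?thesis using bd[of "x + (1/?c) *\<^sub>R z"] bd[of x] \<eta> by (simp add: indicator_def)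
      next
        case False
        then have "dist (x + (1/?c) *\<^sub>R z) x < d" using m(1) by (simp add: dist_norm field_simps)
        from d(2)[OF this] show ?thesis using False by (simp add: dist_real_def indicator_def)
      qed
      from mult_right_mono[OF this, of "?k z"]
      show "\<bar>f (x + (1/?c) *\<^sub>R z) * ?k z - f x * ?k z\<bar> \<le> \<eta>/2 * ?k z + 2 * B * (indicator {z. norm z \<ge> d * ?c} z * ?k z)"
        unfolding left_diff_distrib[symmetric] abs_mult by (simp add: distrib_right mult.assoc)
    qed (use int_f int_ind in auto)
    also have "\<dots> = \<eta>/2 * ?C + 2 * B * (\<integral>z. indicator {z. norm z \<ge> d * ?c} z * ?k z \<partial>lborel)"
      using int_ind by simp
    also have "\<dots> \<le> \<eta>/2 * ?C + 2 * B * (\<eta> * ?C / (4 * (B + 1)))"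
      using m(2) B \<eta> by (intro add_mono mult_left_mono) auto
    also have "\<dots> \<le> \<eta>/2 * ?C + \<eta>/2 * ?C"
      using B \<eta> C by (simp add: field_simps)
    finally have "\<bar>(\<integral>z. f (x + (1/?c) *\<^sub>R z) * ?k z \<partial>lborel) - f x * ?C\<bar> \<le> \<eta> * ?C" by simp
    moreover have "(\<integral>z. f (x + (1/?c) *\<^sub>R z) * ?k z \<partial>lborel) / ?C - f x = ((\<integral>z. f (x + (1/?c) *\<^sub>R z) * ?k z \<partial>lborel) - f x * ?C) / ?C"
      using C by (simp add: field_simps)
    ultimately show ?thesis using C by (simp add: abs_divide pos_divide_le_eq)
  qed
  with that[of ?c] m(1) show ?thesis by simp
qed

text \<open>A function of bounded support is uniformly close to its Gaussian smoothing. Integrals of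
  the smoothing converge: by Fubini they are Lebesgue integrals of \<open>f\<close> against Gaussian
  averages of the laws, dominated by the integrable function \<open>\<bar>f y\<bar>\<close>.\<close>

lemma char_tendsto_imp_integral_tendsto_bounded_support:
  fixes \<nu> :: "nat \<Rightarrow> (real^'n) measure" and P :: "(real^'n) measure"
  assumes \<nu>: "\<And>n. prob_space (\<nu> n)" "\<And>n. sets (\<nu> n) = sets borel"
    and P: "prob_space P" "sets P = sets borel"
    and conv: "\<And>v. (\<lambda>n. \<integral>x. iexp (v \<bullet> x) \<partial>\<nu> n) \<longlonglongrightarrow> (\<integral>x. iexp (v \<bullet> x) \<partial>P)"
    and cont: "continuous_on UNIV f" and supp: "\<And>x. norm x > R \<Longrightarrow> f x = 0"
    and bd: "\<And>x. \<bar>f x\<bar> \<le> B"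
  shows "(\<lambda>n. \<integral>x. f x \<partial>\<nu> n) \<longlonglongrightarrow> (\<integral>x. f x \<partial>P :: real)"
proof -
  let ?k = "\<lambda>z :: real^'n. exp (- (norm z)\<^sup>2 / 2)"
  let ?C = "\<integral>z. ?k z \<partial>lborel"
  have C: "?C > 0" by (rule integral_gaussian_kernel_pos)
  have [measurable]: "f \<in> borel_measurable borel" using cont by (rule borel_measurable_continuous_onI)
  have f_int: "integrable lborel f"
  proof -
    have "integrable lborel (\<lambda>x. indicator (cball 0 R) x *\<^sub>R f x)"
      by (intro borel_integrable_compact continuous_on_subset[OF cont]) auto
    also have "(\<lambda>x. indicator (cball 0 R) x *\<^sub>R f x) = f"
      using supp by (auto simp: indicator_def fun_eq_iff not_le)
    finally show ?thesis .
  qed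
  \<comment> \<open>\<open>G\<close> is the form in which closeness to \<open>f\<close> is uniform,
    \<open>H\<close> the convolution to which Fubini applies; they differ by a constant
    factor.\<close>
  define G where "G c x = (\<integral>z. f (x + (1/c) *\<^sub>R z) * ?k z \<partial>lborel) / ?C" for c :: real and x
  define H where "H c x = (\<integral>y. f y * ?k (c *\<^sub>R (y - x)) \<partial>lborel)" for c :: real and x
  have GH: "G c x = c ^ DIM(real^'n) / ?C * H c x" if "c > 0" for c x
    using integral_gaussian_kernel_affine[OF that, of f x] that C unfolding G_def H_def
    by (simp add: field_simps)
  have H_int: "integrable Q (H c)" and H_swap: "(\<integral>x. H c x \<partial>Q) = (\<integral>y. f y * (\<integral>x. ?k (c *\<^sub>R (y - x)) \<partial>Q) \<partial>lborel)"
    if "prob_space Q" and [measurable_cong]: "sets Q = sets borel" for Q :: "(real^'n) measure" and c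
  proof -
    interpret Q: prob_space Q by fact
    interpret pair_sigma_finite Q "lborel :: (real^'n) measure" ..
    have prod: "integrable (Q \<Otimes>\<^sub>M lborel) (\<lambda>(x, y). f y * ?k (c *\<^sub>R (y - x)))"
    proof (rule Bochner_Integration.integrable_bound[of _ "\<lambda>(x, y). f y"])
      have "integrable (lborel \<Otimes>\<^sub>M Q) (\<lambda>(y, x). f y)"
      proof -
        interpret R: pair_sigma_finite "lborel :: (real^'n) measure" Q ..
        show ?thesis
          by (rule R.Fubini_integrable) (use f_int in \<open>auto simp: Q.prob_space\<close>)
      qed
      then show "integrable (Q \<Otimes>\<^sub>M lborel) (\<lambda>(x, y). f y)"
        by (subst integrable_product_swap_iff[symmetric]) simp
    qed (auto simp: abs_mult mult_left_le)
    show "integrable Q (H c)" unfolding H_def using integrable_fst[OF prod] by simp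
    have "(\<integral>x. H c x \<partial>Q) = (\<integral>y. (\<integral>x. f y * ?k (c *\<^sub>R (y - x)) \<partial>Q) \<partial>lborel)"
      unfolding H_def by (rule Fubini_integral[OF prod, symmetric])
    then show "(\<integral>x. H c x \<partial>Q) = (\<integral>y. f y * (\<integral>x. ?k (c *\<^sub>R (y - x)) \<partial>Q) \<partial>lborel)" by simp
  qed
  have k_meas: "(\<lambda>y. \<integral>x. ?k (c *\<^sub>R (y - x)) \<partial>Q) \<in> borel_measurable lborel"
    if "prob_space Q" and [measurable_cong]: "sets Q = sets borel" for Q :: "(real^'n) measure" and c
  proof -
    interpret Q: prob_space Q by fact
    show ?thesis by (rule Q.borel_measurable_lebesgue_integral) measurable
  qed
  have k_bd: "\<bar>\<integral>x. ?k (c *\<^sub>R (y - x)) \<partial>Q\<bar> \<le> 1"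
    if "prob_space Q" and [measurable_cong]: "sets Q = sets borel" for Q :: "(real^'n) measure" and c y
  proof -
    interpret Q: prob_space Q by fact
    have "(\<integral>x. ?k (c *\<^sub>R (y - x)) \<partial>Q) \<le> 1"
      by (rule Q.integral_le_const, rule Q.integrable_const_bound[where B=1]) auto
    moreover have "0 \<le> (\<integral>x. ?k (c *\<^sub>R (y - x)) \<partial>Q)" by simp
    ultimately show ?thesis by simp
  qed
  have H_conv: "(\<lambda>n. \<integral>x. H c x \<partial>\<nu> n) \<longlonglongrightarrow> (\<integral>x. H c x \<partial>P)" for c
    unfolding H_swap[OF \<nu>] H_swap[OF P]
  proof (rule integral_dominated_convergence[where w="\<lambda>y. \<bar>f y\<bar>"])
    show "(\<lambda>y. f y * (\<integral>x. ?k (c *\<^sub>R (y - x)) \<partial>P)) \<in> borel_measurable lborel"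
      using k_meas[OF P, where c=c] by measurable
    show "(\<lambda>y. f y * (\<integral>x. ?k (c *\<^sub>R (y - x)) \<partial>\<nu> n)) \<in> borel_measurable lborel" for n
      using k_meas[OF \<nu>, where c=c] by measurable
    show "AE y in lborel. (\<lambda>n. f y * (\<integral>x. ?k (c *\<^sub>R (y - x)) \<partial>\<nu> n)) \<longlonglongrightarrow> f y * (\<integral>x. ?k (c *\<^sub>R (y - x)) \<partial>P)"
      by (intro AE_I2 tendsto_mult_left gaussian_average_tendsto \<nu> P conv)
    show "AE y in lborel. norm (f y * (\<integral>x. ?k (c *\<^sub>R (y - x)) \<partial>\<nu> n)) \<le> \<bar>f y\<bar>" for n
      unfolding real_norm_def abs_mult
      using mult_left_mono[OF k_bd[OF \<nu>], OF abs_ge_zero] by (intro AE_I2) (simp only: mult_1_right)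
    show "integrable lborel (\<lambda>y. \<bar>f y\<bar>)"
      by (rule integrable_abs[OF f_int])
  qed
  show ?thesis
  proof (rule LIMSEQ_I)
    fix r :: real assume r: "r > 0"
    then have r4: "r / 4 > 0" by simp
    obtain c where c: "c > 0" "\<And>x. \<bar>G c x - f x\<bar> \<le> r / 4"
      using gaussian_smoothing_uniform[OF cont supp bd r4] unfolding G_def by blast
    have close: "\<bar>(\<integral>x. G c x \<partial>Q) - (\<integral>x. f x \<partial>Q)\<bar> \<le> r / 4"
      if "prob_space Q" and [measurable_cong]: "sets Q = sets borel" for Q :: "(real^'n) measure"
    proof -
      interpret Q: prob_space Q by fact
      have i1: "integrable Q (G c)" unfolding GH[OF c(1)] using H_int[OF that] by simp
      have i2: "integrable Q f" by (rule Q.integrable_const_bound[where B=B]) (use bd in auto)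
      have "\<bar>(\<integral>x. G c x \<partial>Q) - (\<integral>x. f x \<partial>Q)\<bar> = \<bar>\<integral>x. G c x - f x \<partial>Q\<bar>" using i1 i2 by simp
      also have "\<dots> \<le> (\<integral>x. \<bar>G c x - f x\<bar> \<partial>Q)" by (rule integral_abs_bound)
      also have "\<dots> \<le> r / 4" by (rule Q.integral_le_const) (use i1 i2 c(2) in auto)
      finally show ?thesis .
    qed
    have "(\<lambda>n. \<integral>x. G c x \<partial>\<nu> n) \<longlonglongrightarrow> (\<integral>x. G c x \<partial>P)"
      unfolding GH[OF c(1)] integral_mult_right_zero by (intro tendsto_mult_left H_conv)
    from LIMSEQ_D[OF this r4]
    obtain N where N: "\<And>n. n \<ge> N \<Longrightarrow> norm ((\<integral>x. G c x \<partial>\<nu> n) - (\<integral>x. G c x \<partial>P)) < r / 4"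
      by auto
    show "\<exists>N. \<forall>n\<ge>N. norm ((\<integral>x. f x \<partial>\<nu> n) - (\<integral>x. f x \<partial>P)) < r"
    proof (intro exI[of _ N] allI impI)
      fix n assume "n \<ge> N"
      from N[OF this] close[OF \<nu>, of n] close[OF P] r
      show "norm ((\<integral>x. f x \<partial>\<nu> n) - (\<integral>x. f x \<partial>P)) < r" unfolding real_norm_def by linarith
    qed
  qed
qed

text \<open>Since the limit is known to be a probability law, no separate tightness argument is
  required: the mass that \<open>\<nu> n\<close> puts outside a large ball is bounded by the
  integral of \<open>1 - \<psi> m\<close>, and this converges by the case of bounded support applied
  to the cutoff itself.\<close>

theorem char_tendsto_imp_integral_tendsto:
  fixes \<nu> :: "nat \<Rightarrow> (real^'n) measure" and P :: "(real^'n) measure" and f :: "real^'n \<Rightarrow> real"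
  assumes \<nu>: "\<And>n. prob_space (\<nu> n)" "\<And>n. sets (\<nu> n) = sets borel"
    and P: "prob_space P" "sets P = sets borel"
    and conv: "\<And>v. (\<lambda>n. \<integral>x. iexp (v \<bullet> x) \<partial>\<nu> n) \<longlonglongrightarrow> (\<integral>x. iexp (v \<bullet> x) \<partial>P)"
    and cont: "continuous_on UNIV f" and bdd: "bounded (range f)"
  shows "(\<lambda>n. \<integral>x. f x \<partial>\<nu> n) \<longlonglongrightarrow> (\<integral>x. f x \<partial>P)"
proof -
  obtain B where B: "B > 0" "\<And>x. \<bar>f x\<bar> \<le> B"
    using bdd unfolding bounded_pos by auto
  interpret P: prob_space P by fact
  have [measurable]: "f \<in> borel_measurable borel" using cont by (rule borel_measurable_continuous_onI)
  define \<psi> where "\<psi> m x = max 0 (min 1 (real m + 1 - norm x))" for m :: nat and x :: "real^'n"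
  have \<psi>c: "continuous_on UNIV (\<psi> m)" for m unfolding \<psi>_def by (intro continuous_intros)
  have \<psi>01: "0 \<le> \<psi> m x" "\<psi> m x \<le> 1" for m x by (auto simp: \<psi>_def)
  have \<psi>s: "norm x > real m + 1 \<Longrightarrow> \<psi> m x = 0" for m x by (auto simp: \<psi>_def)
  have [measurable]: "\<psi> m \<in> borel_measurable borel" for m using \<psi>c by (rule borel_measurable_continuous_onI)
  have "(\<lambda>m. \<integral>x. 1 - \<psi> m x \<partial>P) \<longlonglongrightarrow> (\<integral>x. 0 \<partial>P)"
  proof (rule integral_dominated_convergence[where w="\<lambda>_. 1"])
    show "AE x in P. (\<lambda>m. 1 - \<psi> m x) \<longlonglongrightarrow> 0"
    proof (rule AE_I2)
      fix x :: "real^'n"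
      have "\<forall>\<^sub>F m in sequentially. norm x < real m" by real_asymp
      then have "\<forall>\<^sub>F m in sequentially. 1 - \<psi> m x = 0"
        by eventually_elim (auto simp: \<psi>_def)
      then show "(\<lambda>m. 1 - \<psi> m x) \<longlonglongrightarrow> 0" by (rule tendsto_eventually)
    qed
    show "(\<lambda>x. 1 - \<psi> m x) \<in> borel_measurable P" for m
      using P(2) by (simp cong: measurable_cong_sets)
    show "AE x in P. norm (1 - \<psi> m x) \<le> 1" for m using \<psi>01 by auto
  qed auto
  then have lim\<psi>: "(\<lambda>m. \<integral>x. 1 - \<psi> m x \<partial>P) \<longlonglongrightarrow> 0" by simp
  show ?thesis
  proof (rule LIMSEQ_I)
    fix r :: real assume r: "r > 0"
    \<comment> \<open>Cutting off then costs at most \<open>r / 8\<close> for the limit and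
      eventually for \<open>\<nu> n\<close>; with \<open>r / 4\<close> for the truncated function
      the sum stays below \<open>r\<close>.\<close>
    have "\<forall>\<^sub>F m in sequentially. (\<integral>x. 1 - \<psi> m x \<partial>P) < r / (8 * B)"
      using lim\<psi> B(1) r by (intro order_tendstoD) auto
    then obtain m where m: "(\<integral>x. 1 - \<psi> m x \<partial>P) < r / (8 * B)"
      using eventually_happens[of _ sequentially] by auto
    have split: "\<bar>(\<integral>x. f x \<partial>Q) - (\<integral>x. f x * \<psi> m x \<partial>Q)\<bar> \<le> B * (\<integral>x. 1 - \<psi> m x \<partial>Q)"
      and one: "(\<integral>x. 1 - \<psi> m x \<partial>Q) = 1 - (\<integral>x. \<psi> m x \<partial>Q)"
      if "prob_space Q" and [measurable_cong]: "sets Q = sets borel" for Q :: "(real^'n) measure"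
    proof -
      interpret Q: prob_space Q by fact
      have i1: "integrable Q f" by (rule Q.integrable_const_bound[where B=B]) (use B in auto)
      have i2: "integrable Q (\<psi> m)" by (rule Q.integrable_const_bound[where B=1]) (use \<psi>01 in auto)
      have i3: "integrable Q (\<lambda>x. f x * \<psi> m x)"
        by (rule Bochner_Integration.integrable_bound[OF i1]) (use \<psi>01 in \<open>auto simp: abs_mult mult_left_le\<close>)
      have "\<bar>(\<integral>x. f x \<partial>Q) - (\<integral>x. f x * \<psi> m x \<partial>Q)\<bar> = \<bar>\<integral>x. f x - f x * \<psi> m x \<partial>Q\<bar>" using i1 i3 by simp
      also have "\<dots> \<le> (\<integral>x. \<bar>f x - f x * \<psi> m x\<bar> \<partial>Q)" by (rule integral_abs_bound)
      also have "\<dots> \<le> (\<integral>x. B * (1 - \<psi> m x) \<partial>Q)"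
      proof (rule integral_mono)
        fix x
        have "\<bar>f x - f x * \<psi> m x\<bar> = \<bar>f x\<bar> * (1 - \<psi> m x)"
        proof -
          have "f x - f x * \<psi> m x = f x * (1 - \<psi> m x)" by (simp add: right_diff_distrib)
          then show ?thesis using \<psi>01[of m x] by (simp add: abs_mult)
        qed
        also have "\<dots> \<le> B * (1 - \<psi> m x)" using B \<psi>01 by (intro mult_right_mono) auto
        finally show "\<bar>f x - f x * \<psi> m x\<bar> \<le> B * (1 - \<psi> m x)" .
      qed (use i1 i2 i3 in auto)
      finally show "\<bar>(\<integral>x. f x \<partial>Q) - (\<integral>x. f x * \<psi> m x \<partial>Q)\<bar> \<le> B * (\<integral>x. 1 - \<psi> m x \<partial>Q)"
        by simp
      show "(\<integral>x. 1 - \<psi> m x \<partial>Q) = 1 - (\<integral>x. \<psi> m x \<partial>Q)" using i2 by (simp add: Q.prob_space)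
    qed
    have "(\<lambda>n. \<integral>x. f x * \<psi> m x \<partial>\<nu> n) \<longlonglongrightarrow> (\<integral>x. f x * \<psi> m x \<partial>P)"
    proof (rule char_tendsto_imp_integral_tendsto_bounded_support[OF \<nu> P conv, where R="real m + 1" and B=B])
      show "continuous_on UNIV (\<lambda>x. f x * \<psi> m x)" using cont \<psi>c by (intro continuous_intros)
      show "norm x > real m + 1 \<Longrightarrow> f x * \<psi> m x = 0" for x using \<psi>s by simp
      have "\<bar>f x\<bar> * \<psi> m x \<le> B * 1" for x using B \<psi>01 by (intro mult_mono) (auto intro: less_imp_le)
      then show "\<bar>f x * \<psi> m x\<bar> \<le> B" for x using \<psi>01[of m x] by (simp add: abs_mult)
    qed
    from tendstoD[OF this, of "r / 4"] r have e1: "\<forall>\<^sub>F n in sequentially. \<bar>(\<integral>x. f x * \<psi> m x \<partial>\<nu> n) - (\<integral>x. f x * \<psi> m x \<partial>P)\<bar> < r / 4"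
      by (simp add: dist_real_def)
    have "(\<lambda>n. \<integral>x. \<psi> m x \<partial>\<nu> n) \<longlonglongrightarrow> (\<integral>x. \<psi> m x \<partial>P)"
      by (rule char_tendsto_imp_integral_tendsto_bounded_support[OF \<nu> P conv \<psi>c, where R="real m + 1" and B=1])
         (use \<psi>s \<psi>01 in auto)
    then have "(\<lambda>n. \<integral>x. 1 - \<psi> m x \<partial>\<nu> n) \<longlonglongrightarrow> (\<integral>x. 1 - \<psi> m x \<partial>P)"
      unfolding one[OF \<nu>] one[OF P] by (intro tendsto_intros)
    then have e2: "\<forall>\<^sub>F n in sequentially. (\<integral>x. 1 - \<psi> m x \<partial>\<nu> n) < r / (8 * B)"
      using m by (intro order_tendstoD)
    have "\<forall>\<^sub>F n in sequentially. norm ((\<integral>x. f x \<partial>\<nu> n) - (\<integral>x. f x \<partial>P)) < r"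
      using e1 e2
    proof eventually_elim
      case (elim n)
      have "B * (\<integral>x. 1 - \<psi> m x \<partial>\<nu> n) < r / 8" "B * (\<integral>x. 1 - \<psi> m x \<partial>P) < r / 8"
        using elim(2) m B(1) by (auto simp: field_simps)
      with elim(1) split[OF \<nu>, of n] split[OF P] r show ?case
        unfolding real_norm_def by linarith
    qed
    then show "\<exists>N. \<forall>n\<ge>N. norm ((\<integral>x. f x \<partial>\<nu> n) - (\<integral>x. f x \<partial>P)) < r"
      by (simp add: eventually_sequentially)
  qed
qed

section \<open>Polynomial growth and Gaussian moments\<close>

text \<open>A class closed under algebraic operations and affine substitution, with measurability
  built in, and integrable under every law with \<open>all_moments\<close>. One collection of
  introduction rules thus discharges the integrability obligations for all polynomial expressions
  below.\<close>

definition poly_growth :: "('a::euclidean_space \<Rightarrow> real) \<Rightarrow> bool" where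
  "poly_growth f \<longleftrightarrow> f \<in> borel_measurable borel \<and> (\<exists>C m. \<forall>x. \<bar>f x\<bar> \<le> C * (1 + norm x) ^ m)"

lemma poly_growthI:
  assumes "f \<in> borel_measurable borel" "\<And>x. \<bar>f x\<bar> \<le> C * (1 + norm x) ^ m"
  shows "poly_growth f"
  using assms unfolding poly_growth_def by blast

lemma poly_growthE:
  assumes "poly_growth f"
  obtains C m where "C \<ge> 0" "\<And>x. \<bar>f x\<bar> \<le> C * (1 + norm x) ^ m"
proof -
  obtain C m where *: "\<And>x. \<bar>f x\<bar> \<le> C * (1 + norm x) ^ m"
    using assms unfolding poly_growth_def by blast
  from *[of 0] have "C \<ge> 0" by simp
  with * show ?thesis using that by blast
qed

lemma poly_growth_measurable: "poly_growth f \<Longrightarrow> f \<in> borel_measurable borel"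
  by (simp add: poly_growth_def)

lemma poly_growth_const: "poly_growth (\<lambda>_. c)"
  by (rule poly_growthI[of _ "\<bar>c\<bar>" 0]) auto

lemma poly_growth_inner: "poly_growth (\<lambda>x. a \<bullet> x)"
proof (rule poly_growthI[of _ "norm a" 1])
  fix x
  have "\<bar>a \<bullet> x\<bar> \<le> norm a * norm x" by (rule Cauchy_Schwarz_ineq2)
  also have "\<dots> \<le> norm a * (1 + norm x)" by (intro mult_left_mono) auto
  finally show "\<bar>a \<bullet> x\<bar> \<le> norm a * (1 + norm x) ^ 1" by simp
qed simp

lemma poly_growth_add:
  assumes "poly_growth f" "poly_growth g"
  shows "poly_growth (\<lambda>x. f x + g x)"
proof -
  obtain C m D k where *: "C \<ge> 0" "\<And>x. \<bar>f x\<bar> \<le> C * (1 + norm x) ^ m"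
    "D \<ge> 0" "\<And>x. \<bar>g x\<bar> \<le> D * (1 + norm x) ^ k"
    using assms by (metis poly_growthE)
  show ?thesis
  proof (rule poly_growthI[of _ "C + D" "m + k"])
    show "(\<lambda>x. f x + g x) \<in> borel_measurable borel"
      using assms by (intro borel_measurable_add poly_growth_measurable)
    fix x
    have "\<bar>f x + g x\<bar> \<le> C * (1 + norm x) ^ m + D * (1 + norm x) ^ k"
      using *(2,4)[of x] by linarith
    also have "\<dots> \<le> C * (1 + norm x) ^ (m + k) + D * (1 + norm x) ^ (m + k)"
      using *(1,3) by (intro add_mono mult_left_mono power_increasing) auto
    finally show "\<bar>f x + g x\<bar> \<le> (C + D) * (1 + norm x) ^ (m + k)" by (simp add: distrib_right)
  qed
qed

lemma poly_growth_mult: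
  assumes "poly_growth f" "poly_growth g"
  shows "poly_growth (\<lambda>x. f x * g x)"
proof -
  obtain C m D k where *: "C \<ge> 0" "\<And>x. \<bar>f x\<bar> \<le> C * (1 + norm x) ^ m"
    "D \<ge> 0" "\<And>x. \<bar>g x\<bar> \<le> D * (1 + norm x) ^ k"
    using assms by (metis poly_growthE)
  show ?thesis
  proof (rule poly_growthI[of _ "C * D" "m + k"])
    show "(\<lambda>x. f x * g x) \<in> borel_measurable borel"
      using assms by (intro borel_measurable_times poly_growth_measurable)
    fix x
    have "\<bar>f x * g x\<bar> \<le> (C * (1 + norm x) ^ m) * (D * (1 + norm x) ^ k)"
      unfolding abs_mult using * by (intro mult_mono) auto
    then show "\<bar>f x * g x\<bar> \<le> (C * D) * (1 + norm x) ^ (m + k)" by (simp add: power_add ac_simps)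
  qed
qed

lemma poly_growth_uminus: "poly_growth f \<Longrightarrow> poly_growth (\<lambda>x. - f x)"
  using poly_growth_mult[OF poly_growth_const[of "-1"]] by fastforce

lemma poly_growth_divide: "poly_growth f \<Longrightarrow> poly_growth (\<lambda>x. f x / c)"
  using poly_growth_mult[OF _ poly_growth_const[of "1 / c"]] by fastforce

lemma poly_growth_diff: "poly_growth f \<Longrightarrow> poly_growth g \<Longrightarrow> poly_growth (\<lambda>x. f x - g x)"
  using poly_growth_add[OF _ poly_growth_uminus] by fastforce

lemma poly_growth_power: "poly_growth f \<Longrightarrow> poly_growth (\<lambda>x. f x ^ k)"
  by (induction k) (auto intro: poly_growth_const poly_growth_mult)

lemma poly_growth_sum: "(\<And>i. i \<in> I \<Longrightarrow> poly_growth (f i)) \<Longrightarrow> poly_growth (\<lambda>x. \<Sum>i\<in>I. f i x)"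
  by (induction I rule: infinite_finite_induct) (auto intro: poly_growth_const poly_growth_add)

lemma poly_growth_prod: "(\<And>i. i \<in> I \<Longrightarrow> poly_growth (f i)) \<Longrightarrow> poly_growth (\<lambda>x. \<Prod>i\<in>I. f i x)"
  by (induction I rule: infinite_finite_induct) (auto intro: poly_growth_const poly_growth_mult)

lemma poly_growth_component: "poly_growth (\<lambda>x. (x :: real^'n) $ i)"
proof -
  have "(\<lambda>x. x $ i) = (\<lambda>x :: real^'n. axis i 1 \<bullet> x)" by (simp add: inner_axis' fun_eq_iff)
  then show ?thesis using poly_growth_inner[of "axis i 1 :: real^'n"] by simp
qed

lemma poly_growth_poly: "poly_growth f \<Longrightarrow> poly_growth (\<lambda>x. poly q (f x))"
  unfolding poly_altdef by (intro poly_growth_sum poly_growth_mult poly_growth_const poly_growth_power)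

lemmas poly_growth_intros = poly_growth_const poly_growth_inner poly_growth_add poly_growth_mult
  poly_growth_uminus poly_growth_divide poly_growth_diff poly_growth_power poly_growth_sum poly_growth_prod
  poly_growth_component poly_growth_poly

lemma poly_growth_compose_affine:
  fixes A :: "real^'n^'m"
  assumes "poly_growth f"
  shows "poly_growth (\<lambda>z. f (m + A *v z))"
proof -
  obtain C k where *: "C \<ge> 0" "\<And>x. \<bar>f x\<bar> \<le> C * (1 + norm x) ^ k"
    using assms by (metis poly_growthE)
  obtain K where K: "K > 0" "\<And>z. norm (A *v z) \<le> norm z * K"
    using bounded_linear.pos_bounded[OF matrix_vector_mul_bounded_linear[of A]] by blast
  show ?thesis
  proof (rule poly_growthI[of _ "C * (1 + norm m + K) ^ k" k])
    have [measurable]: "f \<in> borel_measurable borel" by (rule poly_growth_measurable[OF assms])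
    show "(\<lambda>z. f (m + A *v z)) \<in> borel_measurable borel" by measurable
    fix z
    have "1 + norm (m + A *v z) \<le> 1 + norm m + norm z * K"
      using norm_triangle_ineq[of m "A *v z"] K(2)[of z] by linarith
    also have "\<dots> \<le> (1 + norm m + K) * (1 + norm z)"
      using K(1) by (simp add: algebra_simps)
    finally have "(1 + norm (m + A *v z)) ^ k \<le> ((1 + norm m + K) * (1 + norm z)) ^ k"
      by (intro power_mono) auto
    then have "C * (1 + norm (m + A *v z)) ^ k \<le> C * ((1 + norm m + K) * (1 + norm z)) ^ k"
      using *(1) by (rule mult_left_mono)
    then show "\<bar>f (m + A *v z)\<bar> \<le> C * (1 + norm m + K) ^ k * (1 + norm z) ^ k"
      using *(2)[of "m + A *v z"] by (simp add: power_mult_distrib mult.assoc)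
  qed
qed

lemma poly_growth_shift:
  fixes f :: "real^'n \<Rightarrow> real"
  assumes "poly_growth f"
  shows "poly_growth (\<lambda>x. f (x - m))"
  using poly_growth_compose_affine[OF assms, of "- m" "mat 1"] by simp

definition all_moments :: "'a::euclidean_space measure \<Rightarrow> bool" where
  "all_moments P \<longleftrightarrow> prob_space P \<and> sets P = sets borel \<and> (\<forall>m. integrable P (\<lambda>x. norm x ^ m))"

lemma all_moments_integrable:
  fixes P :: "'a::euclidean_space measure"
  assumes P: "all_moments P" and f: "poly_growth f"
  shows "integrable P f"
proof -
  interpret prob_space P using P by (simp add: all_moments_def)
  have s: "sets P = sets borel" using P by (simp add: all_moments_def)
  obtain C m where *: "C \<ge> 0" "\<And>x. \<bar>f x\<bar> \<le> C * (1 + norm x) ^ m"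
    using f by (metis poly_growthE)
  show ?thesis
  proof (rule Bochner_Integration.integrable_bound[where f="\<lambda>x. C * (2 ^ m * (1 + norm x ^ m))"])
    show "integrable P (\<lambda>x. C * (2 ^ m * (1 + norm x ^ m)))"
      using P by (simp add: all_moments_def)
    show "f \<in> borel_measurable P"
      using poly_growth_measurable[OF f] s by (simp cong: measurable_cong_sets)
    show "AE x in P. norm (f x) \<le> norm (C * (2 ^ m * (1 + norm x ^ m)))"
    proof (rule AE_I2)
      fix x :: 'a
      have "(1 + norm x) ^ m \<le> (2 * max 1 (norm x)) ^ m" by (intro power_mono) auto
      also have "\<dots> = 2 ^ m * max 1 (norm x) ^ m" by (simp add: power_mult_distrib)
      also have "max 1 (norm x) ^ m \<le> 1 + norm x ^ m" by (auto simp: max_def)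
      finally have "(1 + norm x) ^ m \<le> 2 ^ m * (1 + norm x ^ m)" by simp
      then have "C * (1 + norm x) ^ m \<le> C * (2 ^ m * (1 + norm x ^ m))"
        using *(1) by (rule mult_left_mono)
      with *(2)[of x] *(1) show "norm (f x) \<le> norm (C * (2 ^ m * (1 + norm x ^ m)))" by simp
    qed
  qed
qed

section \<open>Moments and orthogonality for the standard normal law\<close>

definition std_moment :: "nat \<Rightarrow> real" where
  "std_moment k = (\<integral>x. x ^ k \<partial>std_normal_distribution)"

lemma std_moment_eq: "std_moment k = (\<integral>x. std_normal_density x * x ^ k \<partial>lborel)"
  unfolding std_moment_def by (subst integral_density) auto

lemma std_moment_0: "std_moment 0 = 1"
  unfolding std_moment_eq using integral_std_normal_moment_even[of 0] by simp

lemma std_moment_odd: "odd k \<Longrightarrow> std_moment k = 0"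
  unfolding std_moment_eq using integral_std_normal_moment_odd by (auto elim!: oddE)

lemma std_moment_even: "std_moment (2 * k) = fact (2 * k) / (2 ^ k * fact k)"
  unfolding std_moment_eq by (rule integral_std_normal_moment_even)

lemma std_moment_Suc_Suc: "std_moment (Suc (Suc k)) = real (Suc k) * std_moment k"
proof (cases "even k")
  case True
  then obtain j where j: "k = 2 * j" by (elim evenE)
  have "std_moment (Suc (Suc k)) = fact (2 * Suc j) / (2 ^ Suc j * fact (Suc j))"
    unfolding j using std_moment_even[of "Suc j"] by simp
  also have "\<dots> = real (Suc k) * (fact (2 * j) / (2 ^ j * fact j))"
    unfolding j by (simp add: divide_simps)
  finally show ?thesis unfolding j std_moment_even .
qed (simp add: std_moment_odd)

text \<open>Both laws have the characteristic function exp(- t^2 (c \<bullet> c) / 2), so uniqueness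
  takes the place of a rotation of coordinates.\<close>

lemma distr_std_mvn_inner:
  "distr std_mvn borel (\<lambda>z. c \<bullet> z) = distr std_normal_distribution borel (\<lambda>x. norm c * x)"
  for c :: "real^'n"
proof (rule Levy_uniqueness)
  interpret N: prob_space "std_mvn :: (real^'n) measure" by (rule prob_space_std_mvn)
  interpret S: prob_space std_normal_distribution by (rule prob_space_normal_density) simp
  show "real_distribution (distr std_mvn borel (\<lambda>z. c \<bullet> z))"
    by (rule N.real_distribution_distr) measurable
  show "real_distribution (distr std_normal_distribution borel (\<lambda>x. norm c * x))"
    by (rule S.real_distribution_distr) measurable
  show "char (distr std_mvn borel (\<lambda>z. c \<bullet> z)) = char (distr std_normal_distribution borel (\<lambda>x. norm c * x))"
  proof
    fix t
    have "char (distr std_mvn borel (\<lambda>z. c \<bullet> z)) t = (\<integral>z. iexp ((t *\<^sub>R c) \<bullet> z) \<partial>std_mvn)"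
      unfolding char_def by (subst integral_distr) (auto simp: measurable_cong_sets[OF sets_std_mvn refl])
    also have "\<dots> = of_real (exp (- ((t * norm c)\<^sup>2) / 2))"
      unfolding std_mvn_characteristic_function
      by (simp add: power_mult_distrib power2_norm_eq_inner) (simp add: power2_eq_square)
    also have "\<dots> = char std_normal_distribution (t * norm c)"
      by (simp add: char_std_normal_distribution)
    also have "\<dots> = char (distr std_normal_distribution borel (\<lambda>x. norm c * x)) t"
      unfolding char_def by (subst integral_distr) (auto simp: mult.assoc)
    finally show "char (distr std_mvn borel (\<lambda>z. c \<bullet> z)) t = char (distr std_normal_distribution borel (\<lambda>x. norm c * x)) t" .
  qed
qed

lemma std_mvn_inner_power:
  fixes c :: "real^'n"
  shows std_mvn_integrable_inner_power: "integrable std_mvn (\<lambda>z. (c \<bullet> z) ^ k)"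
    and std_mvn_integral_inner_power: "(\<integral>z. (c \<bullet> z) ^ k \<partial>std_mvn) = norm c ^ k * std_moment k"
proof -
  have int: "integrable std_normal_distribution (\<lambda>x. (norm c * x) ^ k)"
    unfolding power_mult_distrib
    using integrable_mult_right[OF integrable_std_normal_moment[of k], of "norm c ^ k"]
    by (subst integrable_density) (auto simp: mult_ac)
  then have "integrable (distr std_normal_distribution borel (\<lambda>x. norm c * x)) (\<lambda>x. x ^ k)"
    by (subst integrable_distr_eq) auto
  then have "integrable (distr std_mvn borel (\<lambda>z. c \<bullet> z)) (\<lambda>x. x ^ k)"
    by (simp only: distr_std_mvn_inner)
  then show "integrable std_mvn (\<lambda>z. (c \<bullet> z) ^ k)"
    by (subst (asm) integrable_distr_eq) (auto simp: measurable_cong_sets[OF sets_std_mvn refl])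
  have "(\<integral>z. (c \<bullet> z) ^ k \<partial>std_mvn) = (\<integral>x. x ^ k \<partial>distr std_mvn borel (\<lambda>z. c \<bullet> z))"
    by (subst integral_distr) (auto simp: measurable_cong_sets[OF sets_std_mvn refl])
  also have "\<dots> = (\<integral>x. (norm c * x) ^ k \<partial>std_normal_distribution)"
    unfolding distr_std_mvn_inner by (subst integral_distr) auto
  also have "\<dots> = norm c ^ k * std_moment k"
    by (simp add: power_mult_distrib std_moment_def)
  finally show "(\<integral>z. (c \<bullet> z) ^ k \<partial>std_mvn) = norm c ^ k * std_moment k" .
qed

text \<open>Some coordinate is at least the norm divided by the dimension, since otherwise the l1
  norm would be smaller than the Euclidean one. The exponent is doubled so that absolute values
  disappear and the one-dimensional moments apply.\<close>

lemma norm_power_le_sum_components: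
  fixes z :: "real^'n"
  shows "norm z ^ m \<le> real CARD('n) ^ m * (\<Sum>i\<in>UNIV. 1 + (z $ i) ^ (2 * m))"
proof -
  obtain i where i: "norm z \<le> real CARD('n) * \<bar>z $ i\<bar>"
  proof (rule ccontr)
    assume "\<not> thesis"
    then have *: "\<bar>z $ i\<bar> < norm z / real CARD('n)" for i
      using that by (fastforce simp: field_simps not_le)
    have "norm z \<le> (\<Sum>i\<in>UNIV. \<bar>z $ i\<bar>)" by (rule norm_le_l1_cart)
    also have "\<dots> < (\<Sum>i\<in>(UNIV::'n set). norm z / real CARD('n))"
      using * by (intro sum_strict_mono) auto
    finally show False by simp
  qed
  have "norm z ^ m \<le> (real CARD('n) * \<bar>z $ i\<bar>) ^ m" using i by (intro power_mono) auto
  also have "\<dots> = real CARD('n) ^ m * \<bar>z $ i\<bar> ^ m" by (simp add: power_mult_distrib)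
  also have "\<bar>z $ i\<bar> ^ m \<le> 1 + (z $ i) ^ (2 * m)"
  proof (cases "\<bar>z $ i\<bar> ^ m \<le> 1")
    case True
    then show ?thesis by (simp add: power_mult add_increasing2)
  next
    case False
    then have "\<bar>z $ i\<bar> ^ m * 1 \<le> \<bar>z $ i\<bar> ^ m * \<bar>z $ i\<bar> ^ m" by (intro mult_left_mono) auto
    then show ?thesis by (simp add: power_mult power2_eq_square power_mult_distrib[symmetric])
  qed
  also have "1 + (z $ i) ^ (2 * m) \<le> (\<Sum>i\<in>UNIV. 1 + (z $ i) ^ (2 * m))"
    by (rule member_le_sum) (auto simp: power_mult)
  finally show ?thesis by (simp add: mult_left_mono)
qed

lemma all_moments_std_mvn: "all_moments (std_mvn :: (real^'n) measure)"
  unfolding all_moments_def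
proof (intro conjI allI)
  show "prob_space (std_mvn :: (real^'n) measure)" by (rule prob_space_std_mvn)
  interpret N: prob_space "std_mvn :: (real^'n) measure" by (rule prob_space_std_mvn)
  show "sets (std_mvn :: (real^'n) measure) = sets borel" by (rule sets_std_mvn)
  fix m
  show "integrable std_mvn (\<lambda>z::real^'n. norm z ^ m)"
  proof (rule Bochner_Integration.integrable_bound[where f="\<lambda>z. real CARD('n) ^ m * (\<Sum>i\<in>UNIV. 1 + (z $ i) ^ (2 * m))"])
    have "integrable std_mvn (\<lambda>z::real^'n. (z $ i) ^ (2 * m))" for i
      using std_mvn_integrable_inner_power[of "axis i 1" "2 * m"] by (simp add: inner_axis')
    then show "integrable std_mvn (\<lambda>z::real^'n. real CARD('n) ^ m * (\<Sum>i\<in>UNIV. 1 + (z $ i) ^ (2 * m)))"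
      by simp
    show "(\<lambda>z::real^'n. norm z ^ m) \<in> borel_measurable std_mvn" by measurable
    show "AE z in std_mvn. norm (norm (z::real^'n) ^ m) \<le> norm (real CARD('n) ^ m * (\<Sum>i\<in>UNIV. 1 + (z $ i) ^ (2 * m)))"
      using norm_power_le_sum_components by (intro AE_I2) (fastforce simp: intro: order_trans[OF _ abs_ge_self])
  qed
qed

text \<open>Writes a polynomial in \<open>t^2\<close> as one in \<open>t\<close> with explicit zero
  odd coefficients, ready for comparison of coefficients.\<close>

lemma sum_even_powers:
  fixes g :: "nat \<Rightarrow> real"
  shows "(\<Sum>i\<le>2*k. (if even i then g (i div 2) else 0) * t ^ i) = (\<Sum>j\<le>k. g j * t ^ (2 * j))"
  by (induction k) auto

text \<open>Comparing the coefficients of \<open>t\<close> and \<open>t\<^sup>2\<close> in the moments of \<open>(a + t b) \<bullet> z\<close>, which depend only on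
  \<open>\<parallel>a + t b\<parallel>\<^sup>2 = \<parallel>a\<parallel>\<^sup>2 + t\<^sup>2 \<parallel>b\<parallel>\<^sup>2\<close>, replaces a proof that \<open>a \<bullet> z\<close> and \<open>b \<bullet> z\<close> are independent.\<close>
lemma std_mvn_orthogonal_power:
  fixes a b :: "real^'n"
  assumes ab: "a \<bullet> b = 0"
  shows "(\<integral>z. (a \<bullet> z) ^ m * (b \<bullet> z) \<partial>std_mvn) = 0"
    and "(\<integral>z. (a \<bullet> z) ^ m * (b \<bullet> z)\<^sup>2 \<partial>std_mvn) = (norm b)\<^sup>2 * (\<integral>z. (a \<bullet> z) ^ m \<partial>std_mvn)"
proof -
  let ?N = "std_mvn :: (real^'n) measure"
  \<comment> \<open>The coefficient of \<open>t ^ i\<close> in the \<open>k\<close>-th moment of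
    \<open>(t *\<^sub>R b + a) \<bullet> z\<close>.\<close>
  define e where "e k i = real (k choose i) * (\<integral>z. (a \<bullet> z) ^ (k - i) * (b \<bullet> z) ^ i \<partial>?N)" for k i
  have nrm: "(norm (t *\<^sub>R b + a))\<^sup>2 = (norm b)\<^sup>2 * t\<^sup>2 + (norm a)\<^sup>2" for t
    unfolding power2_norm_eq_inner
    by (simp add: inner_add_left inner_add_right ab inner_commute[of b a] power2_eq_square)
  have int: "integrable ?N (\<lambda>z. (a \<bullet> z) ^ i * (b \<bullet> z) ^ j)" for i j
    by (intro all_moments_integrable[OF all_moments_std_mvn] poly_growth_intros)
  have expand: "(\<Sum>i\<le>k. e k i * t ^ i) = norm (t *\<^sub>R b + a) ^ k * std_moment k" for k t
  proof -
    have "norm (t *\<^sub>R b + a) ^ k * std_moment k = (\<integral>z. (t * (b \<bullet> z) + a \<bullet> z) ^ k \<partial>?N)"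
      unfolding std_mvn_integral_inner_power[symmetric] by (simp add: inner_add_left)
    also have "\<dots> = (\<integral>z. (\<Sum>i\<le>k. real (k choose i) * t ^ i * ((a \<bullet> z) ^ (k - i) * (b \<bullet> z) ^ i)) \<partial>?N)"
      by (simp add: binomial_ring power_mult_distrib mult_ac)
    also have "\<dots> = (\<Sum>i\<le>k. e k i * t ^ i)"
      by (subst Bochner_Integration.integral_sum, use int in simp, simp add: e_def mult_ac)
    finally show ?thesis by simp
  qed
  have even_case: "e (2 * k) i = (if even i then real (k choose (i div 2)) * (norm b) ^ (2 * (i div 2)) * (norm a) ^ (2 * (k - i div 2)) * std_moment (2 * k) else 0)"
    if "i \<le> 2 * k" for k i
  proof -
    let ?g = "\<lambda>j. real (k choose j) * (norm b) ^ (2 * j) * (norm a) ^ (2 * (k - j)) * std_moment (2 * k)"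
    have "(\<Sum>i\<le>2 * k. e (2 * k) i * t ^ i) = (\<Sum>i\<le>2*k. (if even i then ?g (i div 2) else 0) * t ^ i)" for t
    proof -
      have "norm (t *\<^sub>R b + a) ^ (2 * k) = ((norm b)\<^sup>2 * t\<^sup>2 + (norm a)\<^sup>2) ^ k"
        by (simp add: power_mult nrm)
      also have "\<dots> = (\<Sum>j\<le>k. real (k choose j) * (norm b) ^ (2 * j) * (norm a) ^ (2 * (k - j)) * t ^ (2 * j))"
        by (simp add: binomial_ring power_mult_distrib power_mult[symmetric] mult_ac)
      finally have "(\<Sum>i\<le>2 * k. e (2 * k) i * t ^ i) = (\<Sum>j\<le>k. ?g j * t ^ (2 * j))"
        unfolding expand by (simp only: sum_distrib_right) (simp add: mult_ac)
      also have "\<dots> = (\<Sum>i\<le>2*k. (if even i then ?g (i div 2) else 0) * t ^ i)"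
        by (rule sum_even_powers[symmetric])
      finally show ?thesis .
    qed
    then have "\<forall>i\<le>2 * k. e (2 * k) i = (if even i then ?g (i div 2) else 0)"
      using polyfun_eq_coeffs[of "e (2 * k)" "2 * k" "\<lambda>i. if even i then ?g (i div 2) else 0"] by blast
    with that show ?thesis by blast
  qed
  have odd_case: "e k i = 0" if "odd k" "i \<le> k" for k i
  proof -
    have "(\<Sum>i\<le>k. e k i * t ^ i) = (\<Sum>i\<le>k. 0 * t ^ i)" for t
      unfolding expand using that std_moment_odd by simp
    then show ?thesis using polyfun_eq_coeffs[of "e k" k "\<lambda>_. 0"] that by blast
  qed
  have "e (Suc m) 1 = 0"
  proof (cases "even m")
    case True
    then show ?thesis by (intro odd_case) auto
  next
    case False
    then obtain k where "Suc m = 2 * k" by (metis evenE even_Suc)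
    then show ?thesis using even_case[of 1 k] by simp
  qed
  then show "(\<integral>z. (a \<bullet> z) ^ m * (b \<bullet> z) \<partial>std_mvn) = 0" by (simp add: e_def)
  show "(\<integral>z. (a \<bullet> z) ^ m * (b \<bullet> z)\<^sup>2 \<partial>std_mvn) = (norm b)\<^sup>2 * (\<integral>z. (a \<bullet> z) ^ m \<partial>std_mvn)"
  proof (cases "even m")
    case False
    then have "e (Suc (Suc m)) 2 = 0" by (intro odd_case) auto
    moreover have "Suc (Suc m) choose 2 \<noteq> 0" by simp
    ultimately have "(\<integral>z. (a \<bullet> z) ^ m * (b \<bullet> z)\<^sup>2 \<partial>std_mvn) = 0"
      unfolding e_def by (simp del: binomial_eq_0_iff)
    then show ?thesis using False by (simp add: std_mvn_integral_inner_power std_moment_odd)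
  next
    case True
    then obtain j where j: "m = 2 * j" by (elim evenE)
    have "e (2 * Suc j) 2 = real (Suc j) * (norm b)\<^sup>2 * norm a ^ (2 * j) * std_moment (2 * Suc j)"
      using even_case[of 2 "Suc j"] by (simp add: binomial_Suc_n)
    \<comment> \<open>Here \<open>2 * j + 2\<close> choose 2 is
      \<open>(j + 1) * (2 * j + 1)\<close>; the first factor is the binomial coefficient on the
      other side, the second the factor by which \<open>std_moment\<close> grows from order
      \<open>2 * j\<close> to \<open>2 * j + 2\<close>.\<close>
    moreover have "real (Suc (Suc (2 * j)) choose 2) = real (Suc j) * real (Suc (2 * j))"
      by (simp add: choose_two) (simp add: algebra_simps)
    ultimately have "real (Suc j) * real (Suc (2 * j)) * (\<integral>z. (a \<bullet> z) ^ m * (b \<bullet> z)\<^sup>2 \<partial>?N) =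
        real (Suc j) * real (Suc (2 * j)) * ((norm b)\<^sup>2 * (norm a ^ m * std_moment m))"
      unfolding e_def j by (simp add: std_moment_Suc_Suc mult_ac)
    then show ?thesis by (simp add: std_mvn_integral_inner_power del: of_nat_Suc)
  qed
qed

text \<open>Linearity passes from powers to polynomials, polarization from squares to products of
  two projections.\<close>

lemma std_mvn_orthogonal_poly:
  fixes a b c :: "real^'n"
  assumes ab: "a \<bullet> b = 0" and ac: "a \<bullet> c = 0"
  shows "(\<integral>z. poly q (a \<bullet> z) * (b \<bullet> z) \<partial>std_mvn) = 0"
    and "(\<integral>z. poly q (a \<bullet> z) * ((b \<bullet> z) * (c \<bullet> z)) \<partial>std_mvn) = (b \<bullet> c) * (\<integral>z. poly q (a \<bullet> z) \<partial>std_mvn)"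
proof -
  let ?N = "std_mvn :: (real^'n) measure"
  note int = all_moments_integrable[OF all_moments_std_mvn]
  have lin: "(\<integral>z. poly q (a \<bullet> z) * h z \<partial>?N) = (\<Sum>i\<le>degree q. coeff q i * (\<integral>z. (a \<bullet> z) ^ i * h z \<partial>?N))"
    if "poly_growth h" for h
  proof -
    have "(\<integral>z. poly q (a \<bullet> z) * h z \<partial>?N) = (\<integral>z. (\<Sum>i\<le>degree q. coeff q i * ((a \<bullet> z) ^ i * h z)) \<partial>?N)"
      by (simp add: poly_altdef sum_distrib_right mult.assoc)
    also have "\<dots> = (\<Sum>i\<le>degree q. \<integral>z. coeff q i * ((a \<bullet> z) ^ i * h z) \<partial>?N)"
      by (rule Bochner_Integration.integral_sum) (intro int poly_growth_intros that)
    finally show ?thesis by simp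
  qed
  show "(\<integral>z. poly q (a \<bullet> z) * (b \<bullet> z) \<partial>?N) = 0"
    by (subst lin) (auto intro: poly_growth_intros simp: std_mvn_orthogonal_power(1)[OF ab])
  have sq: "(\<integral>z. poly q (a \<bullet> z) * (d \<bullet> z)\<^sup>2 \<partial>?N) = (norm d)\<^sup>2 * (\<integral>z. poly q (a \<bullet> z) \<partial>?N)"
    if "a \<bullet> d = 0" for d
    using lin[of "\<lambda>z. (d \<bullet> z)\<^sup>2"] lin[of "\<lambda>z. 1"] that
    by (simp add: std_mvn_orthogonal_power(2) poly_growth_intros sum_distrib_left mult_ac)
  have "(\<integral>z. poly q (a \<bullet> z) * ((b \<bullet> z) * (c \<bullet> z)) \<partial>?N) =
      (\<integral>z. 1/4 * (poly q (a \<bullet> z) * ((b + c) \<bullet> z)\<^sup>2) - 1/4 * (poly q (a \<bullet> z) * ((b - c) \<bullet> z)\<^sup>2) \<partial>?N)"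
    by (rule Bochner_Integration.integral_cong)
       (simp_all add: inner_add_left inner_diff_left power2_eq_square algebra_simps)
  also have "\<dots> = 1/4 * (\<integral>z. poly q (a \<bullet> z) * ((b + c) \<bullet> z)\<^sup>2 \<partial>?N) - 1/4 * (\<integral>z. poly q (a \<bullet> z) * ((b - c) \<bullet> z)\<^sup>2 \<partial>?N)"
    by (subst Bochner_Integration.integral_diff) (auto intro!: int poly_growth_intros)
  also have "\<dots> = ((norm (b + c))\<^sup>2 - (norm (b - c))\<^sup>2) / 4 * (\<integral>z. poly q (a \<bullet> z) \<partial>?N)"
    using ab ac by (simp add: sq inner_add_right inner_diff_right field_simps)
  also have "(norm (b + c))\<^sup>2 - (norm (b - c))\<^sup>2 = 4 * (b \<bullet> c)"
    by (simp add: power2_norm_eq_inner inner_add_left inner_add_right inner_diff_left inner_diff_right inner_commute)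
  also have "4 * (b \<bullet> c) / 4 * (\<integral>z. poly q (a \<bullet> z) \<partial>?N) = (b \<bullet> c) * (\<integral>z. poly q (a \<bullet> z) \<partial>?N)"
    by simp
  finally show "(\<integral>z. poly q (a \<bullet> z) * ((b \<bullet> z) * (c \<bullet> z)) \<partial>?N) = (b \<bullet> c) * (\<integral>z. poly q (a \<bullet> z) \<partial>?N)" .
qed

section \<open>Strong law of large numbers and averages of polynomials\<close>

definition avg :: "(nat \<Rightarrow> 'b) \<Rightarrow> nat \<Rightarrow> ('b \<Rightarrow> real) \<Rightarrow> real" where
  "avg x n f = (1 / real n) * (\<Sum>i<n. f (x i))"

text \<open>Induction on \<open>n\<close> with the binomial expansion of
  \<open>(S n + Y n) ^ 4\<close>: by independence the mixed terms factor, and those containing a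
  first power vanish. Only \<open>6 * real n * v\<^sup>2 + q\<close> is added in each step.\<close>

lemma (in prob_space) indep_sum_fourth_moment:
  fixes Y :: "nat \<Rightarrow> 'a \<Rightarrow> real"
  assumes indep: "indep_vars (\<lambda>_. borel) Y UNIV"
    and int: "\<And>i k. integrable M (\<lambda>\<omega>. Y i \<omega> ^ k)"
    and mean: "\<And>i. expectation (Y i) = 0"
    and second: "\<And>i. expectation (\<lambda>\<omega>. (Y i \<omega>)\<^sup>2) = v"
    and fourth: "\<And>i. expectation (\<lambda>\<omega>. Y i \<omega> ^ 4) = q"
  defines "S \<equiv> \<lambda>n \<omega>. \<Sum>i<n. Y i \<omega>"
  shows "integrable M (\<lambda>\<omega>. S n \<omega> ^ k)"
    and "expectation (\<lambda>\<omega>. (S n \<omega>)\<^sup>2) = real n * v"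
    and "expectation (\<lambda>\<omega>. S n \<omega> ^ 4) \<le> (q + 3 * v\<^sup>2) * (real n)\<^sup>2"
proof -
  have ind: "indep_var borel (\<lambda>\<omega>. Y n \<omega> ^ j) borel (\<lambda>\<omega>. S n \<omega> ^ l)" for n j l
  proof -
    have "indep_var borel (Y n) borel (S n)"
      unfolding S_def by (rule indep_vars_sum) (auto intro: indep_vars_subset[OF indep])
    from indep_var_compose[OF this, of "\<lambda>x. x ^ j" borel "\<lambda>x. x ^ l" borel]
    show ?thesis by (simp add: comp_def)
  qed
  have Sint: "integrable M (\<lambda>\<omega>. S n \<omega> ^ k)" for n k
  proof (induction n arbitrary: k)
    case (Suc n)
    have "(\<lambda>\<omega>. S (Suc n) \<omega> ^ k) = (\<lambda>\<omega>. \<Sum>j\<le>k. real (k choose j) * (Y n \<omega> ^ (k - j) * S n \<omega> ^ j))"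
      by (simp add: S_def binomial_ring mult_ac)
    moreover have "integrable M (\<lambda>\<omega>. Y n \<omega> ^ (k - j) * S n \<omega> ^ j)" for j
      by (rule indep_var_integrable[OF ind int Suc])
    ultimately show ?case by simp
  qed (simp add: S_def power_0_left)
  then show "integrable M (\<lambda>\<omega>. S n \<omega> ^ k)" .
  have prod: "integrable M (\<lambda>\<omega>. Y n \<omega> ^ j * S n \<omega> ^ l)"
    "expectation (\<lambda>\<omega>. Y n \<omega> ^ j * S n \<omega> ^ l) = expectation (\<lambda>\<omega>. Y n \<omega> ^ j) * expectation (\<lambda>\<omega>. S n \<omega> ^ l)" for n j l
    by (rule indep_var_integrable[OF ind int Sint], rule indep_var_lebesgue_integral[OF ind int Sint])
  have Smean: "expectation (S n) = 0" for n
    unfolding S_def using int[of _ 1] mean by simp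
  have Ssecond: "expectation (\<lambda>\<omega>. (S n \<omega>)\<^sup>2) = real n * v" for n
  proof (induction n)
    case (Suc n)
    have "expectation (\<lambda>\<omega>. (S (Suc n) \<omega>)\<^sup>2) =
        expectation (\<lambda>\<omega>. (S n \<omega>)\<^sup>2 + (2 * (Y n \<omega> ^ 1 * S n \<omega> ^ 1) + (Y n \<omega>)\<^sup>2))"
      by (simp add: S_def power2_eq_square algebra_simps)
    also have "\<dots> = expectation (\<lambda>\<omega>. (S n \<omega>)\<^sup>2) + (2 * expectation (\<lambda>\<omega>. Y n \<omega> ^ 1 * S n \<omega> ^ 1) + expectation (\<lambda>\<omega>. (Y n \<omega>)\<^sup>2))"
      using prod(1)[of n 1 1] int Sint by (subst Bochner_Integration.integral_add; simp)+
    also have "\<dots> = real (Suc n) * v"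
      unfolding prod(2) using Suc mean second by (simp add: algebra_simps)
    finally show ?case .
  qed (simp add: S_def)
  then show "expectation (\<lambda>\<omega>. (S n \<omega>)\<^sup>2) = real n * v" .
  have nn: "0 \<le> v" "0 \<le> q"
    using second[of 0, symmetric] fourth[of 0, symmetric] by simp_all
  show "expectation (\<lambda>\<omega>. S n \<omega> ^ 4) \<le> (q + 3 * v\<^sup>2) * (real n)\<^sup>2"
  proof (induction n)
    case (Suc n)
    have "expectation (\<lambda>\<omega>. S (Suc n) \<omega> ^ 4) =
        expectation (\<lambda>\<omega>. S n \<omega> ^ 4 + (4 * (Y n \<omega> ^ 1 * S n \<omega> ^ 3) + (6 * (Y n \<omega> ^ 2 * S n \<omega> ^ 2) + (4 * (Y n \<omega> ^ 3 * S n \<omega> ^ 1) + Y n \<omega> ^ 4))))"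
      by (simp add: S_def power2_eq_square power3_eq_cube power4_eq_xxxx algebra_simps)
    also have "\<dots> = expectation (\<lambda>\<omega>. S n \<omega> ^ 4) + (4 * expectation (\<lambda>\<omega>. Y n \<omega> ^ 1 * S n \<omega> ^ 3) + (6 * expectation (\<lambda>\<omega>. Y n \<omega> ^ 2 * S n \<omega> ^ 2) + (4 * expectation (\<lambda>\<omega>. Y n \<omega> ^ 3 * S n \<omega> ^ 1) + expectation (\<lambda>\<omega>. Y n \<omega> ^ 4))))"
      using prod(1)[of n 1 3] prod(1)[of n 2 2] prod(1)[of n 3 1] int Sint
      by (subst Bochner_Integration.integral_add; simp)+
    also have "\<dots> = expectation (\<lambda>\<omega>. S n \<omega> ^ 4) + 6 * real n * v\<^sup>2 + q"
      unfolding prod(2) using Smean mean second Ssecond fourth by (simp add: power2_eq_square)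
    also have "\<dots> \<le> (q + 3 * v\<^sup>2) * (real n)\<^sup>2 + 6 * real n * v\<^sup>2 + q"
      using Suc by simp
    \<comment> \<open>The right side grows by \<open>(2 * n + 1) * (q + 3 * v\<^sup>2)\<close>,
      which dominates \<open>6 * n * v\<^sup>2 + q\<close>.\<close>
    also have "\<dots> \<le> (q + 3 * v\<^sup>2) * (real (Suc n))\<^sup>2"
      using nn by (simp add: power2_eq_square algebra_simps)
    finally show ?case .
  qed (simp add: S_def)
qed

text \<open>Fourth moments of the means are of order 1 / n^2 and hence summable. The sum of the
  fourth powers is therefore almost surely finite, so its terms tend to zero.\<close>

lemma (in prob_space) strong_law_fourth_moment:
  fixes Y :: "nat \<Rightarrow> 'a \<Rightarrow> real"
  assumes indep: "indep_vars (\<lambda>_. borel) Y UNIV"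
    and int: "\<And>i k. integrable M (\<lambda>\<omega>. Y i \<omega> ^ k)"
    and mean: "\<And>i. expectation (Y i) = 0"
    and second: "\<And>i. expectation (\<lambda>\<omega>. (Y i \<omega>)\<^sup>2) = v"
    and fourth: "\<And>i. expectation (\<lambda>\<omega>. Y i \<omega> ^ 4) = q"
  shows "AE \<omega> in M. (\<lambda>n. (1 / real n) * (\<Sum>i<n. Y i \<omega>)) \<longlonglongrightarrow> 0"
proof -
  define T where "T n \<omega> = ((1 / real n) * (\<Sum>i<n. Y i \<omega>)) ^ 4" for n \<omega>
  have Y[measurable]: "Y i \<in> borel_measurable M" for i
    using int[of i 1] by simp
  have [measurable]: "T n \<in> borel_measurable M" for n unfolding T_def[abs_def] by measurable
  note S = indep_sum_fourth_moment[OF indep int mean second fourth]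
  have Tint: "integrable M (T n)" for n
    unfolding T_def power_mult_distrib by (intro integrable_mult_right S(1))
  have nn: "0 \<le> q + 3 * v\<^sup>2" using fourth[of 0, symmetric] by simp
  have ET: "expectation (T n) \<le> (q + 3 * v\<^sup>2) * inverse (real n ^ 2)" for n
  proof (cases "n = 0")
    case False
    have "expectation (T n) = (1 / real n) ^ 4 * expectation (\<lambda>\<omega>. (\<Sum>i<n. Y i \<omega>) ^ 4)"
      unfolding T_def power_mult_distrib by simp
    also have "\<dots> \<le> (1 / real n) ^ 4 * ((q + 3 * v\<^sup>2) * (real n)\<^sup>2)"
      by (intro mult_left_mono S(3)) auto
    also have "\<dots> = (q + 3 * v\<^sup>2) * inverse (real n ^ 2)"
      using False by (simp add: field_simps power4_eq_xxxx power2_eq_square)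
    finally show ?thesis .
  next
    case True
    \<comment> \<open>By convention \<open>1 / real 0\<close> and \<open>inverse 0\<close> are 0, so
      both sides vanish.\<close>
    then have "T n = (\<lambda>_. 0)" by (simp add: T_def fun_eq_iff)
    then show ?thesis using True by simp
  qed
  have "(\<integral>\<^sup>+\<omega>. (\<Sum>n. ennreal (T n \<omega>)) \<partial>M) = (\<Sum>n. \<integral>\<^sup>+\<omega>. ennreal (T n \<omega>) \<partial>M)"
    by (rule nn_integral_suminf) measurable
  also have "\<dots> = (\<Sum>n. ennreal (expectation (T n)))"
    by (intro suminf_cong nn_integral_eq_integral Tint AE_I2) (simp add: T_def)
  also have "\<dots> \<le> (\<Sum>n. ennreal ((q + 3 * v\<^sup>2) * inverse (real n ^ 2)))"
    by (intro suminf_le ennreal_leI ET) auto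
  also have "\<dots> < \<infinity>"
  proof -
    have "summable (\<lambda>n. (q + 3 * v\<^sup>2) * inverse (real n ^ 2))"
      using inverse_power_summable[of 2, where 'a=real] by (intro summable_mult) simp
    then have "(\<Sum>n. ennreal ((q + 3 * v\<^sup>2) * inverse (real n ^ 2))) = ennreal (\<Sum>n. (q + 3 * v\<^sup>2) * inverse (real n ^ 2))"
      using nn by (intro suminf_ennreal2) auto
    then show ?thesis by simp
  qed
  finally have "(\<integral>\<^sup>+\<omega>. (\<Sum>n. ennreal (T n \<omega>)) \<partial>M) \<noteq> \<infinity>" by simp
  then have "AE \<omega> in M. (\<Sum>n. ennreal (T n \<omega>)) \<noteq> \<infinity>"
    by (intro nn_integral_PInf_AE) auto
  then show ?thesis
  proof eventually_elim
    case (elim \<omega>)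
    let ?a = "\<lambda>n. (1 / real n) * (\<Sum>i<n. Y i \<omega>)"
    have "summable (\<lambda>n. T n \<omega>)"
      using elim by (intro summable_suminf_not_top) (auto simp: T_def)
    then have "(\<lambda>n. ?a n ^ 4) \<longlonglongrightarrow> 0" unfolding T_def by (rule summable_LIMSEQ_zero)
    then have "(\<lambda>n. root 4 (?a n ^ 4)) \<longlonglongrightarrow> root 4 0" by (rule tendsto_real_root)
    moreover have "root 4 (?a n ^ 4) = \<bar>?a n\<bar>" for n
    proof -
      have "root 4 (\<bar>?a n\<bar> ^ 4) = \<bar>?a n\<bar>" by (rule real_root_power_cancel) auto
      also have "\<bar>?a n\<bar> ^ 4 = ?a n ^ 4" by (rule power_even_abs) simp
      finally show ?thesis .
    qed
    ultimately have "(\<lambda>n. \<bar>?a n\<bar>) \<longlonglongrightarrow> 0" by simp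
    then show ?case by (rule tendsto_rabs_zero_cancel)
  qed
qed

section \<open>Independent samples from a law with all moments\<close>

locale iid_sample = prob_space M for M :: "'a measure" +
  fixes X :: "nat \<Rightarrow> 'a \<Rightarrow> real^'n" and P :: "(real^'n) measure"
  assumes indep: "indep_vars (\<lambda>_. borel) X UNIV"
    and law: "\<And>i. distr M borel (X i) = P"
    and moments: "all_moments P"
begin

lemma X_measurable [measurable]: "X i \<in> borel_measurable M"
  using indep unfolding indep_vars_def2 by simp

lemma poly_growth_X:
  assumes f: "poly_growth f"
  shows integrable_poly_growth_X: "integrable M (\<lambda>\<omega>. f (X i \<omega>))"
    and expectation_poly_growth_X: "expectation (\<lambda>\<omega>. f (X i \<omega>)) = (\<integral>x. f x \<partial>P)"
proof -
  have [measurable]: "f \<in> borel_measurable borel" using f by (rule poly_growth_measurable)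
  have "integrable (distr M borel (X i)) f"
    unfolding law by (rule all_moments_integrable[OF moments f])
  then show "integrable M (\<lambda>\<omega>. f (X i \<omega>))" by (subst (asm) integrable_distr_eq) auto
  show "expectation (\<lambda>\<omega>. f (X i \<omega>)) = (\<integral>x. f x \<partial>P)"
    unfolding law[of i, symmetric] by (subst integral_distr) auto
qed

lemma indep_compose:
  "f \<in> borel_measurable borel \<Longrightarrow> indep_vars (\<lambda>_. borel) (\<lambda>i \<omega>. f (X i \<omega>) :: real) UNIV"
  by (rule indep_vars_compose2[OF indep]) auto

lemma AE_avg_tendsto:
  assumes f: "poly_growth f"
  shows "AE \<omega> in M. (\<lambda>n. avg (\<lambda>i. X i \<omega>) n f) \<longlonglongrightarrow> (\<integral>x. f x \<partial>P)"
proof -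
  let ?m = "\<integral>x. f x \<partial>P"
  define g where "g x = f x - ?m" for x
  have g: "poly_growth (\<lambda>x. g x ^ k)" for k unfolding g_def by (intro poly_growth_intros f)
  interpret P: prob_space P using moments by (simp add: all_moments_def)
  have gmean: "(\<integral>x. g x \<partial>P) = 0"
    unfolding g_def using all_moments_integrable[OF moments f] by (simp add: P.prob_space)
  have "AE \<omega> in M. (\<lambda>n. (1 / real n) * (\<Sum>i<n. g (X i \<omega>))) \<longlonglongrightarrow> 0"
  proof (rule strong_law_fourth_moment)
    show "indep_vars (\<lambda>_. borel) (\<lambda>i \<omega>. g (X i \<omega>)) UNIV"
      using poly_growth_measurable[OF g[of 1]] by (intro indep_compose) simp
    show "integrable M (\<lambda>\<omega>. g (X i \<omega>) ^ k)" for i k by (rule integrable_poly_growth_X[OF g])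
    show "expectation (\<lambda>\<omega>. g (X i \<omega>)) = 0" for i
      using expectation_poly_growth_X[OF g[of 1]] gmean by simp
    show "expectation (\<lambda>\<omega>. (g (X i \<omega>))\<^sup>2) = (\<integral>x. (g x)\<^sup>2 \<partial>P)" for i by (rule expectation_poly_growth_X[OF g])
    show "expectation (\<lambda>\<omega>. g (X i \<omega>) ^ 4) = (\<integral>x. g x ^ 4 \<partial>P)" for i by (rule expectation_poly_growth_X[OF g])
  qed
  then show ?thesis
  proof eventually_elim
    case (elim \<omega>)
    \<comment> \<open>Only eventually: at \<open>n = 0\<close> the average is 0 whatever the
      mean.\<close>
    have "\<forall>\<^sub>F n in sequentially. avg (\<lambda>i. X i \<omega>) n f = (1 / real n) * (\<Sum>i<n. g (X i \<omega>)) + ?m"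
      using eventually_gt_at_top[of 0]
      by eventually_elim (simp add: avg_def g_def sum_subtractf right_diff_distrib)
    moreover have "(\<lambda>n. (1 / real n) * (\<Sum>i<n. g (X i \<omega>)) + ?m) \<longlonglongrightarrow> 0 + ?m"
      by (intro tendsto_add elim tendsto_const)
    ultimately show ?case using tendsto_cong by fastforce
  qed
qed

lemma second_moment_sum:
  assumes f: "poly_growth f" and mean: "(\<integral>x. f x \<partial>P) = 0"
  shows "integrable M (\<lambda>\<omega>. (\<Sum>i<n. f (X i \<omega>))\<^sup>2)"
    and "expectation (\<lambda>\<omega>. (\<Sum>i<n. f (X i \<omega>))\<^sup>2) = real n * (\<integral>x. (f x)\<^sup>2 \<partial>P)"
proof -
  have fk: "poly_growth (\<lambda>x. f x ^ k)" for k by (intro poly_growth_intros f)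
  note S = indep_sum_fourth_moment[OF indep_compose[OF poly_growth_measurable[OF f]] integrable_poly_growth_X[OF fk]
    trans[OF expectation_poly_growth_X[OF f] mean] expectation_poly_growth_X[OF fk] expectation_poly_growth_X[OF fk]]
  show "integrable M (\<lambda>\<omega>. (\<Sum>i<n. f (X i \<omega>))\<^sup>2)" by (rule S(1))
  show "expectation (\<lambda>\<omega>. (\<Sum>i<n. f (X i \<omega>))\<^sup>2) = real n * (\<integral>x. (f x)\<^sup>2 \<partial>P)" by (rule S(2))
qed

end

section \<open>Averages of polynomials with convergent coefficients\<close>

definition vec_monomial :: "('n \<Rightarrow> nat) \<Rightarrow> real^'n \<Rightarrow> real" where
  "vec_monomial e y = (\<Prod>i\<in>UNIV. (y $ i) ^ e i)"

lemma poly_growth_vec_monomial: "poly_growth (vec_monomial e)"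
  unfolding vec_monomial_def[abs_def] by (intro poly_growth_intros)

definition moments_converge :: "(nat \<Rightarrow> real^'n) \<Rightarrow> (real^'n) measure \<Rightarrow> bool" where
  "moments_converge x P \<longleftrightarrow> (\<forall>e. (\<lambda>n. avg x n (vec_monomial e)) \<longlonglongrightarrow> (\<integral>y. vec_monomial e y \<partial>P))"

text \<open>There are countably many exponent functions, so one null set serves all of them.
  Consistency and the expansions of the maximizer are then deterministic along a path outside this
  set.\<close>

lemma (in iid_sample) AE_moments_converge: "AE \<omega> in M. moments_converge (\<lambda>i. X i \<omega>) P"
  unfolding moments_converge_def AE_all_countable
  by (intro allI AE_avg_tendsto poly_growth_vec_monomial)

text \<open>A multiplier preserves convergence of the averages against all monomials. Since multipliers are closed
  under sums and products, averages of polynomials with convergent coefficients need not be expanded.\<close>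

definition avg_limit :: "(nat \<Rightarrow> real^'n) \<Rightarrow> (real^'n) measure \<Rightarrow> (nat \<Rightarrow> real^'n \<Rightarrow> real) \<Rightarrow> (real^'n \<Rightarrow> real) \<Rightarrow> bool" where
  "avg_limit x P F f \<longleftrightarrow> poly_growth f \<and>
    (\<forall>e. (\<lambda>n. avg x n (\<lambda>y. F n y * vec_monomial e y)) \<longlonglongrightarrow> (\<integral>y. f y * vec_monomial e y \<partial>P))"

definition avg_multiplier :: "(nat \<Rightarrow> real^'n) \<Rightarrow> (real^'n) measure \<Rightarrow> (nat \<Rightarrow> real^'n \<Rightarrow> real) \<Rightarrow> (real^'n \<Rightarrow> real) \<Rightarrow> bool" where
  "avg_multiplier x P F f \<longleftrightarrow> (\<forall>H h. avg_limit x P H h \<longrightarrow> avg_limit x P (\<lambda>n y. F n y * H n y) (\<lambda>y. f y * h y))"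

lemma avg_add: "avg x n (\<lambda>y. f y + g y) = avg x n f + avg x n g"
  by (simp add: avg_def sum.distrib distrib_left)

lemma avg_cmult: "avg x n (\<lambda>y. c * f y) = c * avg x n f"
  by (simp add: avg_def sum_distrib_left mult_ac)

lemma avg_diff: "avg x n (\<lambda>y. f y - g y) = avg x n f - avg x n g"
  by (simp add: avg_def sum_subtractf right_diff_distrib)

context
  fixes x :: "nat \<Rightarrow> real^'n" and P :: "(real^'n) measure"
  assumes moments: "all_moments P"
begin

lemma avg_multiplier_const:
  assumes "c \<longlonglongrightarrow> c'"
  shows "avg_multiplier x P (\<lambda>n y. c n) (\<lambda>y. c')"
  unfolding avg_multiplier_def avg_limit_def
  using assms by (auto intro!: poly_growth_intros tendsto_mult simp: mult.assoc avg_cmult)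

lemma avg_multiplier_add:
  assumes "avg_multiplier x P F f" "avg_multiplier x P G g"
  shows "avg_multiplier x P (\<lambda>n y. F n y + G n y) (\<lambda>y. f y + g y)"
  unfolding avg_multiplier_def
proof (intro allI impI)
  fix H h assume H: "avg_limit x P H h"
  have F: "avg_limit x P (\<lambda>n y. F n y * H n y) (\<lambda>y. f y * h y)"
    and G: "avg_limit x P (\<lambda>n y. G n y * H n y) (\<lambda>y. g y * h y)"
    using assms H by (auto simp: avg_multiplier_def)
  show "avg_limit x P (\<lambda>n y. (F n y + G n y) * H n y) (\<lambda>y. (f y + g y) * h y)"
    unfolding avg_limit_def
  proof (intro conjI allI)
    show "poly_growth (\<lambda>y. (f y + g y) * h y)"
      using F G by (simp add: avg_limit_def distrib_right poly_growth_add)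
    fix e
    have "(\<integral>y. (f y + g y) * h y * vec_monomial e y \<partial>P) =
        (\<integral>y. f y * h y * vec_monomial e y \<partial>P) + (\<integral>y. g y * h y * vec_monomial e y \<partial>P)"
      unfolding distrib_right
      by (rule Bochner_Integration.integral_add)
         (use F G in \<open>auto simp: avg_limit_def intro!: all_moments_integrable[OF moments] poly_growth_mult poly_growth_vec_monomial\<close>)
    moreover have "(\<lambda>n. avg x n (\<lambda>y. F n y * H n y * vec_monomial e y) + avg x n (\<lambda>y. G n y * H n y * vec_monomial e y))
        \<longlonglongrightarrow> (\<integral>y. f y * h y * vec_monomial e y \<partial>P) + (\<integral>y. g y * h y * vec_monomial e y \<partial>P)"
      using F G by (intro tendsto_add) (auto simp: avg_limit_def)
    ultimately show "(\<lambda>n. avg x n (\<lambda>y. (F n y + G n y) * H n y * vec_monomial e y)) \<longlonglongrightarrow>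
        (\<integral>y. (f y + g y) * h y * vec_monomial e y \<partial>P)"
      by (simp add: distrib_right avg_add)
  qed
qed

lemma avg_multiplier_mult:
  assumes F: "avg_multiplier x P F f" and G: "avg_multiplier x P G g"
  shows "avg_multiplier x P (\<lambda>n y. F n y * G n y) (\<lambda>y. f y * g y)"
  unfolding avg_multiplier_def
proof (intro allI impI)
  fix H h assume "avg_limit x P H h"
  then have "avg_limit x P (\<lambda>n y. G n y * H n y) (\<lambda>y. g y * h y)"
    using G by (auto simp: avg_multiplier_def)
  then have "avg_limit x P (\<lambda>n y. F n y * (G n y * H n y)) (\<lambda>y. f y * (g y * h y))"
    using F unfolding avg_multiplier_def by blast
  then show "avg_limit x P (\<lambda>n y. F n y * G n y * H n y) (\<lambda>y. f y * g y * h y)"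
    by (simp only: mult.assoc)
qed

text \<open>Multiplication by a coordinate only raises one exponent, and \<open>avg_limit\<close>
  speaks about all exponents at once.\<close>

lemma avg_multiplier_component: "avg_multiplier x P (\<lambda>n y. y $ i) (\<lambda>y. y $ i)"
proof -
  have mono: "y $ i * (c * vec_monomial e y) = c * vec_monomial (e(i := Suc (e i))) y" for e c and y :: "real^'n"
  proof -
    have "vec_monomial (e(i := Suc (e i))) y = y $ i * vec_monomial e y"
      unfolding vec_monomial_def by (subst (1 2) prod.remove[of _ i]) auto
    then show ?thesis by simp
  qed
  show ?thesis
    unfolding avg_multiplier_def avg_limit_def
    by (auto simp: mult.assoc mono intro!: poly_growth_intros)
qed

lemma avg_multiplier_uminus: "avg_multiplier x P F f \<Longrightarrow> avg_multiplier x P (\<lambda>n y. - F n y) (\<lambda>y. - f y)"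
  using avg_multiplier_mult[OF avg_multiplier_const[of "\<lambda>_. -1" "-1"]] by fastforce

lemma avg_multiplier_diff:
  "avg_multiplier x P F f \<Longrightarrow> avg_multiplier x P G g \<Longrightarrow> avg_multiplier x P (\<lambda>n y. F n y - G n y) (\<lambda>y. f y - g y)"
  using avg_multiplier_add[OF _ avg_multiplier_uminus] by fastforce

lemma avg_multiplier_power:
  "avg_multiplier x P F f \<Longrightarrow> avg_multiplier x P (\<lambda>n y. F n y ^ k) (\<lambda>y. f y ^ k)"
  by (induction k) (auto intro: avg_multiplier_const avg_multiplier_mult)

lemma avg_multiplier_sum:
  "(\<And>i. i \<in> I \<Longrightarrow> avg_multiplier x P (F i) (f i)) \<Longrightarrow> avg_multiplier x P (\<lambda>n y. \<Sum>i\<in>I. F i n y) (\<lambda>y. \<Sum>i\<in>I. f i y)"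
  by (induction I rule: infinite_finite_induct) (auto intro: avg_multiplier_const avg_multiplier_add)

lemma avg_multiplier_inner:
  assumes "a \<longlonglongrightarrow> a'"
  shows "avg_multiplier x P (\<lambda>n y. a n \<bullet> y) (\<lambda>y. a' \<bullet> y)"
  unfolding inner_vec_def inner_real_def
  by (intro avg_multiplier_sum avg_multiplier_mult avg_multiplier_component avg_multiplier_const tendsto_vec_nth assms)

lemmas avg_multiplier_intros = avg_multiplier_const avg_multiplier_add avg_multiplier_mult avg_multiplier_uminus
  avg_multiplier_diff avg_multiplier_power avg_multiplier_sum avg_multiplier_inner

lemma avg_multiplier_tendsto:
  assumes conv: "moments_converge x P" and F: "avg_multiplier x P F f"
  shows "(\<lambda>n. avg x n (F n)) \<longlonglongrightarrow> (\<integral>y. f y \<partial>P)"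
proof -
  \<comment> \<open>The constant 1 starts the chain: for it \<open>avg_limit\<close> is convergence
    of the monomial averages themselves. The exponent 0 finally removes the monomial.\<close>
  have "avg_limit x P (\<lambda>n y. 1) (\<lambda>y. 1)"
    using conv by (auto simp: avg_limit_def moments_converge_def intro: poly_growth_intros)
  then have "avg_limit x P (\<lambda>n y. F n y * 1) (\<lambda>y. f y * 1)"
    using F unfolding avg_multiplier_def by blast
  then have "(\<lambda>n. avg x n (\<lambda>y. F n y * 1 * vec_monomial (\<lambda>_. 0) y)) \<longlonglongrightarrow> (\<integral>y. f y * 1 * vec_monomial (\<lambda>_. 0) y \<partial>P)"
    unfolding avg_limit_def by blast
  then show ?thesis by (simp add: vec_monomial_def)
qed

lemma sample_mean_tendsto:
  assumes conv: "moments_converge x P"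
  shows "sample_mean x \<longlonglongrightarrow> (\<chi> i. \<integral>y. y $ i \<partial>P)"
proof (rule vec_tendstoI)
  fix i
  have "(\<lambda>n. avg x n (\<lambda>y. y $ i)) \<longlonglongrightarrow> (\<integral>y. y $ i \<partial>P)"
    by (rule avg_multiplier_tendsto[OF conv avg_multiplier_component])
  then show "(\<lambda>n. sample_mean x n $ i) \<longlonglongrightarrow> (\<chi> i. \<integral>y. y $ i \<partial>P) $ i"
    by (simp add: sample_mean_def avg_def)
qed

end

section \<open>Moments of the mixture\<close>

lemma sets_mixture2: "sets (mixture2 a P b Q) = sets P"
  by (simp add: mixture2_def)

lemma nn_integral_mixture2:
  assumes sets: "sets Q = sets P" and f: "f \<in> borel_measurable P"
  shows "(\<integral>\<^sup>+x. f x \<partial>mixture2 a P b Q) = ennreal a * (\<integral>\<^sup>+x. f x \<partial>P) + ennreal b * (\<integral>\<^sup>+x. f x \<partial>Q)"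
proof -
  have [measurable_cong]: "sets (mixture2 a P b Q) = sets P" by (simp add: mixture2_def)
  have sp: "space (mixture2 a P b Q) = space P" "space Q = space P"
    using sets_eq_imp_space_eq[OF sets] by (simp_all add: mixture2_def)
  note [measurable_cong] = sets
  show ?thesis
    using f
  proof induction
    case (cong f g)
    moreover have "(\<integral>\<^sup>+x. f x \<partial>R) = (\<integral>\<^sup>+x. g x \<partial>R)" if "space R = space P" for R
      using cong(3) that by (intro nn_integral_cong) auto
    ultimately show ?case using sp by simp
  next
    case (set A)
    then show ?case using emeasure_mixture2[OF sets set] sets by simp
  next
    case (mult u c)
    then have [measurable]: "u \<in> borel_measurable P" by blast
    have "(\<integral>\<^sup>+x. c * u x \<partial>R) = c * (\<integral>\<^sup>+x. u x \<partial>R)" if [measurable_cong]: "sets R = sets P" for R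
      by (rule nn_integral_cmult) measurable
    then show ?case using mult.IH sets by (simp add: distrib_left mult_ac mixture2_def)
  next
    case (add u v)
    then have [measurable]: "u \<in> borel_measurable P" "v \<in> borel_measurable P" by blast+
    have "(\<integral>\<^sup>+x. v x + u x \<partial>R) = (\<integral>\<^sup>+x. v x \<partial>R) + (\<integral>\<^sup>+x. u x \<partial>R)" if [measurable_cong]: "sets R = sets P" for R
      by (rule nn_integral_add) measurable
    then show ?case using add.IH sets by (simp add: distrib_left add_ac mixture2_def)
  next
    case (seq U)
    then have [measurable]: "U i \<in> borel_measurable P" for i by blast
    have sup: "(\<integral>\<^sup>+x. (SUP i. U i) x \<partial>R) = (SUP i. \<integral>\<^sup>+x. U i x \<partial>R)" if [measurable_cong]: "sets R = sets P" for R
      unfolding SUP_apply by (rule nn_integral_monotone_convergence_SUP[OF seq.hyps(3)]) measurable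
    have inc: "incseq (\<lambda>i. c * (\<integral>\<^sup>+x. U i x \<partial>R))" for c and R :: "'a measure"
      using seq.hyps(3) by (auto simp: incseq_def le_fun_def intro!: mult_left_mono nn_integral_mono)
    show ?case
      using sup[of "mixture2 a P b Q"] sup[of P] sup[OF sets] seq.IH inc
      by (simp add: SUP_mult_left_ennreal ennreal_SUP_add mixture2_def)
  qed
qed

lemma integral_mixture2:
  fixes f :: "'a \<Rightarrow> real"
  assumes sets: "sets Q = sets P" and f: "integrable P f" "integrable Q f" and ab: "0 \<le> a" "0 \<le> b"
  shows "integrable (mixture2 a P b Q) f"
    and "(\<integral>x. f x \<partial>mixture2 a P b Q) = a * (\<integral>x. f x \<partial>P) + b * (\<integral>x. f x \<partial>Q)"
proof -
  have [measurable_cong]: "sets (mixture2 a P b Q) = sets P" by (simp add: mixture2_def)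
  have [measurable]: "f \<in> borel_measurable P" using f(1) by simp
  have fin: "(\<integral>\<^sup>+x. ennreal (f x) \<partial>P) < \<infinity>" "(\<integral>\<^sup>+x. ennreal (f x) \<partial>Q) < \<infinity>"
    "(\<integral>\<^sup>+x. ennreal (- f x) \<partial>P) < \<infinity>" "(\<integral>\<^sup>+x. ennreal (- f x) \<partial>Q) < \<infinity>"
    using f by (auto simp: real_integrable_def less_top)
  have mix: "(\<integral>\<^sup>+x. ennreal (f x) \<partial>mixture2 a P b Q) = ennreal a * (\<integral>\<^sup>+x. ennreal (f x) \<partial>P) + ennreal b * (\<integral>\<^sup>+x. ennreal (f x) \<partial>Q)"
    "(\<integral>\<^sup>+x. ennreal (- f x) \<partial>mixture2 a P b Q) = ennreal a * (\<integral>\<^sup>+x. ennreal (- f x) \<partial>P) + ennreal b * (\<integral>\<^sup>+x. ennreal (- f x) \<partial>Q)"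
    by (rule nn_integral_mixture2[OF sets]; measurable)+
  show int: "integrable (mixture2 a P b Q) f"
    unfolding real_integrable_def mix using fin by (auto simp: ennreal_mult_eq_top_iff less_top)
  show "(\<integral>x. f x \<partial>mixture2 a P b Q) = a * (\<integral>x. f x \<partial>P) + b * (\<integral>x. f x \<partial>Q)"
    unfolding real_lebesgue_integral_def[OF int] real_lebesgue_integral_def[OF f(1)] real_lebesgue_integral_def[OF f(2)] mix
    using fin ab by (simp add: enn2real_plus enn2real_mult ennreal_mult_less_top algebra_simps)
qed

lemma std_mvn_shifted_power:
  fixes c :: "real^'n"
  shows "(\<integral>z. (r + c \<bullet> z) ^ k \<partial>std_mvn) = (\<Sum>j\<le>k. real (k choose j) * r ^ (k - j) * (norm c ^ j * std_moment j))"
proof -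
  have "(\<integral>z. (r + c \<bullet> z) ^ k \<partial>std_mvn) = (\<integral>z. (\<Sum>j\<le>k. real (k choose j) * r ^ (k - j) * (c \<bullet> z) ^ j) \<partial>std_mvn)"
    by (subst add.commute) (simp add: binomial_ring mult_ac)
  also have "\<dots> = (\<Sum>j\<le>k. real (k choose j) * r ^ (k - j) * (norm c ^ j * std_moment j))"
    by (subst Bochner_Integration.integral_sum)
       (auto simp: std_mvn_integral_inner_power intro!: integrable_mult_right std_mvn_integrable_inner_power)
  finally show ?thesis .
qed

lemma std_moment_values:
  "std_moment 1 = 0" "std_moment 2 = 1" "std_moment 3 = 0" "std_moment 4 = 3" "std_moment 5 = 0" "std_moment 6 = 15"
  using std_moment_odd[of 1] std_moment_odd[of 3] std_moment_odd[of 5]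
    std_moment_even[of 1] std_moment_even[of 2] std_moment_even[of 3]
  by (simp_all add: fact_numeral)

lemma std_mvn_shifted_power_values:
  fixes c :: "real^'n"
  shows "(\<integral>z. (r + c \<bullet> z) \<partial>std_mvn) = r"
    "(\<integral>z. (r + c \<bullet> z)\<^sup>2 \<partial>std_mvn) = r\<^sup>2 + c \<bullet> c"
    "(\<integral>z. (r + c \<bullet> z) ^ 3 \<partial>std_mvn) = r ^ 3 + 3 * r * (c \<bullet> c)"
    "(\<integral>z. (r + c \<bullet> z) ^ 4 \<partial>std_mvn) = r ^ 4 + 6 * r\<^sup>2 * (c \<bullet> c) + 3 * (c \<bullet> c)\<^sup>2"
    "(\<integral>z. (r + c \<bullet> z) ^ 5 \<partial>std_mvn) = r ^ 5 + 10 * r ^ 3 * (c \<bullet> c) + 15 * r * (c \<bullet> c)\<^sup>2"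
    "(\<integral>z. (r + c \<bullet> z) ^ 6 \<partial>std_mvn) = r ^ 6 + 15 * r ^ 4 * (c \<bullet> c) + 45 * r\<^sup>2 * (c \<bullet> c)\<^sup>2 + 15 * (c \<bullet> c) ^ 3"
proof -
  have n: "norm c ^ 2 = c \<bullet> c" "norm c ^ 4 = (c \<bullet> c)\<^sup>2" "norm c ^ 6 = (c \<bullet> c) ^ 3"
    using power_mult[of "norm c" 2 2] power_mult[of "norm c" 2 3] by (simp_all add: power2_norm_eq_inner)
  have c: "(\<Sum>j\<le>k. f j) = (\<Sum>j<Suc k. f j)" for f :: "nat \<Rightarrow> real" and k by (simp add: lessThan_Suc_atMost)
  note s = std_mvn_shifted_power[of r c, unfolded c]
  note v = std_moment_0 std_moment_values std_moment_values(1)[unfolded One_nat_def] n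
  show "(\<integral>z. (r + c \<bullet> z) \<partial>std_mvn) = r"
    using s[of 1] v by simp
  show "(\<integral>z. (r + c \<bullet> z)\<^sup>2 \<partial>std_mvn) = r\<^sup>2 + c \<bullet> c"
  proof -
    have "{..<Suc 2} = {0,1,2}" by auto
    then show ?thesis unfolding s by (simp add: v)
  qed
  show "(\<integral>z. (r + c \<bullet> z) ^ 3 \<partial>std_mvn) = r ^ 3 + 3 * r * (c \<bullet> c)"
  proof -
    have "{..<Suc 3} = {0,1,2,3}" by auto
    moreover have "3 choose 2 = 3" by (simp add: numeral_eq_Suc)
    ultimately show ?thesis unfolding s by (simp add: v)
  qed
  show "(\<integral>z. (r + c \<bullet> z) ^ 4 \<partial>std_mvn) = r ^ 4 + 6 * r\<^sup>2 * (c \<bullet> c) + 3 * (c \<bullet> c)\<^sup>2"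
  proof -
    have "{..<Suc 4} = {0,1,2,3,4}" by auto
    moreover have "4 choose 2 = 6" by (simp add: numeral_eq_Suc)
    ultimately show ?thesis unfolding s by (simp add: v)
  qed
  show "(\<integral>z. (r + c \<bullet> z) ^ 5 \<partial>std_mvn) = r ^ 5 + 10 * r ^ 3 * (c \<bullet> c) + 15 * r * (c \<bullet> c)\<^sup>2"
  proof -
    have "{..<Suc 5} = {0,1,2,3,4,5}" by auto
    moreover have "5 choose 2 = 10" "5 choose 4 = 5" by (simp_all add: numeral_eq_Suc)
    ultimately show ?thesis unfolding s by (simp add: v)
  qed
  show "(\<integral>z. (r + c \<bullet> z) ^ 6 \<partial>std_mvn) = r ^ 6 + 15 * r ^ 4 * (c \<bullet> c) + 45 * r\<^sup>2 * (c \<bullet> c)\<^sup>2 + 15 * (c \<bullet> c) ^ 3"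
  proof -
    have "{..<Suc 6} = {0,1,2,3,4,5,6}" by auto
    moreover have "6 choose 2 = 15" "6 choose 4 = 15" by (simp_all add: numeral_eq_Suc)
    ultimately show ?thesis unfolding s by (simp add: v)
  qed
qed

text \<open>With \<open>d\<close> the projected distance of the component means,
  \<open>- b * d\<close> and \<open>a * d\<close> are their positions relative to the mixture mean
  and \<open>s\<close> is the common projected variance. The left sides mix the shifted normal
  moments; the right sides collect them in terms of \<open>a * b\<close> and
  \<open>a - b\<close>.\<close>

lemma two_point_moments:
  fixes a b d s :: real
  assumes b: "b = 1 - a"
  shows "a * ((- b * d)\<^sup>2 + s) + b * ((a * d)\<^sup>2 + s) = s + a * b * d\<^sup>2"
    "a * ((- b * d) ^ 3 + 3 * (- b * d) * s) + b * ((a * d) ^ 3 + 3 * (a * d) * s) = a * b * (a - b) * d ^ 3"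
    "a * ((- b * d) ^ 4 + 6 * (- b * d)\<^sup>2 * s + 3 * s\<^sup>2) + b * ((a * d) ^ 4 + 6 * (a * d)\<^sup>2 * s + 3 * s\<^sup>2) =
      3 * s\<^sup>2 + 6 * (a * b) * s * d\<^sup>2 + a * b * (1 - 3 * (a * b)) * d ^ 4"
    "a * ((- b * d) ^ 5 + 10 * (- b * d) ^ 3 * s + 15 * (- b * d) * s\<^sup>2) + b * ((a * d) ^ 5 + 10 * (a * d) ^ 3 * s + 15 * (a * d) * s\<^sup>2) =
      10 * (a * b) * (a - b) * s * d ^ 3 + a * b * (a - b) * (1 - 2 * (a * b)) * d ^ 5"
    "a * ((- b * d) ^ 6 + 15 * (- b * d) ^ 4 * s + 45 * (- b * d)\<^sup>2 * s\<^sup>2 + 15 * s ^ 3)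
      + b * ((a * d) ^ 6 + 15 * (a * d) ^ 4 * s + 45 * (a * d)\<^sup>2 * s\<^sup>2 + 15 * s ^ 3) =
      15 * s ^ 3 + 45 * (a * b) * s\<^sup>2 * d\<^sup>2 + 15 * (a * b) * (1 - 3 * (a * b)) * s * d ^ 4
        + a * b * (1 - 5 * (a * b) + 5 * (a * b)\<^sup>2) * d ^ 6"
  unfolding b by (simp_all add: algebra_simps eval_nat_numeral)

section \<open>The mixture law and its discriminant direction\<close>

locale normal_mixture =
  fixes \<alpha>1 \<alpha>2 :: real and \<mu>1 \<mu>2 :: "real^'p" and \<Sigma> :: "real^'p^'p"
  assumes \<alpha>: "0 < \<alpha>1" "\<alpha>1 < 1" "\<alpha>2 = 1 - \<alpha>1"
    and \<mu>: "\<mu>1 \<noteq> \<mu>2"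
    and \<Sigma>: "covariance_matrix \<Sigma>" "rank \<Sigma> = CARD('p)"
begin

definition \<delta> where "\<delta> = \<mu>2 - \<mu>1"
definition \<theta> where "\<theta> = matrix_inv \<Sigma> *v \<delta>"
definition \<beta> where "\<beta> = \<alpha>1 * \<alpha>2"
definition \<tau> where "\<tau> = \<delta> \<bullet> \<theta>"
definition mean where "mean = \<alpha>1 *\<^sub>R \<mu>1 + \<alpha>2 *\<^sub>R \<mu>2"
definition P where "P = mixture2 \<alpha>1 (mvn \<mu>1 \<Sigma>) \<alpha>2 (mvn \<mu>2 \<Sigma>)"
text \<open>The same choice term as in \<open>mvn\<close>, so that both component laws are affine
  images of \<open>std_mvn\<close> under this one matrix.\<close>

definition B :: "real^'p^'p" where "B = (SOME A. A ** transpose A = \<Sigma>)"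

lemma B: "B ** transpose B = \<Sigma>"
  unfolding B_def using covariance_matrix_sqrt[OF \<Sigma>(1)] by (metis (mono_tags, lifting) someI_ex)

lemma \<alpha>2_pos: "0 < \<alpha>2" using \<alpha> by simp

lemma \<beta>_pos: "0 < \<beta>" unfolding \<beta>_def using \<alpha>(1) \<alpha>2_pos by simp

lemma \<beta>_le: "4 * \<beta> \<le> 1" "(\<alpha>1 - \<alpha>2)\<^sup>2 = 1 - 4 * \<beta>"
proof -
  show "(\<alpha>1 - \<alpha>2)\<^sup>2 = 1 - 4 * \<beta>"
    unfolding \<beta>_def unfolding \<alpha>(3) by (simp add: power2_eq_square algebra_simps)
  then show "4 * \<beta> \<le> 1" by (metis diff_ge_0_iff_ge zero_le_power2)
qed

lemma \<Sigma>_sym: "v \<bullet> (\<Sigma> *v w) = w \<bullet> (\<Sigma> *v v)"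
  using \<Sigma>(1) inner_symmetric_matrix unfolding covariance_matrix_def by blast

lemma \<Sigma>_apply_B: "\<Sigma> *v w = B *v (transpose B *v w)"
  by (simp only: matrix_vector_mul_assoc B)

lemma \<Sigma>_inner_B: "v \<bullet> (\<Sigma> *v w) = (transpose B *v v) \<bullet> (transpose B *v w)"
  unfolding \<Sigma>_apply_B by (simp add: dot_lmul_matrix)

lemma inner_B: "e \<bullet> (B *v z) = (transpose B *v e) \<bullet> z"
  by (simp add: dot_lmul_matrix)

lemma \<Sigma>_inj: "inj ((*v) \<Sigma>)"
  using \<Sigma>(2) by (simp add: full_rank_injective)

lemma matrix_inv_\<Sigma>: "\<Sigma> ** matrix_inv \<Sigma> = mat 1" "matrix_inv \<Sigma> ** \<Sigma> = mat 1"
proof -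
  have "invertible \<Sigma>"
    using \<Sigma>_inj matrix_left_invertible_injective[of \<Sigma>] by (simp add: invertible_left_inverse)
  then show "\<Sigma> ** matrix_inv \<Sigma> = mat 1" "matrix_inv \<Sigma> ** \<Sigma> = mat 1"
    by (auto simp: matrix_inv_def invertible_def intro: someI2_ex)
qed

lemma \<Sigma>_inv_apply: "\<Sigma> *v (matrix_inv \<Sigma> *v v) = v" "matrix_inv \<Sigma> *v (\<Sigma> *v v) = v"
  by (simp_all add: matrix_vector_mul_assoc matrix_inv_\<Sigma>)

lemma \<Sigma>_\<theta>: "\<Sigma> *v \<theta> = \<delta>"
  by (simp add: \<theta>_def \<Sigma>_inv_apply)

text \<open>Full rank makes the semidefinite form definite: a vector annihilated by
  \<open>transpose B\<close> is annihilated by the injective \<Sigma>.\<close>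

lemma \<Sigma>_pos: "v \<noteq> 0 \<Longrightarrow> 0 < v \<bullet> (\<Sigma> *v v)"
proof -
  assume "v \<noteq> 0"
  then have "\<Sigma> *v v \<noteq> 0" using \<Sigma>_inj injD[of "(*v) \<Sigma>" v 0] by auto
  then have "transpose B *v v \<noteq> 0"
    unfolding \<Sigma>_apply_B by auto
  then show ?thesis unfolding \<Sigma>_inner_B by simp
qed

lemma \<delta>_nonzero: "\<delta> \<noteq> 0" using \<mu> by (simp add: \<delta>_def)

lemma \<theta>_nonzero: "\<theta> \<noteq> 0" using \<Sigma>_\<theta> \<delta>_nonzero by auto

lemma inner_\<delta>: "v \<bullet> \<delta> = v \<bullet> (\<Sigma> *v \<theta>)" "\<delta> \<bullet> v = v \<bullet> (\<Sigma> *v \<theta>)"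
  by (simp_all add: \<Sigma>_\<theta> inner_commute)

lemma \<tau>_pos: "0 < \<tau>"
  unfolding \<tau>_def inner_\<delta> by (rule \<Sigma>_pos[OF \<theta>_nonzero])

lemma \<tau>_eq: "\<theta> \<bullet> \<delta> = \<tau>" "\<theta> \<bullet> (\<Sigma> *v \<theta>) = \<tau>"
  by (simp_all add: \<tau>_def inner_\<delta>)

lemma mvn_eq: "mvn m \<Sigma> = distr std_mvn borel (\<lambda>z. m + B *v z)"
  by (simp add: mvn_def B_def)

lemma all_moments_mvn: "all_moments (mvn m \<Sigma>)"
  unfolding all_moments_def
proof (intro conjI allI)
  have "poly_growth (\<lambda>x::real^'p. norm x ^ k)" for k
    by (rule poly_growthI[of _ 1 k]) (auto intro: power_mono)
  then have "poly_growth (\<lambda>z. norm (m + B *v z) ^ k)" for k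
    by (rule poly_growth_compose_affine)
  then show "integrable (mvn m \<Sigma>) (\<lambda>x. norm x ^ k)" for k
    unfolding mvn_eq
    by (subst integrable_distr_eq)
       (auto intro: all_moments_integrable[OF all_moments_std_mvn] simp: measurable_cong_sets[OF sets_std_mvn refl])
qed (auto simp: prob_space_mvn sets_mvn)

lemma integral_mvn:
  "poly_growth f \<Longrightarrow> (\<integral>x. f x \<partial>mvn m \<Sigma>) = (\<integral>z. f (m + B *v z) \<partial>std_mvn)"
  unfolding mvn_eq
  by (subst integral_distr) (auto simp: measurable_cong_sets[OF sets_std_mvn refl] poly_growth_measurable)

lemma all_moments_P: "all_moments P"
  unfolding all_moments_def
proof (intro conjI allI)
  show "sets P = sets borel" by (simp add: P_def sets_mixture2 sets_mvn)
  have "emeasure P (space P) = ennreal \<alpha>1 + ennreal \<alpha>2"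
    unfolding P_def
    using emeasure_mixture2[of "mvn \<mu>2 \<Sigma>" "mvn \<mu>1 \<Sigma>" UNIV \<alpha>1 \<alpha>2]
      prob_space.emeasure_space_1[OF prob_space_mvn[of \<mu>1 \<Sigma>]] prob_space.emeasure_space_1[OF prob_space_mvn[of \<mu>2 \<Sigma>]]
    by (simp add: mixture2_def space_mvn sets_mvn)
  also have "\<dots> = 1" using \<alpha> by (simp add: ennreal_plus[symmetric] del: ennreal_plus)
  finally show "prob_space P" by (rule prob_spaceI)
  show "integrable P (\<lambda>x. norm x ^ m)" for m
    unfolding P_def using \<alpha>(1) \<alpha>2_pos all_moments_mvn
    by (intro integral_mixture2(1)) (auto simp: sets_mvn all_moments_def)
qed

lemma mean_shift: "\<mu>1 + b - mean = - \<alpha>2 *\<^sub>R \<delta> + b" "\<mu>2 + b - mean = \<alpha>1 *\<^sub>R \<delta> + b"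
proof -
  have one: "\<alpha>1 + \<alpha>2 = 1" using \<alpha>(3) by simp
  have "\<mu>1 + b - mean = (\<alpha>1 + \<alpha>2) *\<^sub>R \<mu>1 + b - mean" unfolding one by simp
  also have "\<dots> = - \<alpha>2 *\<^sub>R \<delta> + b" by (simp add: mean_def \<delta>_def algebra_simps)
  finally show "\<mu>1 + b - mean = - \<alpha>2 *\<^sub>R \<delta> + b" .
  have "\<mu>2 + b - mean = (\<alpha>1 + \<alpha>2) *\<^sub>R \<mu>2 + b - mean" unfolding one by simp
  also have "\<dots> = \<alpha>1 *\<^sub>R \<delta> + b" by (simp add: mean_def \<delta>_def algebra_simps)
  finally show "\<mu>2 + b - mean = \<alpha>1 *\<^sub>R \<delta> + b" .
qed

lemma integral_P:
  assumes f: "poly_growth f"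
  shows "(\<integral>x. f (x - mean) \<partial>P) = \<alpha>1 * (\<integral>z. f (- \<alpha>2 *\<^sub>R \<delta> + B *v z) \<partial>std_mvn) + \<alpha>2 * (\<integral>z. f (\<alpha>1 *\<^sub>R \<delta> + B *v z) \<partial>std_mvn)"
proof -
  note g = poly_growth_shift[OF f, of mean]
  have "(\<integral>x. f (x - mean) \<partial>P) = \<alpha>1 * (\<integral>z. f (\<mu>1 + B *v z - mean) \<partial>std_mvn) + \<alpha>2 * (\<integral>z. f (\<mu>2 + B *v z - mean) \<partial>std_mvn)"
    unfolding P_def using \<alpha>(1) \<alpha>2_pos
    by (subst integral_mixture2(2))
       (auto simp: sets_mvn integral_mvn[OF g] intro!: all_moments_integrable[OF all_moments_mvn g])
  then show ?thesis unfolding mean_shift .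
qed

lemma integral_P_inner_power:
  defines "m \<equiv> \<lambda>k u. (\<integral>x. (u \<bullet> (x - mean)) ^ k \<partial>P)"
  shows "m 1 u = 0"
    and "m 2 u = u \<bullet> (\<Sigma> *v u) + \<beta> * (u \<bullet> \<delta>)\<^sup>2"
    and "m 3 u = \<beta> * (\<alpha>1 - \<alpha>2) * (u \<bullet> \<delta>) ^ 3"
    and "m 4 u = 3 * (u \<bullet> (\<Sigma> *v u))\<^sup>2 + 6 * \<beta> * (u \<bullet> (\<Sigma> *v u)) * (u \<bullet> \<delta>)\<^sup>2 + \<beta> * (1 - 3 * \<beta>) * (u \<bullet> \<delta>) ^ 4"
    and "m 5 u = 10 * \<beta> * (\<alpha>1 - \<alpha>2) * (u \<bullet> (\<Sigma> *v u)) * (u \<bullet> \<delta>) ^ 3 + \<beta> * (\<alpha>1 - \<alpha>2) * (1 - 2 * \<beta>) * (u \<bullet> \<delta>) ^ 5"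
    and "m 6 u = 15 * (u \<bullet> (\<Sigma> *v u)) ^ 3 + 45 * \<beta> * (u \<bullet> (\<Sigma> *v u))\<^sup>2 * (u \<bullet> \<delta>)\<^sup>2
      + 15 * \<beta> * (1 - 3 * \<beta>) * (u \<bullet> (\<Sigma> *v u)) * (u \<bullet> \<delta>) ^ 4 + \<beta> * (1 - 5 * \<beta> + 5 * \<beta>\<^sup>2) * (u \<bullet> \<delta>) ^ 6"
proof -
  let ?d = "u \<bullet> \<delta>" and ?c = "transpose B *v u"
  have m: "m k u = \<alpha>1 * (\<integral>z. (- \<alpha>2 * ?d + ?c \<bullet> z) ^ k \<partial>std_mvn) + \<alpha>2 * (\<integral>z. (\<alpha>1 * ?d + ?c \<bullet> z) ^ k \<partial>std_mvn)" for k
    unfolding m_def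
    by (subst integral_P[of "\<lambda>y. (u \<bullet> y) ^ k"]) (auto intro!: poly_growth_intros simp: inner_add_right inner_diff_right inner_B)
  have s: "?c \<bullet> ?c = u \<bullet> (\<Sigma> *v u)" by (rule \<Sigma>_inner_B[symmetric])
  note v = std_mvn_shifted_power_values[where c="?c", unfolded s]
  show "m 1 u = 0" unfolding m power_one_right v(1) by simp
  show "m 2 u = u \<bullet> (\<Sigma> *v u) + \<beta> * (u \<bullet> \<delta>)\<^sup>2"
    unfolding m v \<beta>_def by (rule two_point_moments(1)[OF \<alpha>(3)])
  show "m 3 u = \<beta> * (\<alpha>1 - \<alpha>2) * (u \<bullet> \<delta>) ^ 3"
    unfolding m v \<beta>_def by (rule two_point_moments(2)[OF \<alpha>(3)])
  show "m 4 u = 3 * (u \<bullet> (\<Sigma> *v u))\<^sup>2 + 6 * \<beta> * (u \<bullet> (\<Sigma> *v u)) * (u \<bullet> \<delta>)\<^sup>2 + \<beta> * (1 - 3 * \<beta>) * (u \<bullet> \<delta>) ^ 4"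
    unfolding m v \<beta>_def by (rule two_point_moments(3)[OF \<alpha>(3)])
  show "m 5 u = 10 * \<beta> * (\<alpha>1 - \<alpha>2) * (u \<bullet> (\<Sigma> *v u)) * (u \<bullet> \<delta>) ^ 3 + \<beta> * (\<alpha>1 - \<alpha>2) * (1 - 2 * \<beta>) * (u \<bullet> \<delta>) ^ 5"
    unfolding m v \<beta>_def by (rule two_point_moments(4)[OF \<alpha>(3)])
  show "m 6 u = 15 * (u \<bullet> (\<Sigma> *v u)) ^ 3 + 45 * \<beta> * (u \<bullet> (\<Sigma> *v u))\<^sup>2 * (u \<bullet> \<delta>)\<^sup>2
      + 15 * \<beta> * (1 - 3 * \<beta>) * (u \<bullet> (\<Sigma> *v u)) * (u \<bullet> \<delta>) ^ 4 + \<beta> * (1 - 5 * \<beta> + 5 * \<beta>\<^sup>2) * (u \<bullet> \<delta>) ^ 6"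
    unfolding m v \<beta>_def by (rule two_point_moments(5)[OF \<alpha>(3)])
qed

text \<open>For \<open>e \<bottom> \<delta>\<close> the projection \<open>e \<bullet> (x - mean)\<close> has the same centred normal law in both components and is
  independent of \<open>\<theta> \<bullet> (x - mean)\<close>, because \<open>\<theta> \<bullet> \<Sigma> e = \<delta> \<bullet> e = 0\<close>.\<close>
lemma integral_P_orthogonal:
  assumes e: "e \<bullet> \<delta> = 0" and f: "f \<bullet> \<delta> = 0"
  shows "(\<integral>x. poly q (\<theta> \<bullet> (x - mean)) * (e \<bullet> (x - mean)) \<partial>P) = 0"
    and "(\<integral>x. poly q (\<theta> \<bullet> (x - mean)) * ((e \<bullet> (x - mean)) * (f \<bullet> (x - mean))) \<partial>P) =
      (e \<bullet> (\<Sigma> *v f)) * (\<integral>x. poly q (\<theta> \<bullet> (x - mean)) \<partial>P)"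
proof -
  let ?a = "transpose B *v \<theta>" and ?b = "transpose B *v e" and ?c = "transpose B *v f"
  have ab: "?a \<bullet> ?b = 0" "?a \<bullet> ?c = 0"
    unfolding \<Sigma>_inner_B[symmetric] \<Sigma>_sym[of \<theta>] \<Sigma>_\<theta> by (rule e, rule f)
  \<comment> \<open>The shift of a component along \<delta> is absorbed into the polynomial, so that
    the standard normal orthogonality applies to each component.\<close>
  have q: "poly q (\<theta> \<bullet> (r *\<^sub>R \<delta> + B *v z)) = poly (pcompose q [:r * \<tau>, 1:]) (?a \<bullet> z)" for r z
    by (simp add: poly_pcompose inner_add_right \<tau>_eq inner_B)
  have ez: "e \<bullet> (r *\<^sub>R \<delta> + B *v z) = ?b \<bullet> z" and fz: "f \<bullet> (r *\<^sub>R \<delta> + B *v z) = ?c \<bullet> z" for r z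
    by (simp_all add: inner_add_right inner_B e f)
  note orth = std_mvn_orthogonal_poly[OF ab]
  show "(\<integral>x. poly q (\<theta> \<bullet> (x - mean)) * (e \<bullet> (x - mean)) \<partial>P) = 0"
  proof -
    have "poly_growth (\<lambda>y. poly q (\<theta> \<bullet> y) * (e \<bullet> y))" by (intro poly_growth_intros)
    from integral_P[OF this] show ?thesis by (simp only: q ez orth mult_zero_right add_0_left)
  qed
  have "(\<integral>x. poly q (\<theta> \<bullet> (x - mean)) * ((e \<bullet> (x - mean)) * (f \<bullet> (x - mean))) \<partial>P) =
      \<alpha>1 * ((?b \<bullet> ?c) * (\<integral>z. poly q (\<theta> \<bullet> (- \<alpha>2 *\<^sub>R \<delta> + B *v z)) \<partial>std_mvn)) +
      \<alpha>2 * ((?b \<bullet> ?c) * (\<integral>z. poly q (\<theta> \<bullet> (\<alpha>1 *\<^sub>R \<delta> + B *v z)) \<partial>std_mvn))"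
  proof -
    have "poly_growth (\<lambda>y. poly q (\<theta> \<bullet> y) * ((e \<bullet> y) * (f \<bullet> y)))" by (intro poly_growth_intros)
    from integral_P[OF this] show ?thesis by (simp only: q ez fz orth)
  qed
  also have "\<dots> = (?b \<bullet> ?c) * (\<integral>x. poly q (\<theta> \<bullet> (x - mean)) \<partial>P)"
  proof -
    have "poly_growth (\<lambda>y. poly q (\<theta> \<bullet> y))" by (intro poly_growth_intros)
    from integral_P[OF this] show ?thesis by (simp only: distrib_left mult_ac)
  qed
  finally show "(\<integral>x. poly q (\<theta> \<bullet> (x - mean)) * ((e \<bullet> (x - mean)) * (f \<bullet> (x - mean))) \<partial>P) =
      (e \<bullet> (\<Sigma> *v f)) * (\<integral>x. poly q (\<theta> \<bullet> (x - mean)) \<partial>P)"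
    unfolding \<Sigma>_inner_B .
qed

end

section \<open>The population index\<close>

text \<open>\<open>E2\<close> to \<open>E6\<close> are the central moments of the discriminating
  projection Z. The coefficients \<open>a0, a1, a2\<close> and \<open>b0, b1, b3\<close> belong to
  two polynomials A(Z) and B(Z), the skewness and the kurtosis part of the score after common
  factors are removed. The three identities compute E[A^2], E[A B] and E[B^2]; the last one is the
  origin of \<open>Delta\<close>.\<close>

lemma rational_index_algebra:
  fixes \<beta> \<epsilon> \<tau> D k :: real
  assumes \<epsilon>: "\<epsilon>\<^sup>2 = 1 - 4 * \<beta>" and D: "D = 1 + \<beta> * \<tau>" and k: "k = 1 - 6 * \<beta>"
  defines "E2 \<equiv> \<tau> + \<beta> * \<tau>\<^sup>2"
    and "E3 \<equiv> \<beta> * \<epsilon> * \<tau> ^ 3"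
    and "E4 \<equiv> 3 * \<tau>\<^sup>2 + 6 * \<beta> * \<tau> * \<tau>\<^sup>2 + \<beta> * (1 - 3 * \<beta>) * \<tau> ^ 4"
    and "E5 \<equiv> 10 * \<beta> * \<epsilon> * \<tau> * \<tau> ^ 3 + \<beta> * \<epsilon> * (1 - 2 * \<beta>) * \<tau> ^ 5"
    and "E6 \<equiv> 15 * \<tau> ^ 3 + 45 * \<beta> * \<tau>\<^sup>2 * \<tau>\<^sup>2 + 15 * \<beta> * (1 - 3 * \<beta>) * \<tau> * \<tau> ^ 4 + \<beta> * (1 - 5 * \<beta> + 5 * \<beta>\<^sup>2) * \<tau> ^ 6"
    and "a0 \<equiv> - \<tau> * D\<^sup>2" and "a1 \<equiv> - \<beta> * \<epsilon> * \<tau>\<^sup>2" and "a2 \<equiv> D"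
    and "b0 \<equiv> - \<beta> * \<epsilon> * \<tau> ^ 3 * D" and "b1 \<equiv> - \<tau> * (3 * D\<^sup>2 + \<beta> * k * \<tau>\<^sup>2)" and "b3 \<equiv> D"
  shows "a0\<^sup>2 + (a1\<^sup>2 + 2 * a0 * a2) * E2 + 2 * a1 * a2 * E3 + a2\<^sup>2 * E4 = \<tau>\<^sup>2 * D * (2 + 6 * \<beta> * \<tau> + \<beta> * \<tau>\<^sup>2)"
    and "a0 * b0 + (a1 * b1 + a2 * b0) * E2 + (a0 * b3 + a2 * b1) * E3 + a1 * b3 * E4 + a2 * b3 * E5 = \<tau> ^ 4 * D * \<epsilon> * \<beta> * (6 + \<tau>)"
    and "b0\<^sup>2 + b1\<^sup>2 * E2 + 2 * b0 * b3 * E3 + 2 * b1 * b3 * E4 + b3\<^sup>2 * E6 = \<tau> ^ 3 * D * Delta \<beta> \<tau>"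
proof -
  have eps1: "\<epsilon> * \<epsilon> = 1 - 4 * \<beta>" using \<epsilon> by (simp add: power2_eq_square)
  \<comment> \<open>\<epsilon> is known only through its square; this form of the rule also fires
    inside right-nested products.\<close>
  have "\<epsilon> * (\<epsilon> * r) = (1 - 4 * \<beta>) * r" for r
    unfolding eps1[symmetric] by (rule mult.assoc[symmetric])
  with eps1 have eps: "\<epsilon> * \<epsilon> = 1 - 4 * \<beta>" "\<epsilon> * (\<epsilon> * r) = r - 4 * \<beta> * r" for r
    by (auto simp: left_diff_distrib)
  note defs = E2_def E3_def E4_def E5_def E6_def a0_def a1_def a2_def b0_def b1_def b3_def D k Delta_def
  show "a0\<^sup>2 + (a1\<^sup>2 + 2 * a0 * a2) * E2 + 2 * a1 * a2 * E3 + a2\<^sup>2 * E4 = \<tau>\<^sup>2 * D * (2 + 6 * \<beta> * \<tau> + \<beta> * \<tau>\<^sup>2)"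
    unfolding defs by (simp add: algebra_simps eval_nat_numeral eps)
  show "a0 * b0 + (a1 * b1 + a2 * b0) * E2 + (a0 * b3 + a2 * b1) * E3 + a1 * b3 * E4 + a2 * b3 * E5 = \<tau> ^ 4 * D * \<epsilon> * \<beta> * (6 + \<tau>)"
    unfolding defs by (simp add: algebra_simps eval_nat_numeral eps)
  show "b0\<^sup>2 + b1\<^sup>2 * E2 + 2 * b0 * b3 * E3 + 2 * b1 * b3 * E4 + b3\<^sup>2 * E6 = \<tau> ^ 3 * D * Delta \<beta> \<tau>"
    unfolding defs by (simp add: algebra_simps eval_nat_numeral eps)
qed

text \<open>\<open>rational_index w1 w2\<close> expresses the index through the second, third and fourth central moments;
  \<open>index_d2\<close>, \<open>index_d3\<close> and \<open>index_d4\<close> are its partial derivatives.\<close>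

definition rational_index :: "real \<Rightarrow> real \<Rightarrow> real \<Rightarrow> real \<Rightarrow> real \<Rightarrow> real" where
  "rational_index w1 w2 a b c = w1 * (b\<^sup>2 / a ^ 3) + w2 * (c / a\<^sup>2 - 3)\<^sup>2"

definition index_d2 :: "real \<Rightarrow> real \<Rightarrow> real \<Rightarrow> real \<Rightarrow> real \<Rightarrow> real" where
  "index_d2 w1 w2 a b c = - 3 * w1 * b\<^sup>2 / a ^ 4 - 4 * w2 * (c / a\<^sup>2 - 3) * c / a ^ 3"

definition index_d3 :: "real \<Rightarrow> real \<Rightarrow> real \<Rightarrow> real" where
  "index_d3 w1 a b = 2 * w1 * b / a ^ 3"

definition index_d4 :: "real \<Rightarrow> real \<Rightarrow> real \<Rightarrow> real" where
  "index_d4 w2 a c = 2 * w2 * (c / a\<^sup>2 - 3) / a\<^sup>2"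

text \<open>The factor \<open>2 * \<beta> / D ^ 5\<close> is pulled out of every score coefficient,
  and the rest is grouped by \<open>3 * w1 * \<epsilon> * D\<close> and \<open>4 * w2 * k\<close>,
  the weights of the skewness and kurtosis polynomials. Here \<open>k\<close> stems from the fourth
  cumulant \<open>c - 3 * a\<^sup>2\<close>. The last identity gives the bracket whose square is in
  the denominator of \<open>C_eta\<close>.\<close>

lemma index_derivative_values:
  fixes \<beta> \<epsilon> \<tau> D k :: real
  assumes \<epsilon>: "\<epsilon>\<^sup>2 = 1 - 4 * \<beta>" and D: "D = 1 + \<beta> * \<tau>" and k: "k = 1 - 6 * \<beta>"
    and pos: "\<tau> > 0" "D > 0"
    and a: "a = \<tau> * D" and b: "b = \<beta> * \<epsilon> * \<tau> ^ 3" and c: "c = 3 * a\<^sup>2 + \<beta> * k * \<tau> ^ 4"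
  shows "4 * index_d4 w2 a c = 2 * \<beta> / D ^ 5 * (4 * w2 * k * D)"
    and "3 * index_d3 w1 a b = 2 * \<beta> / D ^ 5 * (3 * w1 * \<epsilon> * D * D)"
    and "2 * index_d2 w1 w2 a b c = 2 * \<beta> / D ^ 5 * (3 * w1 * \<epsilon> * D * (- \<beta> * \<epsilon> * \<tau>\<^sup>2) + 4 * w2 * k * (- \<tau> * (3 * D\<^sup>2 + \<beta> * k * \<tau>\<^sup>2)))"
    and "- (3 * index_d3 w1 a b * a + 4 * index_d4 w2 a c * b) =
      2 * \<beta> / D ^ 5 * (3 * w1 * \<epsilon> * D * (- \<tau> * D\<^sup>2) + 4 * w2 * k * (- \<beta> * \<epsilon> * \<tau> ^ 3 * D))"
    and "2 * index_d2 w1 w2 a b c + 12 * index_d4 w2 a c * a =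
      - (2 * \<beta>\<^sup>2 * \<tau>\<^sup>2 / D ^ 5) * (3 * w1 * D * (1 - 4 * \<beta>) + 4 * w2 * \<tau> * k\<^sup>2)"
proof -
  have k3: "c / a\<^sup>2 - 3 = \<beta> * k * \<tau>\<^sup>2 / D\<^sup>2"
    unfolding c a using pos by (simp add: field_simps eval_nat_numeral)
  have d4: "index_d4 w2 a c = 2 * w2 * \<beta> * k / D ^ 4"
    unfolding index_d4_def k3 unfolding a using pos by (simp add: field_simps eval_nat_numeral)
  have d3: "index_d3 w1 a b = 2 * w1 * \<beta> * \<epsilon> / D ^ 3"
    unfolding index_d3_def b a using pos by (simp add: field_simps eval_nat_numeral)
  have ca: "c / a ^ 3 = (3 * D\<^sup>2 + \<beta> * k * \<tau>\<^sup>2) / (\<tau> * D ^ 3)"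
    unfolding c a using pos by (simp add: field_simps eval_nat_numeral)
  have ba: "b\<^sup>2 / a ^ 4 = \<beta>\<^sup>2 * \<epsilon>\<^sup>2 * \<tau>\<^sup>2 / D ^ 4"
    unfolding b a using pos by (simp add: field_simps eval_nat_numeral)
  have "index_d2 w1 w2 a b c = - 3 * w1 * (b\<^sup>2 / a ^ 4) - 4 * w2 * (c / a\<^sup>2 - 3) * (c / a ^ 3)"
    by (simp add: index_d2_def)
  also have "\<dots> = - 3 * w1 * (\<beta>\<^sup>2 * \<epsilon>\<^sup>2 * \<tau>\<^sup>2 / D ^ 4) - 4 * w2 * (\<beta> * k * \<tau>\<^sup>2 / D\<^sup>2) * ((3 * D\<^sup>2 + \<beta> * k * \<tau>\<^sup>2) / (\<tau> * D ^ 3))"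
    unfolding ba k3 ca ..
  also have "\<dots> = - 3 * w1 * \<beta>\<^sup>2 * \<epsilon>\<^sup>2 * \<tau>\<^sup>2 / D ^ 4 - 4 * w2 * \<beta> * k * \<tau> * (3 * D\<^sup>2 + \<beta> * k * \<tau>\<^sup>2) / D ^ 5"
    using pos by (simp add: field_simps eval_nat_numeral)
  finally have d2: "index_d2 w1 w2 a b c = - 3 * w1 * \<beta>\<^sup>2 * \<epsilon>\<^sup>2 * \<tau>\<^sup>2 / D ^ 4 - 4 * w2 * \<beta> * k * \<tau> * (3 * D\<^sup>2 + \<beta> * k * \<tau>\<^sup>2) / D ^ 5" .
  show "4 * index_d4 w2 a c = 2 * \<beta> / D ^ 5 * (4 * w2 * k * D)"
    unfolding d4 using pos by (simp add: field_simps eval_nat_numeral)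
  show "3 * index_d3 w1 a b = 2 * \<beta> / D ^ 5 * (3 * w1 * \<epsilon> * D * D)"
    unfolding d3 using pos by (simp add: field_simps eval_nat_numeral)
  show "2 * index_d2 w1 w2 a b c = 2 * \<beta> / D ^ 5 * (3 * w1 * \<epsilon> * D * (- \<beta> * \<epsilon> * \<tau>\<^sup>2) + 4 * w2 * k * (- \<tau> * (3 * D\<^sup>2 + \<beta> * k * \<tau>\<^sup>2)))"
    unfolding d2 using pos by (simp add: field_simps eval_nat_numeral)
  show "- (3 * index_d3 w1 a b * a + 4 * index_d4 w2 a c * b) =
      2 * \<beta> / D ^ 5 * (3 * w1 * \<epsilon> * D * (- \<tau> * D\<^sup>2) + 4 * w2 * k * (- \<beta> * \<epsilon> * \<tau> ^ 3 * D))"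
    unfolding d3 d4 unfolding a b using pos by (simp add: field_simps eval_nat_numeral)
  show "2 * index_d2 w1 w2 a b c + 12 * index_d4 w2 a c * a =
      - (2 * \<beta>\<^sup>2 * \<tau>\<^sup>2 / D ^ 5) * (3 * w1 * D * (1 - 4 * \<beta>) + 4 * w2 * \<tau> * k\<^sup>2)"
    unfolding d2 d4 unfolding a \<epsilon>[symmetric] using pos by (simp add: field_simps eval_nat_numeral)
qed

locale mixture_index = normal_mixture \<alpha>1 \<alpha>2 \<mu>1 \<mu>2 \<Sigma>
  for \<alpha>1 \<alpha>2 :: real and \<mu>1 \<mu>2 :: "real^'p" and \<Sigma> :: "real^'p^'p" +
  fixes w1 w2 :: real
  assumes w: "0 < w1" "0 < w2"
begin

definition mom where "mom k u = (\<integral>x. (u \<bullet> (x - mean)) ^ k \<partial>P)"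

definition population_index where
  "population_index u = rational_index w1 w2 (mom 2 u) (mom 3 u) (mom 4 u)"

lemma mom_values:
  "mom 1 u = 0"
  "mom 2 u = u \<bullet> (\<Sigma> *v u) + \<beta> * (u \<bullet> \<delta>)\<^sup>2"
  "mom 3 u = \<beta> * (\<alpha>1 - \<alpha>2) * (u \<bullet> \<delta>) ^ 3"
  "mom 4 u = 3 * (mom 2 u)\<^sup>2 + \<beta> * (1 - 6 * \<beta>) * (u \<bullet> \<delta>) ^ 4"
  unfolding mom_def integral_P_inner_power
  by (simp_all add: algebra_simps eval_nat_numeral)

lemma mom_2_pos: "u \<noteq> 0 \<Longrightarrow> 0 < mom 2 u"
  unfolding mom_values using \<Sigma>_pos[of u] \<beta>_pos by (intro add_pos_nonneg) auto

text \<open>The common normal noise contributes nothing to cumulants of order three and four, so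
  \<open>mom 3 u\<close> and \<open>mom 4 u - 3 * (mom 2 u)\<^sup>2\<close> are pure powers of
  \<open>u \<bullet> \<delta>\<close>, and the index depends on \<open>u\<close> only through one
  ratio.\<close>

lemma population_index_eq:
  assumes "u \<noteq> 0"
  shows "population_index u = w1 * (\<beta>\<^sup>2 * (1 - 4 * \<beta>)) * ((u \<bullet> \<delta>)\<^sup>2 / mom 2 u) ^ 3
    + w2 * (\<beta> * (1 - 6 * \<beta>))\<^sup>2 * ((u \<bullet> \<delta>)\<^sup>2 / mom 2 u) ^ 4"
proof -
  have p: "mom 2 u > 0" by (rule mom_2_pos[OF assms])
  have "(mom 3 u)\<^sup>2 / mom 2 u ^ 3 = \<beta>\<^sup>2 * (\<alpha>1 - \<alpha>2)\<^sup>2 * ((u \<bullet> \<delta>)\<^sup>2 / mom 2 u) ^ 3"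
    unfolding mom_values(3) by (simp add: power_mult_distrib power_divide power_mult[symmetric])
  moreover have "mom 4 u / (mom 2 u)\<^sup>2 - 3 = \<beta> * (1 - 6 * \<beta>) * ((u \<bullet> \<delta>)\<^sup>2 / mom 2 u)\<^sup>2"
    unfolding mom_values(4) using p by (simp add: field_simps eval_nat_numeral)
  ultimately show ?thesis
    unfolding population_index_def rational_index_def \<beta>_le(2)
    by (simp add: power_mult_distrib power_mult[symmetric])
qed

lemma population_index_maximizer:
  assumes u: "u \<noteq> 0" and max: "population_index \<theta> \<le> population_index u"
  shows "u = ((u \<bullet> \<delta>) / \<tau>) *\<^sub>R \<theta>"
proof -
  let ?d = "u \<bullet> \<delta>" and ?s = "u \<bullet> (\<Sigma> *v u)"
  define \<rho> where "\<rho> u = (u \<bullet> \<delta>)\<^sup>2 / mom 2 u" for u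
  have \<rho>_nonneg: "u \<noteq> 0 \<Longrightarrow> 0 \<le> \<rho> u" for u unfolding \<rho>_def using mom_2_pos[of u] by simp
  define h where "h r = w1 * (\<beta>\<^sup>2 * (1 - 4 * \<beta>)) * r ^ 3 + w2 * (\<beta> * (1 - 6 * \<beta>))\<^sup>2 * r ^ 4" for r
  have idx: "u \<noteq> 0 \<Longrightarrow> population_index u = h (\<rho> u)" for u
    unfolding h_def \<rho>_def by (rule population_index_eq)
  \<comment> \<open>At \<beta> = 1/4 the cubic term vanishes, but then
    \<open>1 - 6 * \<beta>\<close> is -1/2 and the quartic term is strictly increasing; for other
    \<beta> the cubic term is.\<close>
  have h_mono: "h r < h r'" if "0 \<le> r" "r < r'" for r r'
  proof (cases "\<beta> = 1/4")
    case True
    have "r ^ 4 < r' ^ 4" using that by (intro power_strict_mono) auto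
    then show ?thesis unfolding h_def True using w(2) by (simp add: power_divide)
  next
    case False
    then have "1 - 4 * \<beta> > 0" using \<beta>_le(1) by simp
    then have "w1 * (\<beta>\<^sup>2 * (1 - 4 * \<beta>)) * r ^ 3 < w1 * (\<beta>\<^sup>2 * (1 - 4 * \<beta>)) * r' ^ 3"
      using that w(1) \<beta>_pos by (intro mult_strict_left_mono power_strict_mono mult_pos_pos) auto
    moreover have "w2 * (\<beta> * (1 - 6 * \<beta>))\<^sup>2 * r ^ 4 \<le> w2 * (\<beta> * (1 - 6 * \<beta>))\<^sup>2 * r' ^ 4"
      using that w(2) by (intro mult_left_mono power_mono mult_nonneg_nonneg) auto
    ultimately show ?thesis unfolding h_def by linarith
  qed
  have le: "\<rho> \<theta> \<le> \<rho> u"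
  proof (rule ccontr)
    assume "\<not> \<rho> \<theta> \<le> \<rho> u"
    then have "h (\<rho> u) < h (\<rho> \<theta>)" using \<rho>_nonneg[OF u] by (intro h_mono) auto
    then show False using max idx[OF u] idx[OF \<theta>_nonzero] by simp
  qed
  have "\<tau>\<^sup>2 * mom 2 u \<le> ?d\<^sup>2 * mom 2 \<theta>"
    using le mom_2_pos[OF u] mom_2_pos[OF \<theta>_nonzero]
    unfolding \<rho>_def \<tau>_eq by (simp add: field_simps)
  \<comment> \<open>The between-component parts of both variances cancel, which leaves a comparison
    of the squared projections relative to the form \<Sigma>.\<close>
  then have "\<tau> * (\<tau> * ?s) \<le> \<tau> * ?d\<^sup>2"
    unfolding mom_values \<tau>_eq by (simp add: algebra_simps power2_eq_square)
  then have ts: "\<tau> * ?s \<le> ?d\<^sup>2" using \<tau>_pos by simp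
  \<comment> \<open>The equality case of Cauchy-Schwarz: this is the \<Sigma>-orthogonal residual of
    \<open>u\<close> with respect to \<theta>, and its \<Sigma>-length is at most zero.\<close>
  let ?v = "u - (?d / \<tau>) *\<^sub>R \<theta>"
  have "?v \<bullet> (\<Sigma> *v ?v) = ?s - 2 * (?d / \<tau>) * ?d + (?d / \<tau>)\<^sup>2 * \<tau>"
    by (simp add: matrix_vector_mult_diff_distrib matrix_vector_mult_scaleR \<Sigma>_\<theta> inner_diff_left inner_diff_right
        \<tau>_eq \<Sigma>_sym[of \<theta> u] power2_eq_square algebra_simps)
  also have "\<dots> = (\<tau> * ?s - ?d\<^sup>2) / \<tau>" using \<tau>_pos by (simp add: field_simps power2_eq_square)
  also have "\<dots> \<le> 0" using ts \<tau>_pos by (simp add: divide_nonpos_pos)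
  finally have "?v = 0" using \<Sigma>_pos[of ?v] by (cases "?v = 0") auto
  then show ?thesis by simp
qed

section \<open>Score, curvature and limit variance\<close>

definition d2 where "d2 = index_d2 w1 w2 (mom 2 \<theta>) (mom 3 \<theta>) (mom 4 \<theta>)"
definition d3 where "d3 = index_d3 w1 (mom 2 \<theta>) (mom 3 \<theta>)"
definition d4 where "d4 = index_d4 w2 (mom 2 \<theta>) (mom 4 \<theta>)"

text \<open>The expectation of the derivative of \<open>score\<close> at Z = \<theta> \<bullet> (x -
  mean); its linear term drops out because Z is centred.\<close>

definition curv where "curv = 2 * d2 + 12 * d4 * mom 2 \<theta>"

text \<open>The non-constant coefficients come from differentiating the powers 2, 3, 4 of the
  projection. The constant one reflects centring at the sample mean and makes the expectation of the
  score vanish.\<close>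

definition score :: "real poly" where
  "score = [:- (3 * d3 * mom 2 \<theta> + 4 * d4 * mom 3 \<theta>), 2 * d2, 3 * d3, 4 * d4:]"

lemma d_values:
  fixes D k \<epsilon> :: real
  defines "D \<equiv> 1 + \<beta> * \<tau>" and "k \<equiv> 1 - 6 * \<beta>" and "\<epsilon> \<equiv> \<alpha>1 - \<alpha>2"
  shows "4 * d4 = 2 * \<beta> / D ^ 5 * (4 * w2 * k * D)"
    and "3 * d3 = 2 * \<beta> / D ^ 5 * (3 * w1 * \<epsilon> * D * D)"
    and "2 * d2 = 2 * \<beta> / D ^ 5 * (3 * w1 * \<epsilon> * D * (- \<beta> * \<epsilon> * \<tau>\<^sup>2) + 4 * w2 * k * (- \<tau> * (3 * D\<^sup>2 + \<beta> * k * \<tau>\<^sup>2)))"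
    and "- (3 * d3 * mom 2 \<theta> + 4 * d4 * mom 3 \<theta>) =
      2 * \<beta> / D ^ 5 * (3 * w1 * \<epsilon> * D * (- \<tau> * D\<^sup>2) + 4 * w2 * k * (- \<beta> * \<epsilon> * \<tau> ^ 3 * D))"
    and "curv = - (2 * \<beta>\<^sup>2 * \<tau>\<^sup>2 / D ^ 5) * (3 * w1 * D * (1 - 4 * \<beta>) + 4 * w2 * \<tau> * k\<^sup>2)"
proof -
  have \<epsilon>: "\<epsilon>\<^sup>2 = 1 - 4 * \<beta>" unfolding \<epsilon>_def by (rule \<beta>_le(2))
  have Dp: "D > 0" unfolding D_def using \<beta>_pos \<tau>_pos by (simp add: add_pos_pos)
  have a: "mom 2 \<theta> = \<tau> * D" unfolding mom_values \<tau>_eq D_def by (simp add: algebra_simps power2_eq_square)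
  have b: "mom 3 \<theta> = \<beta> * \<epsilon> * \<tau> ^ 3" unfolding mom_values \<tau>_eq \<epsilon>_def ..
  have c: "mom 4 \<theta> = 3 * (mom 2 \<theta>)\<^sup>2 + \<beta> * k * \<tau> ^ 4" unfolding mom_values(4) \<tau>_eq k_def ..
  note v = index_derivative_values[OF \<epsilon> meta_eq_to_obj_eq[OF D_def] meta_eq_to_obj_eq[OF k_def] \<tau>_pos Dp a b c]
  show "4 * d4 = 2 * \<beta> / D ^ 5 * (4 * w2 * k * D)"
    "3 * d3 = 2 * \<beta> / D ^ 5 * (3 * w1 * \<epsilon> * D * D)"
    "2 * d2 = 2 * \<beta> / D ^ 5 * (3 * w1 * \<epsilon> * D * (- \<beta> * \<epsilon> * \<tau>\<^sup>2) + 4 * w2 * k * (- \<tau> * (3 * D\<^sup>2 + \<beta> * k * \<tau>\<^sup>2)))"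
    "- (3 * d3 * mom 2 \<theta> + 4 * d4 * mom 3 \<theta>) =
      2 * \<beta> / D ^ 5 * (3 * w1 * \<epsilon> * D * (- \<tau> * D\<^sup>2) + 4 * w2 * k * (- \<beta> * \<epsilon> * \<tau> ^ 3 * D))"
    "curv = - (2 * \<beta>\<^sup>2 * \<tau>\<^sup>2 / D ^ 5) * (3 * w1 * D * (1 - 4 * \<beta>) + 4 * w2 * \<tau> * k\<^sup>2)"
    unfolding curv_def d2_def d3_def d4_def by (rule v)+
qed

text \<open>Both summands are nonnegative; they vanish only at \<beta> = 1/4 and at \<beta> = 1/6
  respectively.\<close>

lemma curvature_pos: "0 < 3 * w1 * (1 + \<beta> * \<tau>) * (1 - 4 * \<beta>) + 4 * w2 * \<tau> * (1 - 6 * \<beta>)\<^sup>2"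
proof (cases "\<beta> = 1/4")
  case True
  show ?thesis unfolding True using w \<tau>_pos by (simp add: power2_eq_square)
next
  case False
  then have "1 - 4 * \<beta> > 0" using \<beta>_le(1) by simp
  then have "0 < 3 * w1 * (1 + \<beta> * \<tau>) * (1 - 4 * \<beta>)" using w \<beta>_pos \<tau>_pos by (intro mult_pos_pos add_pos_pos) auto
  then show ?thesis using w \<tau>_pos by (intro add_pos_nonneg) auto
qed

lemma curv_neg: "curv < 0"
proof -
  have "0 < 2 * \<beta>\<^sup>2 * \<tau>\<^sup>2 / (1 + \<beta> * \<tau>) ^ 5" using \<beta>_pos \<tau>_pos by (intro divide_pos_pos zero_less_power) (auto intro: add_pos_pos)
  then show ?thesis unfolding d_values(5) mult_minus_left neg_less_0_iff_less by (rule mult_pos_pos[OF _ curvature_pos])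
qed

lemma integrable_discriminant_power: "integrable P (\<lambda>x. c * (\<theta> \<bullet> (x - mean)) ^ k)"
  by (rule all_moments_integrable[OF all_moments_P poly_growth_shift]) (intro poly_growth_intros)

lemma expectation_cubic_squared:
  "(\<integral>x. (poly [:c0, c1, c2, c3:] (\<theta> \<bullet> (x - mean)))\<^sup>2 \<partial>P) =
    c0\<^sup>2 + (c1\<^sup>2 + 2 * c0 * c2) * mom 2 \<theta> + (2 * c0 * c3 + 2 * c1 * c2) * mom 3 \<theta>
    + (c2\<^sup>2 + 2 * c1 * c3) * mom 4 \<theta> + 2 * c2 * c3 * mom 5 \<theta> + c3\<^sup>2 * mom 6 \<theta>"
proof -
  let ?Z = "\<lambda>x. \<theta> \<bullet> (x - mean)"
  interpret prob_space P using all_moments_P by (simp add: all_moments_def)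
  have "(\<integral>x. (poly [:c0, c1, c2, c3:] (?Z x))\<^sup>2 \<partial>P) =
    (\<integral>x. c0\<^sup>2 * ?Z x ^ 0 + (2 * c0 * c1 * ?Z x ^ 1 + ((c1\<^sup>2 + 2 * c0 * c2) * ?Z x ^ 2 + ((2 * c0 * c3 + 2 * c1 * c2) * ?Z x ^ 3
    + ((c2\<^sup>2 + 2 * c1 * c3) * ?Z x ^ 4 + (2 * c2 * c3 * ?Z x ^ 5 + c3\<^sup>2 * ?Z x ^ 6))))) \<partial>P)"
    by (rule Bochner_Integration.integral_cong) (simp_all add: algebra_simps eval_nat_numeral)
  also have "\<dots> = c0\<^sup>2 * mom 0 \<theta> + (2 * c0 * c1 * mom 1 \<theta> + ((c1\<^sup>2 + 2 * c0 * c2) * mom 2 \<theta> + ((2 * c0 * c3 + 2 * c1 * c2) * mom 3 \<theta>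
    + ((c2\<^sup>2 + 2 * c1 * c3) * mom 4 \<theta> + (2 * c2 * c3 * mom 5 \<theta> + c3\<^sup>2 * mom 6 \<theta>)))))"
    by (simp only: Bochner_Integration.integral_add Bochner_Integration.integrable_add integrable_discriminant_power integral_mult_right_zero mom_def)
  also have "mom 0 \<theta> = 1" unfolding mom_def by (simp add: prob_space)
  finally show ?thesis unfolding mom_values(1) by simp
qed

text \<open>The score is \<open>r * (p * A + q * B)\<close> with the two polynomials of
  \<open>rational_index_algebra\<close>, so its second moment is a quadratic form in
  \<open>p\<close> and \<open>q\<close>. The factor \<open>r\<^sup>2\<close> cancels against the one
  in \<open>curv\<^sup>2\<close>.\<close>

lemma score_variance:
  "(\<integral>x. (poly score (\<theta> \<bullet> (x - mean)))\<^sup>2 \<partial>P) / curv\<^sup>2 = C_eta w1 w2 \<beta> \<tau> * (1 + \<beta> * \<tau>) / \<beta>"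
proof -
  define D where "D = 1 + \<beta> * \<tau>"
  define k where "k = 1 - 6 * \<beta>"
  define \<epsilon> where "\<epsilon> = \<alpha>1 - \<alpha>2"
  define N where "N = 3 * w1 * D * (1 - 4 * \<beta>) + 4 * w2 * \<tau> * k\<^sup>2"
  define p where "p = 3 * w1 * \<epsilon> * D"
  define q where "q = 4 * w2 * k"
  have Dp: "D > 0" unfolding D_def using \<beta>_pos \<tau>_pos by (simp add: add_pos_pos)
  have Np: "N > 0" unfolding N_def D_def k_def by (rule curvature_pos)
  have \<epsilon>: "\<epsilon>\<^sup>2 = 1 - 4 * \<beta>" unfolding \<epsilon>_def by (rule \<beta>_le(2))
  define E2 where "E2 = \<tau> + \<beta> * \<tau>\<^sup>2"
  define E3 where "E3 = \<beta> * \<epsilon> * \<tau> ^ 3"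
  define E4 where "E4 = 3 * \<tau>\<^sup>2 + 6 * \<beta> * \<tau> * \<tau>\<^sup>2 + \<beta> * (1 - 3 * \<beta>) * \<tau> ^ 4"
  define E5 where "E5 = 10 * \<beta> * \<epsilon> * \<tau> * \<tau> ^ 3 + \<beta> * \<epsilon> * (1 - 2 * \<beta>) * \<tau> ^ 5"
  define E6 where "E6 = 15 * \<tau> ^ 3 + 45 * \<beta> * \<tau>\<^sup>2 * \<tau>\<^sup>2 + 15 * \<beta> * (1 - 3 * \<beta>) * \<tau> * \<tau> ^ 4 + \<beta> * (1 - 5 * \<beta> + 5 * \<beta>\<^sup>2) * \<tau> ^ 6"
  define a0 where "a0 = - \<tau> * D\<^sup>2"
  define a1 where "a1 = - \<beta> * \<epsilon> * \<tau>\<^sup>2"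
  define a2 where "a2 = D"
  define b0 where "b0 = - \<beta> * \<epsilon> * \<tau> ^ 3 * D"
  define b1 where "b1 = - \<tau> * (3 * D\<^sup>2 + \<beta> * k * \<tau>\<^sup>2)"
  define b3 where "b3 = D"
  have mom: "mom 2 \<theta> = E2" "mom 3 \<theta> = E3" "mom 4 \<theta> = E4" "mom 5 \<theta> = E5" "mom 6 \<theta> = E6"
    unfolding mom_def integral_P_inner_power \<tau>_eq E2_def E3_def E4_def E5_def E6_def \<epsilon>_def by simp_all
  note A = rational_index_algebra[OF \<epsilon> D_def k_def, folded E2_def E3_def E4_def E5_def E6_def, folded a0_def a1_def b0_def b1_def,
      folded a2_def, folded b3_def]
  define r where "r = 2 * \<beta> / D ^ 5"
  have score: "score = [:r * (p * a0 + q * b0), r * (p * a1 + q * b1), r * (p * D), r * (q * D):]"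
    unfolding score_def d_values(4) unfolding d_values(1,2,3) D_def[symmetric] k_def[symmetric] \<epsilon>_def[symmetric] r_def[symmetric]
    by (simp add: p_def q_def a0_def a1_def b0_def b1_def)
  have "(\<integral>x. (poly score (\<theta> \<bullet> (x - mean)))\<^sup>2 \<partial>P) =
      r\<^sup>2 * (p\<^sup>2 * (a0\<^sup>2 + (a1\<^sup>2 + 2 * a0 * D) * E2 + 2 * a1 * D * E3 + D\<^sup>2 * E4)
      + 2 * p * q * (a0 * b0 + (a1 * b1 + D * b0) * E2 + (a0 * D + D * b1) * E3 + a1 * D * E4 + D * D * E5)
      + q\<^sup>2 * (b0\<^sup>2 + b1\<^sup>2 * E2 + 2 * b0 * D * E3 + 2 * b1 * D * E4 + D\<^sup>2 * E6))"
    unfolding score expectation_cubic_squared mom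
    by (simp add: power2_eq_square distrib_left distrib_right ac_simps)
  also have "\<dots> = r\<^sup>2 * (p\<^sup>2 * (\<tau>\<^sup>2 * D * (2 + 6 * \<beta> * \<tau> + \<beta> * \<tau>\<^sup>2)) + 2 * p * q * (\<tau> ^ 4 * D * \<epsilon> * \<beta> * (6 + \<tau>))
      + q\<^sup>2 * (\<tau> ^ 3 * D * Delta \<beta> \<tau>))"
    using A unfolding a2_def b3_def by simp
  also have "\<dots> = r\<^sup>2 * \<tau>\<^sup>2 * D * (9 * w1\<^sup>2 * (1 - 4 * \<beta>) * D\<^sup>2 * (2 + 6 * \<beta> * \<tau> + \<beta> * \<tau>\<^sup>2)
      + 24 * w1 * w2 * (1 - 4 * \<beta>) * k * D * (\<tau>\<^sup>2 * \<beta> * (6 + \<tau>)) + 16 * w2\<^sup>2 * k\<^sup>2 * \<tau> * Delta \<beta> \<tau>)"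
    unfolding p_def q_def \<epsilon>[symmetric] by (simp add: power2_eq_square power4_eq_xxxx power3_eq_cube distrib_left distrib_right ac_simps)
  finally have var: "(\<integral>x. (poly score (\<theta> \<bullet> (x - mean)))\<^sup>2 \<partial>P) = r\<^sup>2 * \<tau>\<^sup>2 * D * (9 * w1\<^sup>2 * (1 - 4 * \<beta>) * D\<^sup>2 * (2 + 6 * \<beta> * \<tau> + \<beta> * \<tau>\<^sup>2)
      + 24 * w1 * w2 * (1 - 4 * \<beta>) * k * D * (\<tau>\<^sup>2 * \<beta> * (6 + \<tau>)) + 16 * w2\<^sup>2 * k\<^sup>2 * \<tau> * Delta \<beta> \<tau>)" (is "_ = _ * ?num") .
  have lam: "curv\<^sup>2 = r\<^sup>2 * (\<beta>\<^sup>2 * \<tau> ^ 4 * N\<^sup>2)"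
    unfolding d_values D_def[symmetric] k_def[symmetric] N_def[symmetric] r_def
    by (simp add: power_mult_distrib power_divide power2_eq_square power4_eq_xxxx)
  have C: "C_eta w1 w2 \<beta> \<tau> = ?num / (\<beta> * \<tau>\<^sup>2 * N\<^sup>2)"
    unfolding C_eta_def N_def D_def k_def add_divide_distrib[symmetric]
    by (rule arg_cong2[where f="(/)"]) (simp_all add: power2_eq_square algebra_simps)
  have "0 < r" unfolding r_def using \<beta>_pos Dp by (intro divide_pos_pos mult_pos_pos zero_less_power) auto
  then have s: "r\<^sup>2 \<noteq> 0" by simp
  \<comment> \<open>Stated for an arbitrary \<open>n\<close>, so that the long numerator is not
    expanded.\<close>
  have gen: "r\<^sup>2 * \<tau>\<^sup>2 * D * n / (r\<^sup>2 * (\<beta>\<^sup>2 * \<tau> ^ 4 * N\<^sup>2)) = n / (\<beta> * \<tau>\<^sup>2 * N\<^sup>2) * D / \<beta>" for n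
    using \<beta>_pos \<tau>_pos Np s by (simp add: divide_simps) (simp add: power2_eq_square power4_eq_xxxx)
  show ?thesis unfolding var lam C D_def[symmetric] by (rule gen)
qed

end

section \<open>Consistency and first-order condition\<close>

lemma proj_moment_eq_avg: "proj_moment k x n u = avg x n (\<lambda>y. (u \<bullet> (y - sample_mean x n)) ^ k)"
  by (simp add: proj_moment_def avg_def)

text \<open>Squaring removes the fractional power, also for zero variance, where both sides are 0.
  The index becomes a rational function of polynomials in the direction.\<close>

lemma eta_index_eq_rational_index:
  "eta_index w1 w2 x n u = rational_index w1 w2 (proj_moment 2 x n u) (proj_moment 3 x n u) (proj_moment 4 x n u)"
proof -
  have "0 \<le> proj_moment 2 x n u" by (simp add: proj_moment_def sum_nonneg)
  then have "(proj_moment 2 x n u powr (3 / 2))\<^sup>2 = proj_moment 2 x n u ^ 3"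
    by (cases "proj_moment 2 x n u = 0") (simp_all add: power2_eq_square powr_add[symmetric])
  then show ?thesis
    by (simp add: eta_index_def rational_index_def sample_skewness_def sample_kurtosis_def power_divide)
qed

lemma eta_index_scaleR:
  assumes "c \<noteq> 0"
  shows "eta_index w1 w2 x n (c *\<^sub>R u) = eta_index w1 w2 x n u"
proof -
  have s: "proj_moment k x n (c *\<^sub>R u) = c ^ k * proj_moment k x n u" for k
    by (simp add: proj_moment_def power_mult_distrib sum_distrib_left mult_ac)
  have "(c ^ 3 * b)\<^sup>2 / (c\<^sup>2 * a) ^ 3 = b\<^sup>2 / a ^ 3" for a b :: real
    using assms by (simp add: power_mult_distrib power_mult[symmetric])
  moreover have "c ^ 4 * b / (c\<^sup>2 * a)\<^sup>2 = b / a\<^sup>2" for a b :: real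
    using assms by (simp add: power_mult_distrib power_mult[symmetric])
  ultimately show ?thesis unfolding eta_index_eq_rational_index s rational_index_def by simp
qed

lemma rational_index_has_derivative:
  fixes f g h :: "real \<Rightarrow> real"
  assumes f: "(f has_real_derivative f') (at t)" and g: "(g has_real_derivative g') (at t)"
    and h: "(h has_real_derivative h') (at t)" and pos: "0 < f t"
  shows "((\<lambda>t. rational_index w1 w2 (f t) (g t) (h t)) has_real_derivative
    index_d2 w1 w2 (f t) (g t) (h t) * f' + index_d3 w1 (f t) (g t) * g' + index_d4 w2 (f t) (h t) * h') (at t)"
proof -
  have 1: "((\<lambda>t. g t ^ 2 / f t ^ 3) has_real_derivative 2 * g t / f t ^ 3 * g' - 3 * (g t)\<^sup>2 / f t ^ 4 * f') (at t)"
    by (rule DERIV_cong[OF DERIV_divide[OF DERIV_power[OF g] DERIV_power[OF f]]])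
       (use pos in \<open>simp_all add: field_simps eval_nat_numeral\<close>)
  have 2: "((\<lambda>t. h t / f t ^ 2 - 3) has_real_derivative h' / (f t)\<^sup>2 - 2 * h t / f t ^ 3 * f' - 0) (at t)"
    by (rule DERIV_diff[OF DERIV_cong[OF DERIV_divide[OF h DERIV_power[OF f]]] DERIV_const])
       (use pos in \<open>simp_all add: field_simps eval_nat_numeral\<close>)
  show ?thesis
    unfolding rational_index_def
    by (rule DERIV_cong[OF DERIV_add[OF DERIV_cmult[OF 1] DERIV_cmult[OF DERIV_power[OF 2]]]])
       (use pos in \<open>simp add: index_d2_def index_d3_def index_d4_def field_simps eval_nat_numeral\<close>)
qed

text \<open>By scale invariance every nonzero multiple of a maximizer on the sphere maximizes over
  all nonzero vectors. The derivative along the straight line \<open>v + t *\<^sub>R e\<close>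
  therefore vanishes, without a Lagrange multiplier.\<close>

lemma eta_index_first_order_condition:
  fixes x :: "nat \<Rightarrow> real^'n"
  assumes max: "is_arg_max (eta_index w1 w2 x n) (\<lambda>v. v \<in> sphere 0 1) u"
    and c: "c \<noteq> 0" and v: "v = c *\<^sub>R u" and pos: "0 < proj_moment 2 x n v"
  shows "avg x n (\<lambda>y.
      (2 * index_d2 w1 w2 (proj_moment 2 x n v) (proj_moment 3 x n v) (proj_moment 4 x n v) * (v \<bullet> (y - sample_mean x n))
      + 3 * index_d3 w1 (proj_moment 2 x n v) (proj_moment 3 x n v) * (v \<bullet> (y - sample_mean x n))\<^sup>2
      + 4 * index_d4 w2 (proj_moment 2 x n v) (proj_moment 4 x n v) * (v \<bullet> (y - sample_mean x n)) ^ 3)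
      * (e \<bullet> (y - sample_mean x n))) = 0" (is "avg x n ?F = 0")
proof -
  define A where "A i = v \<bullet> (x i - sample_mean x n)" for i
  define E where "E i = e \<bullet> (x i - sample_mean x n)" for i
  define p where "p k t = (1 / real n) * (\<Sum>i<n. (A i + t * E i) ^ k)" for k t
  have p: "proj_moment k x n (v + t *\<^sub>R e) = p k t" for k t
    by (simp add: proj_moment_def p_def A_def E_def inner_add_left)
  have p0: "proj_moment k x n v = p k 0" for k using p[of k 0] by simp
  have dp: "(p k has_real_derivative real k * ((1 / real n) * (\<Sum>i<n. A i ^ (k - 1) * E i))) (at 0)" for k
    unfolding p_def[abs_def]
    by (rule derivative_eq_intros refl | simp)+ (simp add: sum_distrib_left mult_ac)
  have pos0: "p 2 0 > 0" using pos p0 by simp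
  have u1: "norm u = 1" using max by (simp add: is_arg_max_def)
  have v0: "v \<noteq> 0" using u1 c v by auto
  define f where "f t = rational_index w1 w2 (p 2 t) (p 3 t) (p 4 t)" for t
  have f: "f t = eta_index w1 w2 x n (v + t *\<^sub>R e)" for t
    by (simp add: f_def eta_index_eq_rational_index p)
  \<comment> \<open>The bound on \<open>t\<close> keeps the line away from the origin; the 1 in the
    divisor covers \<open>e = 0\<close>.\<close>
  have le: "f t \<le> f 0" if "\<bar>t\<bar> < norm v / (1 + norm e)" for t
  proof -
    let ?w = "v + t *\<^sub>R e"
    have "?w \<noteq> 0"
    proof
      assume "?w = 0"
      then have "norm v = \<bar>t\<bar> * norm e" by (metis add_eq_0_iff norm_minus_cancel norm_scaleR)
      also have "\<dots> \<le> \<bar>t\<bar> * (1 + norm e)" by (intro mult_left_mono) auto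
      also have "\<dots> < norm v" using that by (simp add: pos_less_divide_eq add_pos_nonneg)
      finally show False by simp
    qed
    then have "(1 / norm ?w) *\<^sub>R ?w \<in> sphere 0 1" by simp
    then have "eta_index w1 w2 x n ((1 / norm ?w) *\<^sub>R ?w) \<le> eta_index w1 w2 x n u"
      using max unfolding is_arg_max_def by (meson not_less)
    then have "eta_index w1 w2 x n ?w \<le> eta_index w1 w2 x n v"
      using \<open>?w \<noteq> 0\<close> c unfolding v by (subst (asm) eta_index_scaleR) (auto simp: eta_index_scaleR)
    then show ?thesis using f[of t] f[of 0] by simp
  qed
  have "(f has_real_derivative
      index_d2 w1 w2 (p 2 0) (p 3 0) (p 4 0) * (2 * ((1 / real n) * (\<Sum>i<n. A i * E i)))
      + index_d3 w1 (p 2 0) (p 3 0) * (3 * ((1 / real n) * (\<Sum>i<n. (A i)\<^sup>2 * E i)))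
      + index_d4 w2 (p 2 0) (p 4 0) * (4 * ((1 / real n) * (\<Sum>i<n. A i ^ 3 * E i)))) (at 0)" (is "(f has_real_derivative ?D) _")
  proof -
    define q2 q3 q4 where "q2 = 2 * ((1 / real n) * (\<Sum>i<n. A i * E i))"
      and "q3 = 3 * ((1 / real n) * (\<Sum>i<n. (A i)\<^sup>2 * E i))" and "q4 = 4 * ((1 / real n) * (\<Sum>i<n. A i ^ 3 * E i))"
    have d: "(p 2 has_real_derivative q2) (at 0)" "(p 3 has_real_derivative q3) (at 0)" "(p 4 has_real_derivative q4) (at 0)"
      using dp[of 2] dp[of 3] dp[of 4] by (simp_all add: q2_def q3_def q4_def)
    show ?thesis
      unfolding f_def[abs_def] q2_def[symmetric] q3_def[symmetric] q4_def[symmetric]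
      by (rule rational_index_has_derivative[OF d pos0])
  qed
  moreover have "0 < norm v / (1 + norm e)" using v0 by (simp add: add_pos_nonneg)
  ultimately have "?D = 0"
    by (rule DERIV_local_max) (use le in auto)
  moreover have "avg x n ?F = ?D"
    unfolding p0 avg_def A_def[symmetric] E_def[symmetric]
    by (simp add: distrib_right distrib_left sum.distrib sum_distrib_left sum_distrib_right mult_ac)
  ultimately show ?thesis by simp
qed

locale mixture_path = mixture_index \<alpha>1 \<alpha>2 \<mu>1 \<mu>2 \<Sigma> w1 w2
  for \<alpha>1 \<alpha>2 :: real and \<mu>1 \<mu>2 :: "real^'p" and \<Sigma> :: "real^'p^'p" and w1 w2 :: real +
  fixes x :: "nat \<Rightarrow> real^'p"
  assumes conv: "moments_converge x P"
begin

lemma sample_mean_tendsto_mean: "sample_mean x \<longlonglongrightarrow> mean"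
proof -
  interpret P: prob_space P using all_moments_P by (simp add: all_moments_def)
  have "(\<integral>y. y $ i \<partial>P) = mean $ i" for i
  proof -
    have int: "integrable P (\<lambda>y. y $ i)"
      by (rule all_moments_integrable[OF all_moments_P poly_growth_component])
    have "(\<integral>y. y $ i - mean $ i \<partial>P) = 0"
      using mom_values(1)[of "axis i 1"] by (simp add: mom_def inner_axis')
    then show ?thesis using int by (simp add: P.prob_space)
  qed
  then have "(\<chi> i. \<integral>y. y $ i \<partial>P) = mean" by (simp add: vec_eq_iff)
  with sample_mean_tendsto[OF all_moments_P conv] show ?thesis by simp
qed

lemma avg_multiplier_centred:
  assumes "a \<longlonglongrightarrow> a'"
  shows "avg_multiplier x P (\<lambda>n y. a n \<bullet> (y - sample_mean x n)) (\<lambda>y. a' \<bullet> (y - mean))"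
  unfolding inner_diff_right
  by (intro avg_multiplier_intros[OF all_moments_P] tendsto_inner assms sample_mean_tendsto_mean)

lemma proj_moment_tendsto:
  assumes "a \<longlonglongrightarrow> a'"
  shows "(\<lambda>n. proj_moment k x n (a n)) \<longlonglongrightarrow> mom k a'"
  unfolding proj_moment_eq_avg mom_def
  by (intro avg_multiplier_tendsto[OF all_moments_P conv] avg_multiplier_power[OF all_moments_P] avg_multiplier_centred assms)

lemma eta_index_tendsto:
  assumes "a \<longlonglongrightarrow> a'" "a' \<noteq> 0"
  shows "(\<lambda>n. eta_index w1 w2 x n (a n)) \<longlonglongrightarrow> population_index a'"
  unfolding eta_index_eq_rational_index population_index_def rational_index_def
  using mom_2_pos[OF assms(2)]
  by (intro tendsto_intros proj_moment_tendsto assms(1)) auto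

text \<open>A subsequence that stays away from the target has a limit point \<open>l\<close> on the
  sphere, whose population index is at least that of \<theta>. So \<open>l\<close> is a multiple of
  \<theta>, and the sign convention makes the multiple positive, a contradiction.\<close>

lemma maximizers_tendsto:
  assumes v: "\<And>n. v n \<in> sphere 0 1" "\<And>n. 0 \<le> v n \<bullet> \<theta>"
    and max: "\<forall>\<^sub>F n in sequentially. is_arg_max (eta_index w1 w2 x n) (\<lambda>u. u \<in> sphere 0 1) (v n)"
  shows "v \<longlonglongrightarrow> \<theta> /\<^sub>R norm \<theta>"
proof (rule ccontr)
  let ?t = "\<theta> /\<^sub>R norm \<theta>"
  assume "\<not> v \<longlonglongrightarrow> ?t"
  then obtain \<epsilon> where \<epsilon>: "\<epsilon> > 0" "\<exists>\<^sub>F n in sequentially. \<epsilon> \<le> dist (v n) ?t"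
    unfolding tendsto_iff by (auto simp: not_eventually not_less)
  then have "infinite {n. \<epsilon> \<le> dist (v n) ?t}"
    by (simp add: frequently_cofinite cofinite_eq_sequentially[symmetric])
  then obtain r :: "nat \<Rightarrow> nat" where r: "strict_mono r" "\<And>n. \<epsilon> \<le> dist (v (r n)) ?t"
    using infinite_enumerate by blast
  have "\<And>n. (v \<circ> r) n \<in> sphere 0 1" using v(1) by simp
  then obtain l s where l: "l \<in> sphere 0 1" "strict_mono (s :: nat \<Rightarrow> nat)" "((v \<circ> r) \<circ> s) \<longlonglongrightarrow> l"
    using compact_sphere[of 0 1] unfolding compact_def by (metis (no_types))
  define q where "q = r \<circ> s"
  have q: "strict_mono q" unfolding q_def by (intro strict_mono_o r l)
  have vq: "(\<lambda>n. v (q n)) \<longlonglongrightarrow> l" using l(3) by (simp add: q_def comp_def)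
  \<comment> \<open>\<open>eta_index_tendsto\<close> needs a direction for every sample size, so the
    gaps of the subsequence are filled with its limit.\<close>
  define a where "a n = (if n \<in> range q then v n else l)" for n
  have "a \<longlonglongrightarrow> l"
  proof (rule metric_LIMSEQ_I)
    fix e :: real assume "0 < e"
    from metric_LIMSEQ_D[OF vq this] obtain K where K: "\<And>k. k \<ge> K \<Longrightarrow> dist (v (q k)) l < e" by blast
    have "dist (a n) l < e" if n: "n \<ge> q K" for n
    proof (cases "n \<in> range q")
      case True
      then obtain k where k: "n = q k" by blast
      then have "k \<ge> K" using n strict_mono_less_eq[OF q] by simp
      then show ?thesis using K k True by (simp add: a_def)
    qed (use \<open>0 < e\<close> in \<open>simp add: a_def\<close>)
    then show "\<exists>N. \<forall>n\<ge>N. dist (a n) l < e" by blast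
  qed
  moreover have l0: "l \<noteq> 0" using l(1) by auto
  ultimately have "(\<lambda>n. eta_index w1 w2 x n (a n)) \<longlonglongrightarrow> population_index l" by (rule eta_index_tendsto)
  from LIMSEQ_subseq_LIMSEQ[OF this q]
  have lim1: "(\<lambda>k. eta_index w1 w2 x (q k) (v (q k))) \<longlonglongrightarrow> population_index l"
    by (simp add: comp_def a_def)
  have t0: "?t \<noteq> 0" and t1: "?t \<in> sphere 0 1" using \<theta>_nonzero by auto
  from LIMSEQ_subseq_LIMSEQ[OF eta_index_tendsto[OF tendsto_const t0] q]
  have lim2: "(\<lambda>k. eta_index w1 w2 x (q k) ?t) \<longlonglongrightarrow> population_index ?t" by (simp add: comp_def)
  have "\<forall>\<^sub>F k in sequentially. eta_index w1 w2 x (q k) ?t \<le> eta_index w1 w2 x (q k) (v (q k))"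
    using eventually_subseq[OF q max]
    by eventually_elim (use t1 in \<open>auto simp: is_arg_max_def not_less\<close>)
  then have "population_index ?t \<le> population_index l"
    using tendsto_le[OF sequentially_bot lim1 lim2] by blast
  moreover have "population_index ?t = population_index \<theta>"
    using \<theta>_nonzero mom_2_pos[OF t0] mom_2_pos[OF \<theta>_nonzero]
    by (subst (1 2) population_index_eq)
       (auto simp: mom_values matrix_vector_mult_scaleR power_mult_distrib power2_eq_square field_simps)
  ultimately have "l = ((l \<bullet> \<delta>) / \<tau>) *\<^sub>R \<theta>" using population_index_maximizer[OF l0] by simp
  then obtain c where c: "l = c *\<^sub>R \<theta>" by blast
  have "(\<lambda>n. v (q n) \<bullet> \<theta>) \<longlonglongrightarrow> l \<bullet> \<theta>" by (intro tendsto_intros vq)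
  then have "0 \<le> l \<bullet> \<theta>" by (rule LIMSEQ_le_const) (use v(2) in auto)
  then have "0 \<le> c * (\<theta> \<bullet> \<theta>)" using c by simp
  moreover have "0 < \<theta> \<bullet> \<theta>" using \<theta>_nonzero by simp
  ultimately have "c \<ge> 0" by (metis not_le mult_neg_pos)
  moreover have "norm l = 1" using l(1) by simp
  ultimately have "c = 1 / norm \<theta>" using c \<theta>_nonzero by (simp add: field_simps)
  then have lt: "l = ?t" using c by (simp add: divide_inverse)
  from vq have "(\<lambda>n. dist (v (q n)) ?t) \<longlonglongrightarrow> 0"
    unfolding lt by (rule tendsto_dist_iff[THEN iffD1])
  moreover have "\<epsilon> \<le> dist (v (q n)) ?t" for n using r(2) by (simp add: q_def)
  ultimately show False using LIMSEQ_le_const[of "\<lambda>n. dist (v (q n)) ?t" 0 \<epsilon>] \<epsilon>(1) by auto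
qed

end

section \<open>Linearization of the first-order condition\<close>

lemma avg_sum: "avg x n (\<lambda>y. \<Sum>i\<in>I. f i y) = (\<Sum>i\<in>I. avg x n (f i))"
  unfolding avg_def by (subst sum.swap) (simp add: sum_distrib_left)

lemma avg_inner_sample_mean:
  "0 < n \<Longrightarrow> avg x n (\<lambda>y. e \<bullet> (y - m)) = e \<bullet> (sample_mean x n - m)"
  by (simp add: avg_def sample_mean_def inner_diff_right sum_subtractf inner_sum_right right_diff_distrib)

context normal_mixture
begin

text \<open>The representer of \<open>b\<close> for the form \<Sigma> on the vectors orthogonal to
  \<delta>: the representer \<open>matrix_inv \<Sigma> *v b\<close> on the whole space minus its
  \<Sigma>-projection onto \<theta>. Being \<Sigma>-orthogonal to \<theta> is the same as being
  orthogonal to \<delta>.\<close>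

definition dual where "dual b = matrix_inv \<Sigma> *v b - ((\<theta> \<bullet> b) / \<tau>) *\<^sub>R \<theta>"

lemma \<Sigma>_dual: "\<Sigma> *v dual b = b - ((\<theta> \<bullet> b) / \<tau>) *\<^sub>R \<delta>"
  by (simp add: dual_def matrix_vector_mult_diff_distrib matrix_vector_mult_scaleR \<Sigma>_\<theta> \<Sigma>_inv_apply)

lemma dual_orthogonal: "dual b \<bullet> \<delta> = 0"
proof -
  have "dual b \<bullet> \<delta> = \<theta> \<bullet> (\<Sigma> *v dual b)" unfolding inner_\<delta> by (rule \<Sigma>_sym)
  also have "\<dots> = 0" unfolding \<Sigma>_dual using \<tau>_pos by (simp add: inner_diff_right \<tau>_eq)
  finally show ?thesis .
qed

lemma dual_inner_\<Sigma>: "f \<bullet> \<delta> = 0 \<Longrightarrow> dual b \<bullet> (\<Sigma> *v f) = b \<bullet> f"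
  by (subst \<Sigma>_sym) (simp add: \<Sigma>_dual inner_diff_right inner_commute)

lemma dual_sum: "dual b = (\<Sum>i\<in>UNIV. b $ i *\<^sub>R dual (axis i 1))"
proof -
  have lin: "linear dual"
    unfolding dual_def[abs_def] using \<tau>_pos
    by (intro linearI)
       (simp_all add: matrix_vector_right_distrib matrix_vector_mult_scaleR inner_add_right add_divide_distrib algebra_simps)
  have "b = (\<Sum>i\<in>UNIV. b $ i *\<^sub>R axis i 1)"
    using basis_expansion[of b] by (simp add: scalar_mult_eq_scaleR)
  then have "dual b = dual (\<Sum>i\<in>UNIV. b $ i *\<^sub>R axis i 1)" by simp
  also have "\<dots> = (\<Sum>i\<in>UNIV. b $ i *\<^sub>R dual (axis i 1))"
    by (simp add: linear_sum[OF lin] linear_cmul[OF lin])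
  finally show ?thesis .
qed

text \<open>The axes projected along \<theta> onto the complement of \<delta>. This spanning family
  is redundant, but the coefficients of \<open>h\<close> in it are simply the coordinates of
  \<open>h\<close>.\<close>

definition frame where "frame j = axis j 1 - (\<delta> $ j / \<tau>) *\<^sub>R \<theta>"

lemma frame_orthogonal: "frame j \<bullet> \<delta> = 0"
  using \<tau>_pos by (simp add: frame_def inner_diff_left \<tau>_eq inner_axis')

lemma frame_expansion:
  assumes "h \<bullet> \<delta> = 0"
  shows "h = (\<Sum>j\<in>UNIV. h $ j *\<^sub>R frame j)"
proof -
  have "(\<Sum>j\<in>UNIV. h $ j *\<^sub>R frame j) = (\<Sum>j\<in>UNIV. h $ j *\<^sub>R axis j 1) - ((\<Sum>j\<in>UNIV. h $ j * \<delta> $ j) / \<tau>) *\<^sub>R \<theta>"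
    by (simp add: frame_def scaleR_diff_right sum_subtractf scaleR_sum_left[symmetric] sum_divide_distrib)
  also have "(\<Sum>j\<in>UNIV. h $ j * \<delta> $ j) = 0" using assms by (simp add: inner_vec_def)
  also have "(\<Sum>j\<in>UNIV. h $ j *\<^sub>R axis j 1) = h"
    using basis_expansion[of h] by (simp add: scalar_mult_eq_scaleR)
  finally show ?thesis by simp
qed

end

locale maximizer_path = mixture_path \<alpha>1 \<alpha>2 \<mu>1 \<mu>2 \<Sigma> w1 w2 x
  for \<alpha>1 \<alpha>2 :: real and \<mu>1 \<mu>2 :: "real^'p" and \<Sigma> :: "real^'p^'p" and w1 w2 :: real and x :: "nat \<Rightarrow> real^'p" +
  fixes v :: "nat \<Rightarrow> real^'p"
  assumes v: "\<And>n. v n \<in> sphere 0 1" "\<And>n. 0 \<le> v n \<bullet> \<theta>"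
    and max: "\<forall>\<^sub>F n in sequentially. is_arg_max (eta_index w1 w2 x n) (\<lambda>u. u \<in> sphere 0 1) (v n)"
begin

text \<open>The scale-invariant maximizer is normalized by \<open>\<theta>n n \<bullet> \<delta> = \<theta> \<bullet> \<delta>\<close>.\<close>
definition \<theta>n where "\<theta>n n = (\<tau> / (v n \<bullet> \<delta>)) *\<^sub>R v n"
definition h where "h n = \<theta>n n - \<theta>"

definition D2 where "D2 n = index_d2 w1 w2 (proj_moment 2 x n (\<theta>n n)) (proj_moment 3 x n (\<theta>n n)) (proj_moment 4 x n (\<theta>n n))"
definition D3 where "D3 n = index_d3 w1 (proj_moment 2 x n (\<theta>n n)) (proj_moment 3 x n (\<theta>n n))"
definition D4 where "D4 n = index_d4 w2 (proj_moment 2 x n (\<theta>n n)) (proj_moment 4 x n (\<theta>n n))"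

definition cen where "cen n y = y - sample_mean x n"

text \<open>The first-order condition with \<theta> in the projections, but with derivative weights
  still taken at the maximizer.\<close>

definition Sn where
  "Sn n e = avg x n (\<lambda>y. (2 * D2 n * (\<theta> \<bullet> cen n y) + 3 * D3 n * (\<theta> \<bullet> cen n y)\<^sup>2 + 4 * D4 n * (\<theta> \<bullet> cen n y) ^ 3) * (e \<bullet> cen n y))"

text \<open>The exact difference quotients of the powers 1, 2, 3 between
  \<open>\<theta>n n \<bullet> cen n y\<close> and \<open>\<theta> \<bullet> cen n y\<close>, from
  the factorizations of a^2 - b^2 and a^3 - b^3; the common factor a - b is
  \<open>h n \<bullet> cen n y\<close>.\<close>

definition Bn where
  "Bn n e f = avg x n (\<lambda>y. (2 * D2 n + 3 * D3 n * (\<theta>n n \<bullet> cen n y + \<theta> \<bullet> cen n y)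
      + 4 * D4 n * ((\<theta>n n \<bullet> cen n y)\<^sup>2 + (\<theta>n n \<bullet> cen n y) * (\<theta> \<bullet> cen n y) + (\<theta> \<bullet> cen n y)\<^sup>2)) * ((f \<bullet> cen n y) * (e \<bullet> cen n y)))"

text \<open>Centred at the population mean, hence a genuine average of independent
  variables.\<close>

definition U where "U j n e = avg x n (\<lambda>y. (\<theta> \<bullet> (y - mean)) ^ j * (e \<bullet> (y - mean)))"

definition shift where "shift n = \<theta> \<bullet> (sample_mean x n - mean)"

definition qn where
  "qn n = avg x n (\<lambda>y. 2 * D2 n * (\<theta> \<bullet> cen n y) + 3 * D3 n * (\<theta> \<bullet> cen n y)\<^sup>2 + 4 * D4 n * (\<theta> \<bullet> cen n y) ^ 3)"

text \<open>Coefficients obtained by expanding the powers of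
  \<open>\<theta> \<bullet> cen n y\<close>, the population-centred projection minus
  \<open>shift n\<close>. The term \<open>- qn n\<close> comes from the sample centring of the other
  factor.\<close>

definition sample_score :: "nat \<Rightarrow> real poly" where
  "sample_score n = [:- 2 * D2 n * shift n + 3 * D3 n * (shift n)\<^sup>2 - 4 * D4 n * shift n ^ 3 - qn n,
     2 * D2 n - 6 * D3 n * shift n + 12 * D4 n * (shift n)\<^sup>2, 3 * D3 n - 12 * D4 n * shift n, 4 * D4 n:]"

lemma v_tendsto: "v \<longlonglongrightarrow> \<theta> /\<^sub>R norm \<theta>"
  by (rule maximizers_tendsto[OF v max])

lemma v\<delta>_tendsto: "(\<lambda>n. v n \<bullet> \<delta>) \<longlonglongrightarrow> \<tau> / norm \<theta>"
proof -
  have "(\<lambda>n. v n \<bullet> \<delta>) \<longlonglongrightarrow> (\<theta> /\<^sub>R norm \<theta>) \<bullet> \<delta>" by (intro tendsto_intros v_tendsto)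
  then show ?thesis by (simp add: \<tau>_eq divide_inverse mult.commute)
qed

lemma v\<delta>_pos: "\<forall>\<^sub>F n in sequentially. 0 < v n \<bullet> \<delta>"
  by (rule order_tendstoD(1)[OF v\<delta>_tendsto]) (use \<tau>_pos \<theta>_nonzero in simp)

lemma \<theta>n_tendsto: "\<theta>n \<longlonglongrightarrow> \<theta>"
proof -
  have "\<theta>n \<longlonglongrightarrow> (\<tau> / (\<tau> / norm \<theta>)) *\<^sub>R (\<theta> /\<^sub>R norm \<theta>)"
    unfolding \<theta>n_def[abs_def] using \<tau>_pos \<theta>_nonzero by (intro tendsto_intros v\<delta>_tendsto v_tendsto) auto
  then show ?thesis using \<tau>_pos \<theta>_nonzero by simp
qed

lemma h_orthogonal: "\<forall>\<^sub>F n in sequentially. h n \<bullet> \<delta> = 0"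
  using v\<delta>_pos by eventually_elim (simp add: h_def \<theta>n_def inner_diff_left \<tau>_eq)

lemma v_eq: "\<forall>\<^sub>F n in sequentially. v n = \<theta>n n /\<^sub>R norm (\<theta>n n) \<and> \<theta>n n \<noteq> 0"
  using v\<delta>_pos
proof eventually_elim
  case (elim n)
  have "norm (v n) = 1" using v(1) by simp
  then show ?case using elim \<tau>_pos by (auto simp: \<theta>n_def field_simps)
qed

lemma D_tendsto: "D2 \<longlonglongrightarrow> d2" "D3 \<longlonglongrightarrow> d3" "D4 \<longlonglongrightarrow> d4"
  unfolding D2_def[abs_def] D3_def[abs_def] D4_def[abs_def] d2_def d3_def d4_def index_d2_def index_d3_def index_d4_def
  using mom_2_pos[OF \<theta>_nonzero] by (intro tendsto_intros proj_moment_tendsto \<theta>n_tendsto; simp)+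

lemma cen_multiplier: "a \<longlonglongrightarrow> a' \<Longrightarrow> avg_multiplier x P (\<lambda>n y. a n \<bullet> cen n y) (\<lambda>y. a' \<bullet> (y - mean))"
  unfolding cen_def by (rule avg_multiplier_centred)

lemma first_order_condition: "\<forall>\<^sub>F n in sequentially. Sn n e + Bn n e (h n) = 0"
proof -
  have "\<forall>\<^sub>F n in sequentially. 0 < proj_moment 2 x n (\<theta>n n)"
    using proj_moment_tendsto[OF \<theta>n_tendsto, of 2] mom_2_pos[OF \<theta>_nonzero] by (intro order_tendstoD)
  with v\<delta>_pos max show ?thesis
  proof eventually_elim
    case (elim n)
    have "avg x n (\<lambda>y. (2 * D2 n * (\<theta>n n \<bullet> cen n y) + 3 * D3 n * (\<theta>n n \<bullet> cen n y)\<^sup>2 + 4 * D4 n * (\<theta>n n \<bullet> cen n y) ^ 3) * (e \<bullet> cen n y)) = 0"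
      unfolding D2_def D3_def D4_def cen_def
      by (rule eta_index_first_order_condition[OF elim(2) _ \<theta>n_def elim(3)]) (use elim(1) \<tau>_pos in auto)
    also have "avg x n (\<lambda>y. (2 * D2 n * (\<theta>n n \<bullet> cen n y) + 3 * D3 n * (\<theta>n n \<bullet> cen n y)\<^sup>2 + 4 * D4 n * (\<theta>n n \<bullet> cen n y) ^ 3) * (e \<bullet> cen n y)) = Sn n e + Bn n e (h n)"
      unfolding Sn_def Bn_def h_def avg_add[symmetric] inner_diff_left
      by (rule arg_cong[where f="avg x n"]) (simp add: fun_eq_iff algebra_simps power2_eq_square power3_eq_cube)
    finally show ?case .
  qed
qed

text \<open>The limiting weight is the derivative of \<open>score\<close> at Z. For directions
  orthogonal to \<delta> it separates from the two remaining projections by independence, leaving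
  its mean \<open>curv\<close>.\<close>

lemma Bn_tendsto:
  assumes e: "e \<bullet> \<delta> = 0" and f: "f \<bullet> \<delta> = 0"
  shows "(\<lambda>n. Bn n e f) \<longlonglongrightarrow> curv * (e \<bullet> (\<Sigma> *v f))"
proof -
  let ?Z = "\<lambda>y. \<theta> \<bullet> (y - mean)"
  let ?q = "[:2 * d2, 6 * d3, 12 * d4:]"
  interpret P: prob_space P using all_moments_P by (simp add: all_moments_def)
  have "(\<integral>y. poly ?q (?Z y) \<partial>P) = (\<integral>y. 2 * d2 * ?Z y ^ 0 + (6 * d3 * ?Z y ^ 1 + 12 * d4 * ?Z y ^ 2) \<partial>P)"
    by (rule Bochner_Integration.integral_cong) (simp_all add: algebra_simps power2_eq_square)
  also have "\<dots> = 2 * d2 * mom 0 \<theta> + (6 * d3 * mom 1 \<theta> + 12 * d4 * mom 2 \<theta>)"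
    by (simp only: Bochner_Integration.integral_add Bochner_Integration.integrable_add integrable_discriminant_power integral_mult_right_zero mom_def)
  also have "mom 0 \<theta> = 1" unfolding mom_def by (simp add: P.prob_space)
  finally have q: "(\<integral>y. poly ?q (?Z y) \<partial>P) = curv" unfolding mom_values(1) by (simp add: curv_def)
  have "(\<lambda>n. Bn n e f) \<longlonglongrightarrow> (\<integral>y. (2 * d2 + 3 * d3 * (?Z y + ?Z y) + 4 * d4 * ((?Z y)\<^sup>2 + ?Z y * ?Z y + (?Z y)\<^sup>2))
      * ((f \<bullet> (y - mean)) * (e \<bullet> (y - mean))) \<partial>P)"
    unfolding Bn_def
    by (intro avg_multiplier_tendsto[OF all_moments_P conv] avg_multiplier_mult[OF all_moments_P] avg_multiplier_add[OF all_moments_P]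
        avg_multiplier_const[OF all_moments_P] avg_multiplier_power[OF all_moments_P] cen_multiplier tendsto_intros D_tendsto \<theta>n_tendsto)
  also have "(\<integral>y. (2 * d2 + 3 * d3 * (?Z y + ?Z y) + 4 * d4 * ((?Z y)\<^sup>2 + ?Z y * ?Z y + (?Z y)\<^sup>2))
      * ((f \<bullet> (y - mean)) * (e \<bullet> (y - mean))) \<partial>P) = (\<integral>y. poly ?q (?Z y) * ((e \<bullet> (y - mean)) * (f \<bullet> (y - mean))) \<partial>P)"
    by (rule Bochner_Integration.integral_cong) (simp_all add: algebra_simps power2_eq_square)
  also have "\<dots> = curv * (e \<bullet> (\<Sigma> *v f))"
    unfolding integral_P_orthogonal(2)[OF e f] q by (rule mult.commute)
  finally show ?thesis .
qed

lemma qn_tendsto: "qn \<longlonglongrightarrow> 3 * d3 * mom 2 \<theta> + 4 * d4 * mom 3 \<theta>"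
proof -
  have "qn n = 2 * D2 n * proj_moment 1 x n \<theta> + 3 * D3 n * proj_moment 2 x n \<theta> + 4 * D4 n * proj_moment 3 x n \<theta>" for n
    unfolding qn_def by (simp add: avg_add avg_cmult proj_moment_eq_avg cen_def)
  then have "qn = (\<lambda>n. 2 * D2 n * proj_moment 1 x n \<theta> + 3 * D3 n * proj_moment 2 x n \<theta> + 4 * D4 n * proj_moment 3 x n \<theta>)" ..
  moreover have "(\<lambda>n. 2 * D2 n * proj_moment 1 x n \<theta> + 3 * D3 n * proj_moment 2 x n \<theta> + 4 * D4 n * proj_moment 3 x n \<theta>)
      \<longlonglongrightarrow> 2 * d2 * mom 1 \<theta> + 3 * d3 * mom 2 \<theta> + 4 * d4 * mom 3 \<theta>"
    by (intro tendsto_intros D_tendsto proj_moment_tendsto)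
  ultimately show ?thesis unfolding mom_values(1) by simp
qed

lemma shift_tendsto: "shift \<longlonglongrightarrow> 0"
  using tendsto_inner[OF tendsto_const[of \<theta>] tendsto_diff[OF sample_mean_tendsto_mean tendsto_const[of mean]]]
  by (simp add: shift_def[abs_def])

lemma sample_score_tendsto:
  assumes "j \<le> 3" shows "(\<lambda>n. coeff (sample_score n) j) \<longlonglongrightarrow> coeff score j"
proof -
  have "(\<lambda>n. - 2 * D2 n * shift n + 3 * D3 n * (shift n)\<^sup>2 - 4 * D4 n * shift n ^ 3 - qn n) \<longlonglongrightarrow>
      - 2 * d2 * 0 + 3 * d3 * 0\<^sup>2 - 4 * d4 * 0 ^ 3 - (3 * d3 * mom 2 \<theta> + 4 * d4 * mom 3 \<theta>)"
    "(\<lambda>n. 2 * D2 n - 6 * D3 n * shift n + 12 * D4 n * (shift n)\<^sup>2) \<longlonglongrightarrow> 2 * d2 - 6 * d3 * 0 + 12 * d4 * 0\<^sup>2"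
    "(\<lambda>n. 3 * D3 n - 12 * D4 n * shift n) \<longlonglongrightarrow> 3 * d3 - 12 * d4 * 0"
    "(\<lambda>n. 4 * D4 n) \<longlonglongrightarrow> 4 * d4"
    by (intro tendsto_intros D_tendsto shift_tendsto qn_tendsto)+
  moreover have "j = 0 \<or> j = 1 \<or> j = 2 \<or> j = 3" using assms by linarith
  ultimately show ?thesis
    by (auto simp: sample_score_def score_def numeral_2_eq_2 numeral_3_eq_3)
qed

lemma Sn_eq:
  assumes n: "0 < n"
  shows "Sn n e = (\<Sum>j\<le>3. coeff (sample_score n) j * U j n e)"
proof -
  let ?Z = "\<lambda>y. \<theta> \<bullet> (y - mean)" and ?W = "\<lambda>y. e \<bullet> (y - mean)"
  let ?q = "\<lambda>y. 2 * D2 n * (\<theta> \<bullet> cen n y) + 3 * D3 n * (\<theta> \<bullet> cen n y)\<^sup>2 + 4 * D4 n * (\<theta> \<bullet> cen n y) ^ 3"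
  \<comment> \<open>Here \<open>0 < n\<close> enters: the average of a constant is that constant
    only for a nonempty sample.\<close>
  have ec: "e \<bullet> cen n y = ?W y - U 0 n e" for y
    using avg_inner_sample_mean[OF n, of x e mean] by (simp add: U_def cen_def inner_diff_right)
  have tc: "\<theta> \<bullet> cen n y = ?Z y - shift n" for y
    by (simp add: shift_def cen_def inner_diff_right)
  have "Sn n e = avg x n (\<lambda>y. ?q y * ?W y - U 0 n e * ?q y)"
    unfolding Sn_def ec by (rule arg_cong[where f="avg x n"]) (simp add: fun_eq_iff algebra_simps)
  also have "\<dots> = avg x n (\<lambda>y. ?q y * ?W y) - U 0 n e * qn n"
    unfolding avg_diff avg_cmult qn_def ..
  also have "avg x n (\<lambda>y. ?q y * ?W y) = avg x n (\<lambda>y. (coeff (sample_score n) 0 + qn n) * (?Z y ^ 0 * ?W y)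
      + (coeff (sample_score n) 1 * (?Z y ^ 1 * ?W y) + (coeff (sample_score n) 2 * (?Z y ^ 2 * ?W y) + coeff (sample_score n) 3 * (?Z y ^ 3 * ?W y))))"
    unfolding tc
    by (rule arg_cong[where f="avg x n"])
       (simp add: fun_eq_iff sample_score_def numeral_2_eq_2 numeral_3_eq_3 algebra_simps)
  also have "\<dots> = (coeff (sample_score n) 0 + qn n) * U 0 n e + (coeff (sample_score n) 1 * U 1 n e
      + (coeff (sample_score n) 2 * U 2 n e + coeff (sample_score n) 3 * U 3 n e))"
    unfolding avg_add avg_cmult U_def ..
  finally show ?thesis by (simp add: numeral_2_eq_2 numeral_3_eq_3 algebra_simps)
qed

definition err where "err n b j = Bn n (dual b) (frame j) - curv * (dual b \<bullet> (\<Sigma> *v frame j))"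

lemma err_tendsto: "(\<lambda>n. err n b j) \<longlonglongrightarrow> 0"
  using tendsto_diff[OF Bn_tendsto[OF dual_orthogonal[of b] frame_orthogonal[of j]]
      tendsto_const[of "curv * (dual b \<bullet> (\<Sigma> *v frame j))"]]
  unfolding err_def by simp

text \<open>Bilinearity and the frame turn the error of \<open>Bn\<close> at the varying argument
  \<open>h n\<close> into a finite sum of coordinates of \<open>h n\<close> times errors at fixed
  arguments.\<close>

lemma linearized_condition:
  "\<forall>\<^sub>F n in sequentially. curv * (b \<bullet> h n) = - (\<Sum>j\<le>3. coeff (sample_score n) j * U j n (dual b)) - (\<Sum>j\<in>UNIV. h n $ j * err n b j)"
  using first_order_condition[of "dual b"] h_orthogonal eventually_gt_at_top[of "0::nat"]
proof eventually_elim
  case (elim n)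
  let ?h = "h n" and ?e = "dual b"
  have lin: "Bn n ?e (\<Sum>j\<in>UNIV. ?h $ j *\<^sub>R frame j) = (\<Sum>j\<in>UNIV. ?h $ j * Bn n ?e (frame j))"
    unfolding Bn_def avg_cmult[symmetric] avg_sum[symmetric]
    by (rule arg_cong[where f="avg x n"]) (simp add: fun_eq_iff inner_sum_left sum_distrib_left sum_distrib_right mult_ac)
  have "curv * (b \<bullet> ?h) = curv * (?e \<bullet> (\<Sigma> *v ?h))" by (simp add: dual_inner_\<Sigma>[OF elim(2)])
  also have "?e \<bullet> (\<Sigma> *v ?h) = (\<Sum>j\<in>UNIV. ?h $ j * (?e \<bullet> (\<Sigma> *v frame j)))"
  proof -
    have "?e \<bullet> (\<Sigma> *v ?h) = ?h \<bullet> (\<Sigma> *v ?e)" by (rule \<Sigma>_sym)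
    also have "\<dots> = (\<Sum>j\<in>UNIV. ?h $ j *\<^sub>R frame j) \<bullet> (\<Sigma> *v ?e)"
      using frame_expansion[OF elim(2)] by simp
    also have "\<dots> = (\<Sum>j\<in>UNIV. ?h $ j * (?e \<bullet> (\<Sigma> *v frame j)))"
      by (simp add: inner_sum_left \<Sigma>_sym[of ?e])
    finally show ?thesis .
  qed
  also have "curv * \<dots> = (\<Sum>j\<in>UNIV. ?h $ j * Bn n ?e (frame j)) - (\<Sum>j\<in>UNIV. ?h $ j * err n b j)"
    by (simp add: err_def sum_distrib_left sum_subtractf[symmetric] algebra_simps)
  also have "(\<Sum>j\<in>UNIV. ?h $ j * Bn n ?e (frame j)) = Bn n ?e ?h"
    using lin frame_expansion[OF elim(2)] by simp
  also have "Bn n ?e ?h = - (\<Sum>j\<le>3. coeff (sample_score n) j * U j n ?e)"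
    using elim(1) Sn_eq[OF elim(3), of ?e] by simp
  finally show ?case .
qed

end

text \<open>An exact form of the delta method: the difference of the norms is (a - c) \<bullet> (a +
  c) divided by their sum, so \<open>a - c\<close> factors out and the other factor converges to the
  gradient.\<close>

lemma unit_vector_difference:
  fixes a c b :: "'b::real_inner"
  assumes "a \<noteq> 0" "c \<noteq> 0"
  shows "b \<bullet> (a /\<^sub>R norm a - c /\<^sub>R norm c) =
    (a - c) \<bullet> ((1 / norm a) *\<^sub>R b - ((c \<bullet> b) / (norm a * norm c * (norm a + norm c))) *\<^sub>R (a + c))"
proof -
  have na: "norm a > 0" "norm c > 0" using assms by auto
  have sq: "(a - c) \<bullet> (a + c) = (norm a - norm c) * (norm a + norm c)"
    by (simp add: inner_diff_left inner_add_right inner_commute power2_norm_eq_inner[symmetric] power2_eq_square algebra_simps)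
  have "((c \<bullet> b) / (norm a * norm c * (norm a + norm c))) * ((a - c) \<bullet> (a + c)) = (c \<bullet> b) / (norm a * norm c) * (norm a - norm c)"
  proof -
    have "x / (y * s) * (d * s) = x / y * d" if "s \<noteq> 0" for x y s d :: real using that by simp
    moreover have "norm a + norm c \<noteq> 0" using na by linarith
    ultimately show ?thesis unfolding sq by blast
  qed
  also have "\<dots> = (c \<bullet> b) / norm c - (c \<bullet> b) / norm a" using na by (simp add: field_simps)
  finally have e: "((c \<bullet> b) / (norm a * norm c * (norm a + norm c))) * ((a - c) \<bullet> (a + c)) = (c \<bullet> b) / norm c - (c \<bullet> b) / norm a" .
  have "(a - c) \<bullet> ((1 / norm a) *\<^sub>R b - ((c \<bullet> b) / (norm a * norm c * (norm a + norm c))) *\<^sub>R (a + c)) =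
      ((a - c) \<bullet> b) / norm a - ((c \<bullet> b) / (norm a * norm c * (norm a + norm c))) * ((a - c) \<bullet> (a + c))"
    by (simp only: inner_diff_right inner_scaleR_right) simp
  also have "\<dots> = b \<bullet> (a /\<^sub>R norm a - c /\<^sub>R norm c)"
    unfolding e by (simp add: inner_diff_left inner_diff_right inner_commute diff_divide_distrib divide_inverse algebra_simps)
  finally show ?thesis ..
qed

section \<open>Rate and linear expansion of the maximizer\<close>

context mixture_index
begin

text \<open>The scale against which remainders are measured. It depends on the sample alone and not
  on the maximizer, so its expectation can be bounded by second moments.\<close>

definition score_size :: "(nat \<Rightarrow> real^'p) \<Rightarrow> nat \<Rightarrow> real" where
  "score_size x n = sqrt (real n) * (\<Sum>i\<in>UNIV. \<Sum>j\<le>3.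
    \<bar>avg x n (\<lambda>y. (\<theta> \<bullet> (y - mean)) ^ j * (dual (axis i 1) \<bullet> (y - mean)))\<bar>)"

text \<open>The gradient at \<theta> of the map sending a vector v to (b \<bullet> v) / norm
  v.\<close>

definition unit_gradient where
  "unit_gradient b = (1 / norm \<theta>) *\<^sub>R (b - ((\<theta> \<bullet> b) / (norm \<theta>)\<^sup>2) *\<^sub>R \<theta>)"

definition influence where
  "influence b y = - (1 / curv) * (poly score (\<theta> \<bullet> (y - mean)) * (dual (unit_gradient b) \<bullet> (y - mean)))"

end

context maximizer_path
begin

definition T where "T n = (\<Sum>i\<in>UNIV. \<Sum>j\<le>3. \<bar>U j n (dual (axis i 1))\<bar>)"
definition H where "H n = (\<Sum>i\<in>UNIV. \<bar>h n $ i\<bar>)"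

lemma score_size_eq: "score_size x n = sqrt (real n) * T n"
  by (simp add: score_size_def T_def U_def)

lemma T_nonneg: "0 \<le> T n" by (simp add: T_def sum_nonneg)

lemma H_nonneg: "0 \<le> H n" by (simp add: H_def sum_nonneg)

lemma U_axis_le: "j \<le> 3 \<Longrightarrow> \<bar>U j n (dual (axis i 1))\<bar> \<le> T n"
proof -
  assume j: "j \<le> 3"
  have "\<bar>U j n (dual (axis i 1))\<bar> \<le> (\<Sum>j\<le>3. \<bar>U j n (dual (axis i 1))\<bar>)"
    using j by (intro member_le_sum) auto
  also have "\<dots> \<le> T n"
    unfolding T_def by (intro member_le_sum) (auto intro: sum_nonneg)
  finally show ?thesis .
qed

lemma U_dual_le:
  assumes j: "j \<le> 3"
  shows "\<bar>U j n (dual b)\<bar> \<le> (\<Sum>i\<in>UNIV. \<bar>b $ i\<bar>) * T n"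
proof -
  have "U j n (dual b) = (\<Sum>i\<in>UNIV. b $ i * U j n (dual (axis i 1)))"
    unfolding U_def avg_cmult[symmetric] avg_sum[symmetric]
    by (subst dual_sum) (simp add: inner_sum_left sum_distrib_left mult_ac)
  also have "\<bar>\<dots>\<bar> \<le> (\<Sum>i\<in>UNIV. \<bar>b $ i * U j n (dual (axis i 1))\<bar>)" by (rule sum_abs)
  also have "\<dots> \<le> (\<Sum>i\<in>UNIV. \<bar>b $ i\<bar> * T n)"
    unfolding abs_mult by (intro sum_mono mult_left_mono U_axis_le j) auto
  finally show ?thesis by (simp add: sum_distrib_right)
qed

text \<open>The linearized condition bounds \<open>- curv * H n\<close> by a multiple of
  \<open>T n\<close> plus \<open>H n\<close> times a vanishing error. Once that error is below
  \<open>- curv / 2\<close>, half of the left side remains after absorption.\<close>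

lemma H_rate: "\<exists>L\<ge>0. \<forall>\<^sub>F n in sequentially. H n \<le> L * T n"
proof -
  define \<epsilon> where "\<epsilon> n = (\<Sum>i\<in>UNIV. \<Sum>j\<in>UNIV. \<bar>err n (axis i 1) j\<bar>)" for n
  define S where "S n = (\<Sum>j\<le>3. \<bar>coeff (sample_score n) j\<bar>)" for n
  define s where "s = (\<Sum>j\<le>3. \<bar>coeff score j\<bar>)"
  have "\<epsilon> \<longlonglongrightarrow> (\<Sum>i\<in>(UNIV::'p set). \<Sum>j\<in>(UNIV::'p set). \<bar>0\<bar>)"
    unfolding \<epsilon>_def[abs_def] by (intro tendsto_sum tendsto_rabs err_tendsto)
  then have "\<forall>\<^sub>F n in sequentially. \<epsilon> n < - curv / 2"
    using curv_neg by (intro order_tendstoD) auto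
  moreover have "S \<longlonglongrightarrow> s"
    unfolding S_def[abs_def] s_def by (intro tendsto_sum tendsto_rabs sample_score_tendsto) auto
  then have "\<forall>\<^sub>F n in sequentially. S n < s + 1" by (intro order_tendstoD) auto
  moreover have "\<forall>\<^sub>F n in sequentially. \<forall>i\<in>UNIV. curv * (axis i 1 \<bullet> h n) =
      - (\<Sum>j\<le>3. coeff (sample_score n) j * U j n (dual (axis i 1))) - (\<Sum>j\<in>UNIV. h n $ j * err n (axis i 1) j)"
    by (rule eventually_ball_finite[OF finite]) (use linearized_condition in blast)
  ultimately have "\<forall>\<^sub>F n in sequentially. H n \<le> (2 * (s + 1) / - curv) * T n"
  proof eventually_elim
    case (elim n)
    have "- curv * \<bar>h n $ i\<bar> \<le> (\<Sum>j\<le>3. S n * \<bar>U j n (dual (axis i 1))\<bar>) + (\<Sum>j\<in>UNIV. H n * \<bar>err n (axis i 1) j\<bar>)" for i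
    proof -
      have "- curv * \<bar>h n $ i\<bar> = \<bar>curv * (axis i 1 \<bullet> h n)\<bar>"
        using curv_neg by (simp add: abs_mult inner_axis')
      also have "\<dots> \<le> \<bar>\<Sum>j\<le>3. coeff (sample_score n) j * U j n (dual (axis i 1))\<bar> + \<bar>\<Sum>j\<in>UNIV. h n $ j * err n (axis i 1) j\<bar>"
        using elim(3) by auto
      also have "\<dots> \<le> (\<Sum>j\<le>3. \<bar>coeff (sample_score n) j\<bar> * \<bar>U j n (dual (axis i 1))\<bar>) + (\<Sum>j\<in>UNIV. \<bar>h n $ j\<bar> * \<bar>err n (axis i 1) j\<bar>)"
        unfolding abs_mult[symmetric] by (intro add_mono sum_abs)
      also have "\<dots> \<le> (\<Sum>j\<le>3. S n * \<bar>U j n (dual (axis i 1))\<bar>) + (\<Sum>j\<in>UNIV. H n * \<bar>err n (axis i 1) j\<bar>)"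
        unfolding S_def H_def by (intro add_mono sum_mono mult_right_mono member_le_sum) auto
      finally show ?thesis .
    qed
    then have "(\<Sum>i\<in>UNIV. - curv * \<bar>h n $ i\<bar>) \<le> (\<Sum>i\<in>UNIV. (\<Sum>j\<le>3. S n * \<bar>U j n (dual (axis i 1))\<bar>) + (\<Sum>j\<in>UNIV. H n * \<bar>err n (axis i 1) j\<bar>))"
      by (intro sum_mono)
    then have "- curv * H n \<le> S n * T n + H n * \<epsilon> n"
      by (simp only: H_def T_def \<epsilon>_def sum.distrib sum_distrib_left[symmetric])
    also have "S n * T n + H n * \<epsilon> n \<le> (s + 1) * T n + H n * (- curv / 2)"
      using elim(1,2) by (intro add_mono mult_right_mono mult_left_mono T_nonneg H_nonneg) auto
    finally show ?case using curv_neg by (simp add: field_simps)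
  qed
  moreover have "0 \<le> 2 * (s + 1) / - curv"
    using curv_neg unfolding s_def by (intro divide_nonneg_pos mult_nonneg_nonneg add_nonneg_nonneg sum_nonneg) auto
  ultimately show ?thesis by blast
qed

text \<open>With the rate inserted, both sources of error, the random score coefficients and
  \<open>err\<close>, are vanishing multiples of \<open>T n\<close>.\<close>

lemma h_expansion:
  "\<exists>\<epsilon>. \<epsilon> \<longlonglongrightarrow> 0 \<and> (\<forall>\<^sub>F n in sequentially. \<bar>b \<bullet> h n + (1 / curv) * (\<Sum>j\<le>3. coeff score j * U j n (dual b))\<bar> \<le> \<epsilon> n * T n)"
proof -
  obtain L where L: "0 \<le> L" "\<forall>\<^sub>F n in sequentially. H n \<le> L * T n" using H_rate by blast
  define B1 where "B1 = (\<Sum>i\<in>UNIV. \<bar>b $ i\<bar>)"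
  define \<epsilon> where "\<epsilon> n = (1 / - curv) * ((\<Sum>j\<le>3. \<bar>coeff (sample_score n) j - coeff score j\<bar> * B1) + (\<Sum>j\<in>UNIV. L * \<bar>err n b j\<bar>))" for n
  have "\<epsilon> \<longlonglongrightarrow> (1 / - curv) * ((\<Sum>j\<le>(3::nat). \<bar>coeff score j - coeff score j\<bar> * B1) + (\<Sum>j\<in>(UNIV::'p set). L * \<bar>0\<bar>))"
    unfolding \<epsilon>_def[abs_def] by (intro tendsto_intros sample_score_tendsto err_tendsto) auto
  then have "\<epsilon> \<longlonglongrightarrow> 0" by simp
  moreover have "\<forall>\<^sub>F n in sequentially. \<bar>b \<bullet> h n + (1 / curv) * (\<Sum>j\<le>3. coeff score j * U j n (dual b))\<bar> \<le> \<epsilon> n * T n"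
    using L(2) linearized_condition[of b]
  proof eventually_elim
    case (elim n)
    let ?R = "b \<bullet> h n + (1 / curv) * (\<Sum>j\<le>3. coeff score j * U j n (dual b))"
    have "curv * ?R = curv * (b \<bullet> h n) + (\<Sum>j\<le>3. coeff score j * U j n (dual b))"
      using curv_neg by (simp add: distrib_left)
    also have "\<dots> = - (\<Sum>j\<le>3. (coeff (sample_score n) j - coeff score j) * U j n (dual b)) - (\<Sum>j\<in>UNIV. h n $ j * err n b j)"
      unfolding elim(2) by (simp add: left_diff_distrib sum_subtractf)
    finally have R: "curv * ?R = \<dots>" .
    have "- curv * \<bar>?R\<bar> = \<bar>curv * ?R\<bar>" using curv_neg by (simp add: abs_mult)
    also have "\<dots> \<le> \<bar>\<Sum>j\<le>3. (coeff (sample_score n) j - coeff score j) * U j n (dual b)\<bar> + \<bar>\<Sum>j\<in>UNIV. h n $ j * err n b j\<bar>"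
      unfolding R by linarith
    also have "\<dots> \<le> (\<Sum>j\<le>3. \<bar>coeff (sample_score n) j - coeff score j\<bar> * \<bar>U j n (dual b)\<bar>) + (\<Sum>j\<in>UNIV. \<bar>h n $ j\<bar> * \<bar>err n b j\<bar>)"
      unfolding abs_mult[symmetric] by (intro add_mono sum_abs)
    also have "\<dots> \<le> (\<Sum>j\<le>3. \<bar>coeff (sample_score n) j - coeff score j\<bar> * (B1 * T n)) + (\<Sum>j\<in>UNIV. (L * T n) * \<bar>err n b j\<bar>)"
    proof (intro add_mono sum_mono mult_left_mono mult_right_mono)
      show "\<bar>U j n (dual b)\<bar> \<le> B1 * T n" if "j \<in> {..3}" for j unfolding B1_def using that by (intro U_dual_le) simp
      have "\<bar>h n $ j\<bar> \<le> H n" for j unfolding H_def by (intro member_le_sum) auto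
      then show "\<bar>h n $ j\<bar> \<le> L * T n" for j using elim(1) order_trans by blast
    qed auto
    also have "\<dots> = ((\<Sum>j\<le>3. \<bar>coeff (sample_score n) j - coeff score j\<bar> * B1) + (\<Sum>j\<in>UNIV. L * \<bar>err n b j\<bar>)) * T n"
      by (simp add: distrib_left sum_distrib_left mult_ac)
    finally have "(1 / - curv) * (- curv * \<bar>?R\<bar>) \<le> (1 / - curv) * (((\<Sum>j\<le>3. \<bar>coeff (sample_score n) j - coeff score j\<bar> * B1) + (\<Sum>j\<in>UNIV. L * \<bar>err n b j\<bar>)) * T n)"
      using curv_neg by (intro mult_left_mono) auto
    moreover have "(1 / - curv) * (- curv * \<bar>?R\<bar>) = \<bar>?R\<bar>" using curv_neg by simp
    ultimately have "\<bar>?R\<bar> \<le> (1 / - curv) * (((\<Sum>j\<le>3. \<bar>coeff (sample_score n) j - coeff score j\<bar> * B1) + (\<Sum>j\<in>UNIV. L * \<bar>err n b j\<bar>)) * T n)"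
      by (simp only:)
    then show ?case unfolding \<epsilon>_def by (simp only: mult.assoc)
  qed
  ultimately show ?thesis by blast
qed

lemma direction_expansion:
  "\<exists>\<epsilon>. \<epsilon> \<longlonglongrightarrow> 0 \<and> (\<forall>\<^sub>F n in sequentially. \<bar>b \<bullet> (v n - \<theta> /\<^sub>R norm \<theta>) - avg x n (influence b)\<bar> \<le> \<epsilon> n * T n)"
proof -
  obtain L where L: "0 \<le> L" "\<forall>\<^sub>F n in sequentially. H n \<le> L * T n" using H_rate by blast
  let ?b = "unit_gradient b"
  obtain \<epsilon> where \<epsilon>: "\<epsilon> \<longlonglongrightarrow> 0"
    "\<forall>\<^sub>F n in sequentially. \<bar>?b \<bullet> h n + (1 / curv) * (\<Sum>j\<le>3. coeff score j * U j n (dual ?b))\<bar> \<le> \<epsilon> n * T n"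
    using h_expansion by blast
  define N where "N n = (1 / norm (\<theta>n n)) *\<^sub>R b - ((\<theta> \<bullet> b) / (norm (\<theta>n n) * norm \<theta> * (norm (\<theta>n n) + norm \<theta>))) *\<^sub>R (\<theta>n n + \<theta>)" for n
  have nz: "norm \<theta> > 0" using \<theta>_nonzero by simp
  have "N \<longlonglongrightarrow> (1 / norm \<theta>) *\<^sub>R b - ((\<theta> \<bullet> b) / (norm \<theta> * norm \<theta> * (norm \<theta> + norm \<theta>))) *\<^sub>R (\<theta> + \<theta>)"
    unfolding N_def[abs_def] using nz by (intro tendsto_intros \<theta>n_tendsto) auto
  also have "(1 / norm \<theta>) *\<^sub>R b - ((\<theta> \<bullet> b) / (norm \<theta> * norm \<theta> * (norm \<theta> + norm \<theta>))) *\<^sub>R (\<theta> + \<theta>) = ?b"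
  proof -
    have "((\<theta> \<bullet> b) / (norm \<theta> * norm \<theta> * (norm \<theta> + norm \<theta>))) *\<^sub>R (\<theta> + \<theta>) = (2 * ((\<theta> \<bullet> b) / (norm \<theta> * norm \<theta> * (norm \<theta> + norm \<theta>)))) *\<^sub>R \<theta>"
      by (simp only: scaleR_2[symmetric] scaleR_scaleR mult.commute)
    also have "2 * ((\<theta> \<bullet> b) / (norm \<theta> * norm \<theta> * (norm \<theta> + norm \<theta>))) = 1 / norm \<theta> * ((\<theta> \<bullet> b) / (norm \<theta>)\<^sup>2)"
      using nz by (simp add: field_simps power2_eq_square)
    finally show ?thesis by (simp only: unit_gradient_def scaleR_diff_right scaleR_scaleR)
  qed
  finally have N: "N \<longlonglongrightarrow> ?b" .
  define \<epsilon>' where "\<epsilon>' n = \<epsilon> n + norm (N n - ?b) * L" for n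
  have "\<epsilon>' \<longlonglongrightarrow> 0 + norm (?b - ?b) * L"
    unfolding \<epsilon>'_def[abs_def] by (intro tendsto_intros \<epsilon>(1) N)
  then have "\<epsilon>' \<longlonglongrightarrow> 0" by simp
  moreover have "\<forall>\<^sub>F n in sequentially. \<bar>b \<bullet> (v n - \<theta> /\<^sub>R norm \<theta>) - avg x n (influence b)\<bar> \<le> \<epsilon>' n * T n"
    using L(2) \<epsilon>(2) v_eq
  proof eventually_elim
    case (elim n)
    have inf: "avg x n (influence b) = - (1 / curv) * (\<Sum>j\<le>3. coeff score j * U j n (dual ?b))"
    proof -
      have "poly score z = (\<Sum>j\<le>3. coeff score j * z ^ j)" for z
        by (simp add: score_def numeral_2_eq_2 numeral_3_eq_3 algebra_simps)
      then show ?thesis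
        unfolding U_def avg_cmult[symmetric] avg_sum[symmetric]
        by (intro arg_cong[where f="avg x n"]) (simp add: influence_def fun_eq_iff sum_distrib_right mult.assoc)
    qed
    have "b \<bullet> (v n - \<theta> /\<^sub>R norm \<theta>) = h n \<bullet> N n"
      using elim(3) unit_vector_difference[OF _ \<theta>_nonzero, of "\<theta>n n" b] by (simp add: h_def N_def)
    then have "b \<bullet> (v n - \<theta> /\<^sub>R norm \<theta>) - avg x n (influence b) =
        h n \<bullet> (N n - ?b) + (?b \<bullet> h n + (1 / curv) * (\<Sum>j\<le>3. coeff score j * U j n (dual ?b)))"
      unfolding inf by (simp add: inner_diff_right inner_commute)
    moreover have "\<bar>h n \<bullet> (N n - ?b)\<bar> \<le> norm (N n - ?b) * (L * T n)"
    proof -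
      have "\<bar>h n \<bullet> (N n - ?b)\<bar> \<le> norm (h n) * norm (N n - ?b)" by (rule Cauchy_Schwarz_ineq2)
      also have "norm (h n) \<le> H n" unfolding H_def by (rule norm_le_l1_cart)
      also have "H n \<le> L * T n" by (rule elim(1))
      finally show ?thesis by (simp add: mult_right_mono mult.commute)
    qed
    ultimately show ?case using elim(2) by (simp add: \<epsilon>'_def distrib_right mult.assoc)
  qed
  ultimately show ?thesis by blast
qed

text \<open>Boundedness in probability is not a property of a single path; dividing by
  \<open>1 + score_size x n\<close> gives a limit that holds along each path.\<close>

lemma remainder_tendsto:
  "(\<lambda>n. (sqrt (real n) * (b \<bullet> (v n - \<theta> /\<^sub>R norm \<theta>)) - sqrt (real n) * avg x n (influence b)) / (1 + score_size x n)) \<longlonglongrightarrow> 0"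
proof -
  obtain \<epsilon> where \<epsilon>: "\<epsilon> \<longlonglongrightarrow> 0"
    "\<forall>\<^sub>F n in sequentially. \<bar>b \<bullet> (v n - \<theta> /\<^sub>R norm \<theta>) - avg x n (influence b)\<bar> \<le> \<epsilon> n * T n"
    using direction_expansion by blast
  show ?thesis
  proof (rule Lim_null_comparison)
    show "(\<lambda>n. \<bar>\<epsilon> n\<bar>) \<longlonglongrightarrow> 0" using tendsto_rabs[OF \<epsilon>(1)] by simp
    show "\<forall>\<^sub>F n in sequentially. norm ((sqrt (real n) * (b \<bullet> (v n - \<theta> /\<^sub>R norm \<theta>)) - sqrt (real n) * avg x n (influence b)) / (1 + score_size x n)) \<le> \<bar>\<epsilon> n\<bar>"
      using \<epsilon>(2)
    proof eventually_elim
      case (elim n)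
      have K: "0 \<le> score_size x n" unfolding score_size_eq by (intro mult_nonneg_nonneg T_nonneg) auto
      have "\<bar>sqrt (real n) * (b \<bullet> (v n - \<theta> /\<^sub>R norm \<theta>)) - sqrt (real n) * avg x n (influence b)\<bar> =
          sqrt (real n) * \<bar>b \<bullet> (v n - \<theta> /\<^sub>R norm \<theta>) - avg x n (influence b)\<bar>"
        by (simp add: right_diff_distrib[symmetric] abs_mult)
      also have "\<dots> \<le> sqrt (real n) * (\<epsilon> n * T n)" using elim by (intro mult_left_mono) auto
      also have "\<dots> = \<epsilon> n * score_size x n" unfolding score_size_eq by simp
      also have "\<dots> \<le> \<bar>\<epsilon> n\<bar> * (1 + score_size x n)" using K by (intro mult_mono) auto
      finally show ?case using K by (simp add: abs_divide pos_divide_le_eq add_pos_nonneg)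
    qed
  qed
qed

end

section \<open>Limit law\<close>

lemma norm_iexp_diff_le: "cmod (iexp a - iexp b) \<le> min 2 \<bar>a - b\<bar>"
proof -
  have "iexp a - iexp b = iexp b * (iexp (a - b) - 1)"
    by (simp add: exp_add[symmetric] algebra_simps)
  then have "cmod (iexp a - iexp b) = cmod (iexp (a - b) - 1)" by (simp add: norm_mult)
  also have "\<dots> \<le> \<bar>a - b\<bar>" using iexp_approx1[of "a - b" 0] by simp
  finally have "cmod (iexp a - iexp b) \<le> \<bar>a - b\<bar>" .
  moreover have "cmod (iexp a - iexp b) \<le> cmod (iexp a) + cmod (iexp b)" by (rule norm_triangle_ineq4)
  ultimately show ?thesis by simp
qed

text \<open>A bounded-in-probability factor times an almost surely vanishing one. Where
  \<open>K n \<omega> \<le> L\<close> the remainder is at most \<open>1 + L\<close> times the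
  vanishing ratio; elsewhere the cap 2 is below \<open>2 / L * K n \<omega>\<close>, whose
  expectation is small as in Markov's inequality.\<close>

lemma (in prob_space) negligible_remainder:
  fixes R K :: "nat \<Rightarrow> 'a \<Rightarrow> real"
  assumes R[measurable]: "\<And>n. R n \<in> borel_measurable M"
    and K: "\<And>n \<omega>. 0 \<le> K n \<omega>" "\<And>n. integrable M (K n)" "\<And>n. expectation (K n) \<le> C"
    and lim: "AE \<omega> in M. (\<lambda>n. R n \<omega> / (1 + K n \<omega>)) \<longlonglongrightarrow> 0"
  shows "(\<lambda>n. expectation (\<lambda>\<omega>. min 2 \<bar>R n \<omega>\<bar>)) \<longlonglongrightarrow> 0"
proof (rule LIMSEQ_I)
  fix r :: real assume r: "0 < r"
  have [measurable]: "K n \<in> borel_measurable M" for n using K(2) by simp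
  have "0 \<le> expectation (K 0)" by (rule integral_nonneg_AE) (use K(1) in auto)
  then have C: "0 \<le> C" using K(3)[of 0] by linarith
  \<comment> \<open>The summand \<open>4 * C / r\<close> makes \<open>2 * C / L\<close> smaller than
    \<open>r / 2\<close>; adding 1 keeps \<open>L\<close> positive for \<open>C = 0\<close>.\<close>
  define L where "L = 4 * C / r + 1"
  have L: "L > 0" "2 * C / L < r / 2"
  proof -
    show "L > 0" unfolding L_def using C r by (intro add_nonneg_pos divide_nonneg_pos) auto
    then show "2 * C / L < r / 2" using r C unfolding L_def by (simp add: field_simps)
  qed
  define q where "q n \<omega> = \<bar>R n \<omega> / (1 + K n \<omega>)\<bar>" for n \<omega>
  have [measurable]: "q n \<in> borel_measurable M" for n unfolding q_def[abs_def] by measurable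
  have "(\<lambda>n. expectation (\<lambda>\<omega>. min 2 ((1 + L) * q n \<omega>))) \<longlonglongrightarrow> expectation (\<lambda>\<omega>. 0)"
  proof (rule integral_dominated_convergence[where w="\<lambda>_. 2"])
    show "AE \<omega> in M. (\<lambda>n. min 2 ((1 + L) * q n \<omega>)) \<longlonglongrightarrow> 0"
      using lim
    proof eventually_elim
      case (elim \<omega>)
      then have "(\<lambda>n. min 2 ((1 + L) * q n \<omega>)) \<longlonglongrightarrow> min 2 ((1 + L) * \<bar>0\<bar>)"
        unfolding q_def by (intro tendsto_intros)
      then show ?case by simp
    qed
    show "AE \<omega> in M. norm (min 2 ((1 + L) * q n \<omega>)) \<le> 2" for n
      using L(1) by (intro AE_I2) (simp add: q_def min_def)
  qed auto
  then have "(\<lambda>n. expectation (\<lambda>\<omega>. min 2 ((1 + L) * q n \<omega>))) \<longlonglongrightarrow> 0" by simp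
  then have "\<forall>\<^sub>F n in sequentially. expectation (\<lambda>\<omega>. min 2 ((1 + L) * q n \<omega>)) < r / 2"
    using r by (intro order_tendstoD) auto
  moreover have "norm (expectation (\<lambda>\<omega>. min 2 \<bar>R n \<omega>\<bar>) - 0) < r"
    if "expectation (\<lambda>\<omega>. min 2 ((1 + L) * q n \<omega>)) < r / 2" for n
  proof -
    have int: "integrable M (\<lambda>\<omega>. min 2 ((1 + L) * q n \<omega>))"
      using L(1) by (intro integrable_const_bound[where B=2]) (auto simp: q_def min_def)
    have "expectation (\<lambda>\<omega>. min 2 \<bar>R n \<omega>\<bar>) \<le> expectation (\<lambda>\<omega>. min 2 ((1 + L) * q n \<omega>) + 2 / L * K n \<omega>)"
    proof (rule integral_mono)
      show "integrable M (\<lambda>\<omega>. min 2 \<bar>R n \<omega>\<bar>)" by (intro integrable_const_bound[where B=2]) auto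
      show "integrable M (\<lambda>\<omega>. min 2 ((1 + L) * q n \<omega>) + 2 / L * K n \<omega>)"
        by (intro Bochner_Integration.integrable_add int integrable_mult_right K(2))
      fix \<omega>
      have Rq: "\<bar>R n \<omega>\<bar> = (1 + K n \<omega>) * q n \<omega>" using K(1)[of n \<omega>] by (simp add: q_def abs_divide)
      have q0: "0 \<le> q n \<omega>" by (simp add: q_def)
      show "min 2 \<bar>R n \<omega>\<bar> \<le> min 2 ((1 + L) * q n \<omega>) + 2 / L * K n \<omega>"
      proof (cases "K n \<omega> \<le> L")
        case True
        then have "\<bar>R n \<omega>\<bar> \<le> (1 + L) * q n \<omega>" unfolding Rq using q0 by (intro mult_right_mono) auto
        moreover have "0 \<le> 2 / L * K n \<omega>" using L(1) K(1)[of n \<omega>] by simp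
        ultimately show ?thesis by linarith
      next
        case False
        then have "2 \<le> 2 / L * K n \<omega>" using L(1) by (simp add: field_simps)
        moreover have "0 \<le> min 2 ((1 + L) * q n \<omega>)" using q0 L(1) by simp
        ultimately show ?thesis by linarith
      qed
    qed
    also have "\<dots> = expectation (\<lambda>\<omega>. min 2 ((1 + L) * q n \<omega>)) + 2 / L * expectation (K n)"
      using int K(2) by simp
    also have "2 / L * expectation (K n) \<le> 2 / L * C" using K(3) L(1) by (intro mult_left_mono) auto
    finally have "expectation (\<lambda>\<omega>. min 2 \<bar>R n \<omega>\<bar>) < r" using that L(2) by simp
    moreover have "0 \<le> expectation (\<lambda>\<omega>. min 2 \<bar>R n \<omega>\<bar>)" by (rule integral_nonneg_AE) simp
    ultimately show ?thesis by simp
  qed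
  ultimately have "\<forall>\<^sub>F n in sequentially. norm (expectation (\<lambda>\<omega>. min 2 \<bar>R n \<omega>\<bar>) - 0) < r"
    by (auto elim: eventually_mono)
  then show "\<exists>N. \<forall>n\<ge>N. norm (expectation (\<lambda>\<omega>. min 2 \<bar>R n \<omega>\<bar>) - 0) < r"
    by (simp add: eventually_sequentially)
qed

context iid_sample
begin

lemma sqrt_avg_eq: "sqrt (real n) * avg (\<lambda>i. X i \<omega>) n f = (\<Sum>i<n. f (X i \<omega>)) / sqrt (real n)"
  by (cases "n = 0") (simp_all add: avg_def real_div_sqrt field_simps)

lemma scaled_average_second_moment:
  assumes f: "poly_growth f" and mean: "(\<integral>x. f x \<partial>P) = 0"
  shows "integrable M (\<lambda>\<omega>. (sqrt (real n) * avg (\<lambda>i. X i \<omega>) n f)\<^sup>2)"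
    and "expectation (\<lambda>\<omega>. (sqrt (real n) * avg (\<lambda>i. X i \<omega>) n f)\<^sup>2) \<le> (\<integral>x. (f x)\<^sup>2 \<partial>P)"
proof -
  show "integrable M (\<lambda>\<omega>. (sqrt (real n) * avg (\<lambda>i. X i \<omega>) n f)\<^sup>2)"
    unfolding sqrt_avg_eq power_divide by (intro integrable_divide second_moment_sum(1)[OF f mean])
  have "expectation (\<lambda>\<omega>. (sqrt (real n) * avg (\<lambda>i. X i \<omega>) n f)\<^sup>2) = real n * (\<integral>x. (f x)\<^sup>2 \<partial>P) / real n"
    unfolding sqrt_avg_eq power_divide using second_moment_sum(2)[OF f mean, of n] by simp
  \<comment> \<open>Equality for positive \<open>n\<close>; at \<open>n = 0\<close> the left side is
    0.\<close>
  also have "\<dots> \<le> (\<integral>x. (f x)\<^sup>2 \<partial>P)" by (cases "n = 0") auto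
  finally show "expectation (\<lambda>\<omega>. (sqrt (real n) * avg (\<lambda>i. X i \<omega>) n f)\<^sup>2) \<le> (\<integral>x. (f x)\<^sup>2 \<partial>P)" .
qed

lemma scaled_average_abs_moment:
  assumes f: "poly_growth f" and mean: "(\<integral>x. f x \<partial>P) = 0"
  shows "integrable M (\<lambda>\<omega>. sqrt (real n) * \<bar>avg (\<lambda>i. X i \<omega>) n f\<bar>)"
    and "expectation (\<lambda>\<omega>. sqrt (real n) * \<bar>avg (\<lambda>i. X i \<omega>) n f\<bar>) \<le> 1 + (\<integral>x. (f x)\<^sup>2 \<partial>P)"
proof -
  let ?Y = "\<lambda>\<omega>. sqrt (real n) * avg (\<lambda>i. X i \<omega>) n f"
  have [measurable]: "f \<in> borel_measurable borel" by (rule poly_growth_measurable[OF f])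
  have [measurable]: "?Y \<in> borel_measurable M" unfolding avg_def by measurable
  note sq = scaled_average_second_moment[OF f mean, of n]
  have abs_eq: "sqrt (real n) * \<bar>avg (\<lambda>i. X i \<omega>) n f\<bar> = \<bar>?Y \<omega>\<bar>" for \<omega> by (simp add: abs_mult)
  have "integrable M ?Y" by (rule square_integrable_imp_integrable[OF _ sq(1)]) simp_all
  then show "integrable M (\<lambda>\<omega>. sqrt (real n) * \<bar>avg (\<lambda>i. X i \<omega>) n f\<bar>)"
    unfolding abs_eq by (rule integrable_abs)
  then have "expectation (\<lambda>\<omega>. sqrt (real n) * \<bar>avg (\<lambda>i. X i \<omega>) n f\<bar>) \<le> expectation (\<lambda>\<omega>. 1 + (?Y \<omega>)\<^sup>2)"
  proof (rule integral_mono)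
    show "integrable M (\<lambda>\<omega>. 1 + (?Y \<omega>)\<^sup>2)" using sq(1) by simp
    have "\<bar>y\<bar> \<le> 1 + y\<^sup>2" for y :: real
      using sum_squares_ge_zero[of "\<bar>y\<bar> - 1/2" 0] by (simp add: power2_eq_square algebra_simps)
    then show "sqrt (real n) * \<bar>avg (\<lambda>i. X i \<omega>) n f\<bar> \<le> 1 + (?Y \<omega>)\<^sup>2" for \<omega> unfolding abs_eq by blast
  qed
  also have "\<dots> = 1 + expectation (\<lambda>\<omega>. (?Y \<omega>)\<^sup>2)" using sq(1) by (simp add: prob_space)
  finally show "expectation (\<lambda>\<omega>. sqrt (real n) * \<bar>avg (\<lambda>i. X i \<omega>) n f\<bar>) \<le> 1 + (\<integral>x. (f x)\<^sup>2 \<partial>P)"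
    using sq(2) by simp
qed

lemma scaled_average_char_tendsto:
  assumes f: "poly_growth f" and mean: "(\<integral>x. f x \<partial>P) = 0"
  shows "(\<lambda>n. expectation (\<lambda>\<omega>. iexp (sqrt (real n) * avg (\<lambda>i. X i \<omega>) n f))) \<longlonglongrightarrow>
    of_real (exp (- (\<integral>x. (f x)\<^sup>2 \<partial>P) / 2))"
proof -
  define v where "v = (\<integral>x. (f x)\<^sup>2 \<partial>P)"
  have [measurable]: "f \<in> borel_measurable borel" by (rule poly_growth_measurable[OF f])
  have f2: "poly_growth (\<lambda>x. (f x)\<^sup>2)" by (intro poly_growth_intros f)
  have v0: "0 \<le> v" unfolding v_def by simp
  let ?W = "\<lambda>n \<omega>. sqrt (real n) * avg (\<lambda>i. X i \<omega>) n f"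
  have [measurable]: "(\<lambda>\<omega>. avg (\<lambda>i. X i \<omega>) n f) \<in> borel_measurable M" for n unfolding avg_def by measurable
  show ?thesis
  \<comment> \<open>Variance zero does occur: the influence in the direction of \<theta> vanishes.
    The central limit theorem is applied to positive variance only.\<close>
  proof (cases "v = 0")
    case True
    have "expectation (\<lambda>\<omega>. iexp (?W n \<omega>)) = 1" for n
    proof -
      note sq = scaled_average_second_moment[OF f mean, of n]
      have "0 \<le> expectation (\<lambda>\<omega>. (?W n \<omega>)\<^sup>2)" by simp
      then have "expectation (\<lambda>\<omega>. (?W n \<omega>)\<^sup>2) = 0" using sq(2) True unfolding v_def by linarith
      then have "AE \<omega> in M. (?W n \<omega>)\<^sup>2 = 0"
        using sq(1) by (subst (asm) integral_nonneg_eq_0_iff_AE) auto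
      then have "AE \<omega> in M. iexp (?W n \<omega>) = 1"
      proof eventually_elim
        case (elim \<omega>)
        then have "?W n \<omega> = 0" by (simp only: power_eq_0_iff)
        then show ?case by (simp only: of_real_0 mult_zero_right exp_zero)
      qed
      then have "expectation (\<lambda>\<omega>. iexp (?W n \<omega>)) = expectation (\<lambda>\<omega>. 1)"
        by (intro integral_cong_AE) auto
      then show ?thesis by (simp add: prob_space)
    qed
    then show ?thesis using True unfolding v_def by simp
  next
    case False
    define \<sigma> where "\<sigma> = sqrt v"
    have \<sigma>: "\<sigma> > 0" "\<sigma>\<^sup>2 = v" using False v0 by (auto simp: \<sigma>_def)
    let ?S = "\<lambda>n \<omega>. (\<Sum>i<n. f (X i \<omega>)) / sqrt (real n * \<sigma>\<^sup>2)"
    have weak: "weak_conv_m (\<lambda>n. distr M borel (?S n)) std_normal_distribution"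
    proof (rule central_limit_theorem_zero_mean[where \<mu>="distr P borel f"])
      show "indep_vars (\<lambda>i. borel) (\<lambda>i \<omega>. f (X i \<omega>)) UNIV" by (rule indep_compose) simp
      show "expectation (\<lambda>\<omega>. f (X n \<omega>)) = 0" for n using expectation_poly_growth_X[OF f] mean by simp
      then show "variance (\<lambda>\<omega>. f (X n \<omega>)) = \<sigma>\<^sup>2" for n
        using expectation_poly_growth_X[OF f2] by (simp add: \<sigma>(2) v_def)
      show "integrable M (\<lambda>\<omega>. (f (X n \<omega>))\<^sup>2)" for n by (rule integrable_poly_growth_X[OF f2])
      show "distr M borel (\<lambda>\<omega>. f (X n \<omega>)) = distr P borel f" for n
        unfolding law[of n, symmetric] by (subst distr_distr) (auto simp: comp_def)
    qed (rule \<sigma>(1))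
    interpret S: prob_space std_normal_distribution by (rule prob_space_normal_density) simp
    \<comment> \<open>The argument \<sigma> undoes the standardization of the sum.\<close>
    have "(\<lambda>n. char (distr M borel (?S n)) \<sigma>) \<longlonglongrightarrow> char std_normal_distribution \<sigma>"
      by (rule levy_continuity1[OF _ _ weak]) (auto intro!: real_distribution_distr simp: real_dist_normal_dist)
    also have "char std_normal_distribution \<sigma> = of_real (exp (- v / 2))"
      by (simp add: char_std_normal_distribution \<sigma>(2))
    also have "(\<lambda>n. char (distr M borel (?S n)) \<sigma>) = (\<lambda>n. expectation (\<lambda>\<omega>. iexp (?W n \<omega>)))"
    proof
      fix n
      have "\<sigma> * ?S n \<omega> = ?W n \<omega>" for \<omega>
        using \<sigma>(1) unfolding sqrt_avg_eq by (simp add: real_sqrt_mult)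
      then show "char (distr M borel (?S n)) \<sigma> = expectation (\<lambda>\<omega>. iexp (?W n \<omega>))"
        unfolding char_def by (subst integral_distr) (simp_all del: of_real_mult of_real_divide of_real_sum)
    qed
    finally show ?thesis unfolding v_def .
  qed
qed

end

context mixture_index
begin

lemma matrix_inv_\<Sigma>_sym: "v \<bullet> (matrix_inv \<Sigma> *v w) = w \<bullet> (matrix_inv \<Sigma> *v v)"
proof -
  have "v \<bullet> (matrix_inv \<Sigma> *v w) = (\<Sigma> *v (matrix_inv \<Sigma> *v v)) \<bullet> (matrix_inv \<Sigma> *v w)" by (simp add: \<Sigma>_inv_apply)
  also have "\<dots> = (matrix_inv \<Sigma> *v v) \<bullet> (\<Sigma> *v (matrix_inv \<Sigma> *v w))"
    by (metis \<Sigma>_sym inner_commute)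
  finally show ?thesis by (simp add: \<Sigma>_inv_apply inner_commute)
qed

lemma proj_orth_apply: "proj_orth \<theta> *v b = norm \<theta> *\<^sub>R unit_gradient b"
proof -
  have "((columnvector \<theta> :: real^1^'p) ** rowvector \<theta>) *v b = (\<theta> \<bullet> b) *\<^sub>R \<theta>"
    by (simp add: vec_eq_iff matrix_matrix_mult_def matrix_vector_mult_def columnvector_def rowvector_def inner_vec_def
        sum_distrib_left sum_distrib_right mult_ac)
  then show ?thesis
    using \<theta>_nonzero by (simp add: proj_orth_def unit_gradient_def matrix_vector_mult_diff_rdistrib scaleR_matrix_vector_assoc[symmetric])
qed

lemma transpose_proj_orth: "v \<bullet> (proj_orth \<theta> *v w) = (proj_orth \<theta> *v v) \<bullet> w"
  unfolding proj_orth_apply using \<theta>_nonzero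
  by (simp add: unit_gradient_def inner_diff_left inner_diff_right inner_commute mult_ac)

lemma Psi_eta_form:
  "v \<bullet> (Psi_eta w1 w2 \<beta> \<tau> \<theta> \<Sigma> *v w) =
    C_eta w1 w2 \<beta> \<tau> * (1 + \<beta> * \<tau>) / \<beta> * (unit_gradient v \<bullet> (matrix_inv \<Sigma> *v unit_gradient w))"
proof -
  have "v \<bullet> (Psi_eta w1 w2 \<beta> \<tau> \<theta> \<Sigma> *v w) = C_eta w1 w2 \<beta> \<tau> * ((1 + \<beta> * \<tau>) / ((norm \<theta>)\<^sup>2 * \<beta>)) *
      ((proj_orth \<theta> *v v) \<bullet> (matrix_inv \<Sigma> *v (proj_orth \<theta> *v w)))"
    by (simp add: Psi_eta_def scaleR_matrix_vector_assoc[symmetric] matrix_vector_mul_assoc[symmetric] transpose_proj_orth)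
  then show ?thesis
    unfolding proj_orth_apply matrix_vector_mult_scaleR inner_scaleR_left inner_scaleR_right
    using \<theta>_nonzero by (simp add: power2_eq_square)
qed

text \<open>Independence of Z and the projection on \<open>dual (unit_gradient b)\<close> gives mean
  zero and factors the variance into the second moment of the score over \<open>curv\<^sup>2\<close>
  and a \<Sigma>-length. The former is \<open>score_variance\<close>, the latter the form of the
  projected inverse of \<Sigma>.\<close>

lemma influence_moments:
  shows poly_growth_influence: "poly_growth (influence b)"
    and influence_mean: "(\<integral>x. influence b x \<partial>P) = 0"
    and influence_variance: "(\<integral>x. (influence b x)\<^sup>2 \<partial>P) = b \<bullet> (Psi_eta w1 w2 \<beta> \<tau> \<theta> \<Sigma> *v b)"
proof -
  let ?g = "unit_gradient b" and ?e = "dual (unit_gradient b)" and ?Z = "\<lambda>x. \<theta> \<bullet> (x - mean)"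
  have "poly_growth (\<lambda>y. - (1 / curv) * (poly score (\<theta> \<bullet> y) * (?e \<bullet> y)))" by (intro poly_growth_intros)
  from poly_growth_shift[OF this, of mean] show "poly_growth (influence b)" by (simp add: influence_def[abs_def])
  show "(\<integral>x. influence b x \<partial>P) = 0"
    unfolding influence_def integral_mult_right_zero integral_P_orthogonal(1)[OF dual_orthogonal dual_orthogonal] by simp
  have "(\<integral>x. (influence b x)\<^sup>2 \<partial>P) = (\<integral>x. (1 / curv\<^sup>2) * (poly (score * score) (?Z x) * ((?e \<bullet> (x - mean)) * (?e \<bullet> (x - mean)))) \<partial>P)"
    by (rule Bochner_Integration.integral_cong) (simp_all add: influence_def power2_eq_square mult_ac)
  also have "\<dots> = (1 / curv\<^sup>2) * ((?e \<bullet> (\<Sigma> *v ?e)) * (\<integral>x. poly (score * score) (?Z x) \<partial>P))"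
    unfolding integral_mult_right_zero integral_P_orthogonal(2)[OF dual_orthogonal dual_orthogonal] ..
  also have "\<dots> = (\<integral>x. (poly score (?Z x))\<^sup>2 \<partial>P) / curv\<^sup>2 * (?e \<bullet> (\<Sigma> *v ?e))"
    by (simp add: power2_eq_square)
  also have "?e \<bullet> (\<Sigma> *v ?e) = ?g \<bullet> (matrix_inv \<Sigma> *v ?g)"
  proof -
    \<comment> \<open>A unit vector moves only tangentially; this orthogonality reduces
      \<open>dual\<close> to \<open>matrix_inv \<Sigma>\<close>.\<close>
    have "\<theta> \<bullet> ?g = 0" using \<theta>_nonzero by (simp add: unit_gradient_def inner_diff_right power2_norm_eq_inner)
    then have "?e = matrix_inv \<Sigma> *v ?g" by (simp add: dual_def)
    then show ?thesis unfolding dual_inner_\<Sigma>[OF dual_orthogonal] by simp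
  qed
  finally show "(\<integral>x. (influence b x)\<^sup>2 \<partial>P) = b \<bullet> (Psi_eta w1 w2 \<beta> \<tau> \<theta> \<Sigma> *v b)"
    unfolding score_variance Psi_eta_form .
qed

text \<open>Semidefiniteness holds because the quadratic form is a variance; the sign of
  \<open>C_eta\<close> is not discussed directly.\<close>

lemma covariance_matrix_Psi_eta: "covariance_matrix (Psi_eta w1 w2 \<beta> \<tau> \<theta> \<Sigma>)"
  unfolding covariance_matrix_def
proof
  let ?\<Psi> = "Psi_eta w1 w2 \<beta> \<tau> \<theta> \<Sigma>"
  have "axis i 1 \<bullet> (?\<Psi> *v axis j 1) = axis j 1 \<bullet> (?\<Psi> *v axis i 1)" for i j
    unfolding Psi_eta_form by (simp add: matrix_inv_\<Sigma>_sym)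
  then show "transpose ?\<Psi> = ?\<Psi>"
    by (simp add: vec_eq_iff transpose_def inner_axis' matrix_vector_mult_basis column_def)
  show "\<forall>b. 0 \<le> b \<bullet> (?\<Psi> *v b)"
    unfolding influence_variance[symmetric] by simp
qed

text \<open>The choice inside \<open>mvn\<close> is meaningful here only because the singular limit
  covariance has a square root.\<close>

lemma mvn_Psi_eta_char:
  "(\<integral>x. iexp (b \<bullet> x) \<partial>mvn 0 (Psi_eta w1 w2 \<beta> \<tau> \<theta> \<Sigma>)) = of_real (exp (- (\<integral>x. (influence b x)\<^sup>2 \<partial>P) / 2))"
proof -
  obtain A :: "real^'p^'p" where "A ** transpose A = Psi_eta w1 w2 \<beta> \<tau> \<theta> \<Sigma>"
    using covariance_matrix_sqrt[OF covariance_matrix_Psi_eta] .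
  from mvn_characteristic_function[OF this, where v=b and m=0] show ?thesis
    by (simp add: influence_variance)
qed

end

lemma is_arg_max_eta_index_sign:
  assumes "is_arg_max (eta_index w1 w2 x n) (\<lambda>v. v \<in> sphere 0 1) u" "s = 1 \<or> s = - 1"
  shows "is_arg_max (eta_index w1 w2 x n) (\<lambda>v. v \<in> sphere 0 1) (s *\<^sub>R u)"
  using assms eta_index_scaleR[of s w1 w2 x n u] by (auto simp: is_arg_max_def)

theorem theorem4:
  fixes M :: "'a measure"
    and X :: "nat \<Rightarrow> 'a \<Rightarrow> real^'p"
    and u :: "nat \<Rightarrow> 'a \<Rightarrow> real^'p"
    and \<alpha>1 \<alpha>2 w1 w2 \<beta> \<tau> :: real
    and \<mu>1 \<mu>2 \<theta> :: "real^'p"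
    and \<Sigma> :: "real^'p^'p"
  assumes M: "prob_space M"
    and indep: "prob_space.indep_vars M (\<lambda>_. borel) X UNIV"
    and law: "\<And>i. distr M borel (X i) = mixture2 \<alpha>1 (mvn \<mu>1 \<Sigma>) \<alpha>2 (mvn \<mu>2 \<Sigma>)"
    and \<alpha>: "0 < \<alpha>1" "\<alpha>1 < 1" "\<alpha>2 = 1 - \<alpha>1"
    and \<mu>: "\<mu>1 \<noteq> \<mu>2"
    and \<Sigma>: "covariance_matrix \<Sigma>" "rank \<Sigma> = CARD('p)"
    and w: "0 < w1" "0 < w2" "w1 + w2 = 1"
    and u_meas: "\<And>n. u n \<in> borel_measurable M"
    and u_unit: "\<And>n \<omega>. \<omega> \<in> space M \<Longrightarrow> u n \<omega> \<in> sphere 0 1"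
    and u_max: "\<forall>\<^sub>F n in sequentially. AE \<omega> in M.
      is_arg_max (eta_index w1 w2 (\<lambda>i. X i \<omega>) n) (\<lambda>v. v \<in> sphere 0 1) (u n \<omega>)"
    and \<theta>: "\<theta> = matrix_inv \<Sigma> *v (\<mu>2 - \<mu>1)"
    and \<beta>: "\<beta> = \<alpha>1 * \<alpha>2"
    and \<tau>: "\<tau> = (\<mu>2 - \<mu>1) \<bullet> (matrix_inv \<Sigma> *v (\<mu>2 - \<mu>1))"
  shows "\<exists>s :: nat \<Rightarrow> 'a \<Rightarrow> real.
    (\<forall>n. s n \<in> borel_measurable M) \<and>
    (\<forall>n. \<forall>\<omega>\<in>space M. s n \<omega> \<in> {-1, 1}) \<and>
    (AE \<omega> in M. (\<lambda>n. s n \<omega> *\<^sub>R u n \<omega>) \<longlonglongrightarrow> \<theta> /\<^sub>R norm \<theta>) \<and>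
    converges_in_distribution M
      (\<lambda>n \<omega>. sqrt (real n) *\<^sub>R (s n \<omega> *\<^sub>R u n \<omega> - \<theta> /\<^sub>R norm \<theta>))
      (mvn 0 (Psi_eta w1 w2 \<beta> \<tau> \<theta> \<Sigma>))"
proof -
  interpret I: mixture_index \<alpha>1 \<alpha>2 \<mu>1 \<mu>2 \<Sigma> w1 w2
    by unfold_locales (use \<alpha> \<mu> \<Sigma> w in auto)
  have par: "\<theta> = I.\<theta>" "\<beta> = I.\<beta>" "\<tau> = I.\<tau>"
    by (simp_all add: \<theta> \<beta> \<tau> I.\<theta>_def I.\<delta>_def I.\<beta>_def I.\<tau>_def)
  interpret prob_space M by (rule M)
  interpret S: iid_sample M X I.P
    by unfold_locales (use indep law I.all_moments_P in \<open>auto simp: I.P_def\<close>)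
  let ?t = "I.\<theta> /\<^sub>R norm I.\<theta>"
  \<comment> \<open>The hemisphere of \<theta> selects the sign; a zero inner product gets 1, so
    that \<open>s\<close> is a measurable sign at every point.\<close>
  define s :: "nat \<Rightarrow> 'a \<Rightarrow> real" where "s n \<omega> = (if 0 \<le> u n \<omega> \<bullet> I.\<theta> then 1 else - 1)" for n \<omega>
  have s1: "s n \<omega> = 1 \<or> s n \<omega> = - 1" for n \<omega> by (simp add: s_def)
  note [measurable] = u_meas
  have [measurable]: "s n \<in> borel_measurable M" for n unfolding s_def[abs_def] by measurable
  define v where "v n \<omega> = s n \<omega> *\<^sub>R u n \<omega>" for n \<omega>
  have [measurable]: "v n \<in> borel_measurable M" for n unfolding v_def[abs_def] by measurable
  obtain N where "\<And>n. n \<ge> N \<Longrightarrow> AE \<omega> in M.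
      is_arg_max (eta_index w1 w2 (\<lambda>i. X i \<omega>) n) (\<lambda>v. v \<in> sphere 0 1) (u n \<omega>)"
    using u_max by (auto simp: eventually_sequentially)
  \<comment> \<open>Countably many sample sizes allow one null set for all of them.\<close>
  then have "AE \<omega> in M. \<forall>n. n \<ge> N \<longrightarrow>
      is_arg_max (eta_index w1 w2 (\<lambda>i. X i \<omega>) n) (\<lambda>v. v \<in> sphere 0 1) (u n \<omega>)"
    by (simp add: AE_all_countable)
  then have path: "AE \<omega> in M. maximizer_path \<alpha>1 \<alpha>2 \<mu>1 \<mu>2 \<Sigma> w1 w2 (\<lambda>i. X i \<omega>) (\<lambda>n. v n \<omega>)"
    using S.AE_moments_converge AE_space
  proof eventually_elim
    case (elim \<omega>)
    show ?case
    proof unfold_locales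
      show "moments_converge (\<lambda>i. X i \<omega>) I.P" by (rule elim(2))
      show "v n \<omega> \<in> sphere 0 1" for n using u_unit[OF elim(3), of n] s1[of n \<omega>] by (auto simp: v_def)
      show "0 \<le> v n \<omega> \<bullet> I.\<theta>" for n by (simp add: v_def s_def)
      show "\<forall>\<^sub>F n in sequentially. is_arg_max (eta_index w1 w2 (\<lambda>i. X i \<omega>) n) (\<lambda>u. u \<in> sphere 0 1) (v n \<omega>)"
        unfolding v_def eventually_sequentially
        by (intro exI[of _ N] allI impI is_arg_max_eta_index_sign s1) (use elim(1) in blast)
    qed
  qed
  have lim: "AE \<omega> in M. (\<lambda>n. v n \<omega>) \<longlonglongrightarrow> ?t"
    using path by eventually_elim (rule maximizer_path.v_tendsto)
  define Y where "Y n \<omega> = sqrt (real n) *\<^sub>R (v n \<omega> - ?t)" for n \<omega>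
  have [measurable]: "Y n \<in> borel_measurable M" for n unfolding Y_def[abs_def] by measurable
  have char: "(\<lambda>n. expectation (\<lambda>\<omega>. iexp (b \<bullet> Y n \<omega>))) \<longlonglongrightarrow> (\<integral>x. iexp (b \<bullet> x) \<partial>mvn 0 (Psi_eta w1 w2 I.\<beta> I.\<tau> I.\<theta> \<Sigma>))" for b
  proof -
    define W where "W n \<omega> = sqrt (real n) * avg (\<lambda>i. X i \<omega>) n (I.influence b)" for n \<omega>
    define R where "R n \<omega> = b \<bullet> Y n \<omega> - W n \<omega>" for n \<omega>
    have [measurable]: "I.influence b \<in> borel_measurable borel"
      by (rule poly_growth_measurable[OF I.poly_growth_influence])
    have W[measurable]: "W n \<in> borel_measurable M" for n unfolding W_def[abs_def] avg_def by measurable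
    have R[measurable]: "R n \<in> borel_measurable M" for n unfolding R_def[abs_def] by measurable
    define F where "F i j y = (I.\<theta> \<bullet> (y - I.mean)) ^ j * (I.dual (axis i 1) \<bullet> (y - I.mean))" for i :: 'p and j :: nat and y
    have F: "poly_growth (F i j)" for i j
      unfolding F_def[abs_def]
      by (rule poly_growth_shift[of "\<lambda>y. (I.\<theta> \<bullet> y) ^ j * (I.dual (axis i 1) \<bullet> y)"]) (intro poly_growth_intros)
    \<comment> \<open>Orthogonality of \<open>dual\<close> to \<delta> centres each summand of the
      score size, which bounds its scaled absolute moment uniformly in \<open>n\<close>.\<close>
    have F0: "(\<integral>x. F i j x \<partial>I.P) = 0" for i j
      using I.integral_P_orthogonal(1)[OF I.dual_orthogonal I.dual_orthogonal, of "monom 1 j" "axis i 1"]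
      by (simp add: F_def poly_monom)
    note FK = S.scaled_average_abs_moment[OF F F0]
    define K where "K n \<omega> = I.score_size (\<lambda>i. X i \<omega>) n" for n \<omega>
    have K: "K n = (\<lambda>\<omega>. \<Sum>i\<in>UNIV. \<Sum>j\<le>3. sqrt (real n) * \<bar>avg (\<lambda>i. X i \<omega>) n (F i j)\<bar>)" for n
      by (simp add: K_def I.score_size_def F_def[abs_def] sum_distrib_left fun_eq_iff)
    have R0: "(\<lambda>n. expectation (\<lambda>\<omega>. min 2 \<bar>R n \<omega>\<bar>)) \<longlonglongrightarrow> 0"
    proof (rule negligible_remainder[where K=K])
      show "0 \<le> K n \<omega>" for n \<omega> unfolding K by (intro sum_nonneg) auto
      show "integrable M (K n)" for n unfolding K by (intro Bochner_Integration.integrable_sum FK(1))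
      show "expectation (K n) \<le> (\<Sum>i\<in>UNIV. \<Sum>j\<le>3. 1 + (\<integral>x. (F i j x)\<^sup>2 \<partial>I.P))" for n
      proof -
        have "expectation (K n) = (\<Sum>i\<in>UNIV. \<Sum>j\<le>3. expectation (\<lambda>\<omega>. sqrt (real n) * \<bar>avg (\<lambda>i. X i \<omega>) n (F i j)\<bar>))"
          unfolding K by (simp only: Bochner_Integration.integral_sum Bochner_Integration.integrable_sum FK(1))
        also have "\<dots> \<le> (\<Sum>i\<in>UNIV. \<Sum>j\<le>3. 1 + (\<integral>x. (F i j x)\<^sup>2 \<partial>I.P))" by (intro sum_mono FK(2))
        finally show ?thesis .
      qed
      show "AE \<omega> in M. (\<lambda>n. R n \<omega> / (1 + K n \<omega>)) \<longlonglongrightarrow> 0"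
        using path
      proof eventually_elim
        case (elim \<omega>)
        from maximizer_path.remainder_tendsto[OF elim, of b] show ?case
          by (simp add: R_def Y_def W_def K_def)
      qed
    qed (rule R)
    \<comment> \<open>The map \<open>iexp\<close> is 1-Lipschitz and of modulus 1, so the truncated
      expectation of the remainder controls the difference of the characteristic functions.\<close>
    have bound: "cmod (expectation (\<lambda>\<omega>. iexp (b \<bullet> Y n \<omega>)) - expectation (\<lambda>\<omega>. iexp (W n \<omega>))) \<le> expectation (\<lambda>\<omega>. min 2 \<bar>R n \<omega>\<bar>)" for n
    proof -
      have i: "integrable M (\<lambda>\<omega>. iexp (b \<bullet> Y n \<omega>))" "integrable M (\<lambda>\<omega>. iexp (W n \<omega>))"
        by (rule integrable_const_bound[where B=1]; simp)+
      have "cmod (expectation (\<lambda>\<omega>. iexp (b \<bullet> Y n \<omega>)) - expectation (\<lambda>\<omega>. iexp (W n \<omega>))) = cmod (expectation (\<lambda>\<omega>. iexp (b \<bullet> Y n \<omega>) - iexp (W n \<omega>)))"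
        using i by simp
      also have "\<dots> \<le> expectation (\<lambda>\<omega>. cmod (iexp (b \<bullet> Y n \<omega>) - iexp (W n \<omega>)))" by (rule integral_norm_bound)
      also have "\<dots> \<le> expectation (\<lambda>\<omega>. min 2 \<bar>R n \<omega>\<bar>)"
      proof (rule integral_mono)
        show "integrable M (\<lambda>\<omega>. cmod (iexp (b \<bullet> Y n \<omega>) - iexp (W n \<omega>)))"
          by (intro integrable_norm Bochner_Integration.integrable_diff i)
        show "integrable M (\<lambda>\<omega>. min 2 \<bar>R n \<omega>\<bar>)" by (intro integrable_const_bound[where B=2]) auto
        show "cmod (iexp (b \<bullet> Y n \<omega>) - iexp (W n \<omega>)) \<le> min 2 \<bar>R n \<omega>\<bar>" for \<omega>
          unfolding R_def by (rule norm_iexp_diff_le)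
      qed
      finally show ?thesis .
    qed
    have "(\<lambda>n. expectation (\<lambda>\<omega>. iexp (b \<bullet> Y n \<omega>)) - expectation (\<lambda>\<omega>. iexp (W n \<omega>))) \<longlonglongrightarrow> 0"
      by (rule Lim_null_comparison[OF always_eventually[OF allI[OF bound]] R0])
    from tendsto_add[OF this S.scaled_average_char_tendsto[OF I.poly_growth_influence I.influence_mean, of b, folded W_def]]
    show ?thesis unfolding I.mvn_Psi_eta_char by simp
  qed
  have "converges_in_distribution M Y (mvn 0 (Psi_eta w1 w2 I.\<beta> I.\<tau> I.\<theta> \<Sigma>))"
    unfolding converges_in_distribution_def
  proof (intro allI impI char_tendsto_imp_integral_tendsto)
    show "prob_space (distr M borel (Y n))" for n by (rule prob_space_distr) measurable
    show "(\<lambda>n. \<integral>x. iexp (b \<bullet> x) \<partial>distr M borel (Y n)) \<longlonglongrightarrow> (\<integral>x. iexp (b \<bullet> x) \<partial>mvn 0 (Psi_eta w1 w2 I.\<beta> I.\<tau> I.\<theta> \<Sigma>))" for b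
      using char[of b] by (subst integral_distr) auto
  qed (auto simp: prob_space_mvn sets_mvn)
  then show ?thesis
    using lim s1 unfolding par Y_def v_def
    by (intro exI[of _ s] conjI allI ballI) auto
qed

end
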